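(* For a positive even integer $n$ and a positive integer $d$ let $f_{n,d}$ be uniformly chosen from $\mathrm{Hom}(T_{n,d},0)$. There exist absolute constants $C,c>0$ such that for any positive even integer $n$ and any positive integer $d$, $$3+\big\lfloor c\sqrt{n2^{-d}}\big\rfloor-2^{1-n/2}\le\mathbb{E}\big[|\mathrm{Rng}(f_{n,d})|\big]\le C(\sqrt{n2^{-d}}+1).$$ Moreover, for any $\epsilon>0$ there exists $\delta>0$ such that for any positive even integer $n$ and any positive integer $d$, $$\mathbb{P}\Big(|\mathrm{Rng}(f_{n,d})|<3+\big\lfloor\delta\sqrt{n2^{-d}}\big\rfloor\Big)\le\epsilon+2^{1-n/2}.$$ In particular, if $d(n)$ are positive integers with $d(n)-\log_2 n\to-\infty$ as $n\to\infty$ ($n$ even), then for any positive integer $r$, $\mathbb{P}\big(|\mathrm{Rng}(f_{n,d(n)})|\le r\big)\to0$ as $n\to\infty$ ($n$ even).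
   Context: For $n\ge1$ even and $d\ge1$, $T_{n,d}$ is the graph with vertex set $\{0,1,\dots,n-1\}$ in which $i,j$ are adjacent iff $\min\{|i-j|,n-|i-j|\}\in\{1,3,\dots,2d+1\}$. $\mathrm{Hom}(T_{n,d},0)$ is the finite set of functions $f\colon\{0,\dots,n-1\}\to\mathbb{Z}$ with $f(0)=0$ and $|f(i)-f(j)|=1$ whenever $i,j$ are adjacent in $T_{n,d}$. $\mathrm{Rng}(f)$ denotes the set of values taken by $f$, and $|\cdot|$ is cardinality. *)

theory Defs
  imports "HOL-Probability.Probability"
begin

text \<open>The vertices of \<open>T\<^sub>n\<^sub>,\<^sub>d\<close> are the elements of \<open>{..<n}\<close>; the distances are taken in the integers
  because subtraction of natural numbers truncates.\<close>

definition torus_adj :: "nat \<Rightarrow> nat \<Rightarrow> nat \<Rightarrow> nat \<Rightarrow> bool" where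
  "torus_adj n d i j \<longleftrightarrow> i < n \<and> j < n \<and>
     min \<bar>int i - int j\<bar> (int n - \<bar>int i - int j\<bar>) \<in> {2 * int k + 1 |k. k \<le> d}"

text \<open>A function on the vertex set is represented by its extensional representative (equal to
  \<open>undefined\<close> off \<open>{..<n}\<close>), so that distinct elements differ on the vertex set.\<close>

definition torus_Hom :: "nat \<Rightarrow> nat \<Rightarrow> (nat \<Rightarrow> int) set" where
  "torus_Hom n d = {f \<in> {..<n} \<rightarrow>\<^sub>E UNIV. f 0 = 0 \<and>
     (\<forall>i j. torus_adj n d i j \<longrightarrow> \<bar>f i - f j\<bar> = 1)}"

definition Rng :: "nat \<Rightarrow> (nat \<Rightarrow> int) \<Rightarrow> int set" where
  "Rng n f = f ` {..<n}"

definition random_hom :: "nat \<Rightarrow> nat \<Rightarrow> (nat \<Rightarrow> int) pmf" where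
  "random_hom n d = pmf_of_set (torus_Hom n d)"

text \<open>The filter expressing that \<open>n \<rightarrow> \<infinity>\<close> through even values.\<close>

definition even_at_top :: "nat filter" where
  "even_at_top = inf at_top (principal {n. even n})"

text \<open>The next two lemmas show that the uniform distribution \<open>pmf_of_set\<close> is meaningful here.\<close>

lemma finite_torus_Hom:
  assumes "even n" "n > 0"
  shows "finite (torus_Hom n d)"
proof -
  have "torus_Hom n d \<subseteq> {..<n} \<rightarrow>\<^sub>E {- int n..int n}"
  proof
    fix f assume f: "f \<in> torus_Hom n d"
    have adj: "torus_adj n d (Suc i) i" if "Suc i < n" for i
      using that unfolding torus_adj_def by (auto intro!: exI[of _ 0])
    have step: "\<bar>f (Suc i) - f i\<bar> = 1" if "Suc i < n" for i
      using f adj[OF that] unfolding torus_Hom_def by blast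
    have bound: "i < n \<Longrightarrow> \<bar>f i\<bar> \<le> int i" for i
    proof (induction i)
      case 0
      then show ?case using f by (simp add: torus_Hom_def)
    next
      case (Suc i)
      then show ?case using step[of i] by linarith
    qed
    have "f i \<in> {- int n..int n}" if "i < n" for i
      using bound[OF that] that by (simp add: abs_le_iff)
    then show "f \<in> {..<n} \<rightarrow>\<^sub>E {- int n..int n}"
      using f by (auto simp: torus_Hom_def PiE_iff)
  qed
  then show ?thesis
    by (rule finite_subset) (simp add: finite_PiE)
qed

lemma torus_Hom_nonempty:
  assumes "even n" "n > 0"
  shows "torus_Hom n d \<noteq> {}"
proof -
  let ?f = "\<lambda>i\<in>{..<n}. int (i mod 2)"
  have "\<bar>?f i - ?f j\<bar> = 1" if "torus_adj n d i j" for i j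
  proof -
    have ij: "i < n" "j < n" using that by (auto simp: torus_adj_def)
    have "odd (min \<bar>int i - int j\<bar> (int n - \<bar>int i - int j\<bar>))"
      using that by (auto simp: torus_adj_def)
    then have "odd (int i - int j)"
      using assms(1) by (auto simp: min_def split: if_splits)
    then have "odd i \<noteq> odd j" by simp
    then show ?thesis
      using ij by (cases "even i"; cases "even j") (auto simp: even_iff_mod_2_eq_zero odd_iff_mod_2_eq_one)
  qed
  then have "?f \<in> torus_Hom n d"
    using assms(2) unfolding torus_Hom_def by simp
  then show ?thesis by blast
qed

end

theory Submission
  imports Defs
begin

text \<open>
  While \<open>f\<close> is followed around the cycle, within any \<open>2 d + 2\<close> consecutive vertices one of the two
  parity classes is constant, because these vertices span a complete bipartite graph. Hence \<open>f\<close> is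
  spelled by a cyclic word: a letter of duration 2 lets the other class choose its next value freely,
  a letter of duration \<open>2 d + 1\<close> exchanges the roles of the two classes and moves the constant
  value by one step. With \<open>2 x\<^sup>2 + x\<^bsup>2d+1\<^esup> = 1\<close> all words of duration \<open>n\<close> get the same weight
  \<open>x\<^sup>n\<close> when the letters are drawn independently with weight \<open>x\<close> to the power of their duration.
  The constant value then performs a persistent random walk that moves at rate \<open>q = x\<^bsup>2d+1\<^esup>\<close>, which is
  of order \<open>2\<^sup>-\<^sup>d\<close>, and \<open>f\<close> is this walk conditioned to return to its initial state at time \<open>n\<close>.
  The conditioning costs a factor of order \<open>sqrt (n q)\<close>, by the Cauchy-Schwarz inequality applied to
  two independent halves; anticoncentration of a third part of the walk, whose signs are fair coins,
  gains this factor back. The two bounds on the range thus follow from a maximal inequality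
  and from anticoncentration for the unconditioned walk.
\<close>

text \<open>The scale throughout is \<open>b = sqrt (1 + n q)\<close>, comparable with
  \<open>1 + sqrt (n / 2 ^ d)\<close>. The weight \<open>x ^ n * card (torus_Hom n d)\<close> is at
  least of order \<open>1 / b\<close>. Against it stand two upper bounds. The peak of the walk,
  summed with weights over closed words, is of constant order: a factor \<open>b\<close> for the
  peak meets \<open>1 / b\<close> for the exact return. Words of range at most \<open>R\<close> have
  weight of order \<open>(1 + R) / b ^ 2\<close>: confinement and exact return are charged to
  different stretches of letters. Quotients then have order \<open>b\<close> and
  \<open>(1 + R) / b\<close>. The obstacle is that closed words have a fixed duration, while
  independence holds for a fixed number of letters. A weighted count of words of duration
  \<open>t\<close> becomes an expectation over \<open>t\<close> letters restricted to the event that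
  a letter ends exactly at time \<open>t\<close>. The smoothing stretches have to be over by then;
  by Chebyshev this fails with probability of order \<open>1 / b ^ 2\<close>, small enough for both
  bounds. No bijection between words and homomorphisms is needed: lower counts use an injective
  coding, upper counts a surjective one. If \<open>n < 4 * d + 4\<close>, the graph is complete
  bipartite and is treated by hand.\<close>

section \<open>Words and homomorphisms\<close>

text \<open>At a letter boundary the walk has a height \<open>y\<close>, the current value of the constant class, and
  a sign \<open>s\<close>: the next value of \<open>f\<close> is \<open>y + sg s\<close>. The letter \<open>Sg b\<close> outputs two values and makes
  \<open>b\<close> the new sign; \<open>Jp\<close> outputs \<open>2 d + 1\<close> alternating values and moves the height by \<open>sg s\<close>.\<close>

datatype letter = Sg bool | Jp

lemma UNIV_letter: "(UNIV :: letter set) = {Sg True, Sg False, Jp}"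
proof (intro equalityI subsetI)
  fix a :: letter
  show "a \<in> {Sg True, Sg False, Jp}" by (cases a) auto
qed simp

definition sg :: "bool \<Rightarrow> int" where
  "sg s = (if s then 1 else - 1)"

primrec len :: "nat \<Rightarrow> letter \<Rightarrow> nat" where
  "len d (Sg b) = 2"
| "len d Jp = 2 * d + 1"

definition duration :: "nat \<Rightarrow> letter list \<Rightarrow> nat" where
  "duration d w = sum_list (map (len d) w)"

fun disp :: "bool \<Rightarrow> letter list \<Rightarrow> int" where
  "disp s [] = 0"
| "disp s (Sg b # w) = disp b w"
| "disp s (Jp # w) = sg s + disp s w"

fun final_sign :: "bool \<Rightarrow> letter list \<Rightarrow> bool" where
  "final_sign s [] = s"
| "final_sign s (Sg b # w) = final_sign b w"
| "final_sign s (Jp # w) = final_sign s w"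

definition alt :: "int \<Rightarrow> bool \<Rightarrow> nat \<Rightarrow> int" where
  "alt y s i = (if even i then y else y + sg s)"

text \<open>Past the last letter the path keeps alternating with the final height and sign, so that
  statements about windows reaching beyond the word need no side condition.\<close>

fun word_path :: "nat \<Rightarrow> int \<Rightarrow> bool \<Rightarrow> letter list \<Rightarrow> nat \<Rightarrow> int" where
  "word_path d y s [] i = alt y s i"
| "word_path d y s (Sg b # w) i = (if i < 2 then alt y s i else word_path d y b w (i - 2))"
| "word_path d y s (Jp # w) i =
    (if i < 2 * d + 1 then alt y s i else word_path d (y + sg s) s w (i - (2 * d + 1)))"

lemma duration_simps [simp]:
  "duration d [] = 0"
  "duration d (a # w) = len d a + duration d w"
  "duration d (u @ w) = duration d u + duration d w"
  by (simp_all add: duration_def)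

lemma abs_sg [simp]: "\<bar>sg s\<bar> = 1"
  by (simp add: sg_def)

lemma sg_eq_iff [simp]: "sg s = sg t \<longleftrightarrow> s = t"
  by (auto simp: sg_def)

lemma sg_cases: "sg s = 1 \<or> sg s = - 1"
  by (simp add: sg_def)

lemma len_ge_2: "d > 0 \<Longrightarrow> len d a \<ge> 2"
  by (cases a) auto

lemma len_le: "d > 0 \<Longrightarrow> len d a \<le> 2 * d + 1"
  by (cases a) auto

lemma length_le_duration: "d > 0 \<Longrightarrow> 2 * length w \<le> duration d w"
proof (induction w)
  case (Cons a w)
  then show ?case using len_ge_2[of d a] by simp
qed simp

lemma duration_eq_0_iff: "d > 0 \<Longrightarrow> duration d w = 0 \<longleftrightarrow> w = []"
  using length_le_duration[of d w] by auto

lemma disp_append: "disp s (u @ w) = disp s u + disp (final_sign s u) w"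
  by (induction s u rule: disp.induct) auto

lemma final_sign_append: "final_sign s (u @ w) = final_sign (final_sign s u) w"
  by (induction s u rule: final_sign.induct) auto

lemma path_shift: "word_path d (y + z) s w i = word_path d y s w i + z"
proof (induction d y s w i rule: word_path.induct)
  case (3 d y s w i)
  then show ?case by (auto simp: alt_def algebra_simps)
qed (auto simp: alt_def)

lemma path_append:
  "word_path d y s (u @ w) i =
    (if i < duration d u then word_path d y s u i
     else word_path d (y + disp s u) (final_sign s u) w (i - duration d u))"
  by (induction d y s u i rule: word_path.induct) (auto simp: algebra_simps)

lemma path_beyond:
  assumes "i \<ge> duration d w"
  shows "word_path d y s w i = alt (y + disp s w) (final_sign s w) (i - duration d w)"
  using assms path_append[of d y s w "[]" i] by simp

text \<open>A letter \<open>Sg b\<close> keeps the height and shifts the offset by an even number;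
  the first \<open>Jp\<close> starts at an even offset and outlasts the rest of the window.\<close>

lemma path_even: "even j \<Longrightarrow> j \<le> 2 * d \<Longrightarrow> word_path d y s w j = y"
  by (induction d y s w j rule: word_path.induct) (auto simp: alt_def)

lemma path_odd: "odd j \<Longrightarrow> j \<le> 2 * d + 1 \<Longrightarrow> \<bar>word_path d y s w j - y\<bar> = 1"
proof (induction d y s w j rule: word_path.induct)
  case (3 d y s w i)
  show ?case
  proof (cases "i < 2 * d + 1")
    case True
    then show ?thesis using 3 by (simp add: alt_def)
  next
    case False
    then have "i = 2 * d + 1" using 3 by simp
    then show ?thesis using path_even[of 0 d "y + sg s" s w] by simp
  qed
qed (auto simp: alt_def)

lemma path_0 [simp]: "word_path d y s w 0 = y"
  using path_even[of 0 d y s w] by simp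

lemma path_1 [simp]: "d > 0 \<Longrightarrow> word_path d y s w (Suc 0) = y + sg s"
  by (cases w; cases "hd w") (auto simp: alt_def)

text \<open>The delicate pairs straddle the end of the first letter. If \<open>i\<close> lies in a
  leading \<open>Jp\<close> and \<open>j\<close> behind it, then \<open>k = j - (2 * d + 1)\<close>
  has the parity of \<open>i\<close> and \<open>k \<le> i\<close>, so \<open>path_even\<close> or
  \<open>path_odd\<close> at the next boundary locates the value at \<open>j\<close>.\<close>

lemma path_adjacent:
  "i < j \<Longrightarrow> odd (j - i) \<Longrightarrow> j - i \<le> 2 * d + 1 \<Longrightarrow> \<bar>word_path d y s w j - word_path d y s w i\<bar> = 1"
proof (induction w arbitrary: y s i j)
  case Nil
  then show ?case by (auto simp: alt_def)
next
  case (Cons a w)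
  show ?case
  proof (cases a)
    case (Sg b)
    consider "i = 0" | "i = 1" | "i \<ge> 2" by linarith
    then show ?thesis
    proof cases
      case 1
      then show ?thesis using path_odd[of j d y s "a # w"] Cons.prems by simp
    next
      case 2
      then have j: "even j" "j \<ge> 2" "j \<le> 2 * d + 2" using Cons.prems by auto
      have "word_path d y b w (j - 2) = y"
        by (rule path_even) (use j in auto)
      then show ?thesis using j 2 Sg by (simp add: alt_def)
    next
      case 3
      then show ?thesis using Cons.IH[of "i - 2" "j - 2" y b] Cons.prems Sg by auto
    qed
  next
    case Jp
    consider "j < 2 * d + 1" | "i < 2 * d + 1" "j \<ge> 2 * d + 1" | "i \<ge> 2 * d + 1" by linarith
    then show ?thesis
    proof cases
      case 1
      then show ?thesis using Jp Cons.prems by (auto simp: alt_def)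
    next
      case 2
      define k where "k = j - (2 * d + 1)"
      have j: "j = k + (2 * d + 1)" using 2 by (simp add: k_def)
      have par: "even i \<longleftrightarrow> even k" using Cons.prems j by auto
      have k: "k \<le> i" using Cons.prems j by simp
      show ?thesis
      proof (cases "even i")
        case True
        have "word_path d (y + sg s) s w k = y + sg s"
          by (rule path_even) (use True par k 2 in auto)
        then show ?thesis using True 2 Jp j by (simp add: alt_def)
      next
        case False
        have "\<bar>word_path d (y + sg s) s w k - (y + sg s)\<bar> = 1"
          by (rule path_odd) (use False par k 2 in auto)
        then show ?thesis using False 2 Jp j by (simp add: alt_def)
      qed
    next
      case 3
      have "\<bar>word_path d (y + sg s) s w (j - (2 * d + 1)) - word_path d (y + sg s) s w (i - (2 * d + 1))\<bar> = 1"
        by (rule Cons.IH) (use 3 Cons.prems in auto)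
      then show ?thesis using 3 Jp Cons.prems by simp
    qed
  qed
qed

text \<open>First letters \<open>Sg b\<close> and \<open>Jp\<close> are told apart by two positions:
  after \<open>Jp\<close> position 3 still shows \<open>y + sg s\<close>, which forces
  \<open>b = s\<close>; then position \<open>2 * d + 2\<close> is \<open>y\<close> in one case and
  \<open>y + 2 * sg s\<close> in the other.\<close>

lemma path_inject:
  assumes "d > 0"
  shows "duration d w = duration d w' \<Longrightarrow> word_path d y s w = word_path d y s w' \<Longrightarrow> w = w'"
proof (induction w arbitrary: w' y s)
  case Nil
  then show ?case using duration_eq_0_iff[OF assms, of w'] by simp
next
  case (Cons a w)
  have "w' \<noteq> []"
    using Cons.prems(1) duration_eq_0_iff[OF assms, of "a # w"] by auto
  then obtain a' v where w': "w' = a' # v" by (cases w') auto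
  have eq: "word_path d y s (a # w) i = word_path d y s (a' # v) i" for i
    using Cons.prems(2) w' by simp
  have ne: False
    if "\<And>i. word_path d y s (Sg b # u) i = word_path d y s (Jp # u') i" for b u u'
  proof -
    have "word_path d y b u 1 = word_path d y s (Jp # u') 3" using that[of 3] by simp
    also have "\<dots> = y + sg s"
      using assms by (auto simp: alt_def)
    finally have "b = s" using assms by simp
    then have "word_path d y s u (2 * d) = word_path d y s (Jp # u') (2 * d + 2)"
      using that[of "2 * d + 2"] by simp
    also have "\<dots> = y + 2 * sg s" using assms by simp
    finally show False using path_even[of "2 * d" d y s u] sg_cases[of s] by auto
  qed
  show ?case
  proof (cases a; cases a')
    fix b b' assume a: "a = Sg b" "a' = Sg b'"
    have e: "word_path d y b w i = word_path d y b' v i" for i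
      using eq[of "i + 2"] a by simp
    from e[of 1] have "b = b'" using assms by simp
    then show ?thesis using Cons.IH[of v y b] e Cons.prems(1) a w' by auto
  next
    assume a: "a = Jp" "a' = Jp"
    have "word_path d (y + sg s) s w i = word_path d (y + sg s) s v i" for i
      using eq[of "i + (2 * d + 1)"] a by simp
    then have "word_path d (y + sg s) s w = word_path d (y + sg s) s v" by (intro ext)
    then show ?thesis using Cons.IH[of v] Cons.prems(1) a w' by auto
  next
    fix b assume "a = Sg b" "a' = Jp"
    then show ?thesis using ne[of b w v] eq by simp
  next
    fix b assume "a = Jp" "a' = Sg b"
    then show ?thesis using ne[of b v w] eq by simp
  qed
qed

section \<open>Closed words as homomorphisms\<close>

definition closed_words :: "nat \<Rightarrow> nat \<Rightarrow> bool \<Rightarrow> letter list set" where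
  "closed_words n d s = {w. duration d w = n \<and> disp s w = 0 \<and> final_sign s w = s}"

lemma finite_duration: "d > 0 \<Longrightarrow> finite {w. duration d w = t}"
proof -
  assume d: "d > 0"
  then have "finite {w. set w \<subseteq> (UNIV :: letter set) \<and> length w \<le> t}"
    by (intro finite_lists_length_le) (simp add: UNIV_letter)
  then show ?thesis
  proof (rule rev_finite_subset, intro subsetI)
    fix w assume "w \<in> {w. duration d w = t}"
    then show "w \<in> {w. set w \<subseteq> UNIV \<and> length w \<le> t}"
      using length_le_duration[OF d, of w] by simp
  qed
qed

lemma path_closed_twice:
  assumes "w \<in> closed_words n d s" "i < 2 * n"
  shows "word_path d y s (w @ w) i = word_path d y s w (i mod n)"
  using assms by (auto simp: path_append closed_words_def mod_if)

definition hom_of_word :: "nat \<Rightarrow> nat \<Rightarrow> bool \<Rightarrow> letter list \<Rightarrow> nat \<Rightarrow> int" where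
  "hom_of_word n d s w = (\<lambda>i\<in>{..<n}. word_path d 0 s w i)"

text \<open>An edge across the origin of the cycle becomes an ordinary pair of positions in the
  doubled word, whose path is periodic because the word is closed.\<close>

lemma hom_of_word_in_torus_Hom:
  assumes w: "w \<in> closed_words n d s" and "d > 0" "n > 0" "even n"
  shows "hom_of_word n d s w \<in> torus_Hom n d"
proof -
  have main: "\<bar>word_path d 0 s w j - word_path d 0 s w i\<bar> = 1"
    if "torus_adj n d i j" "i < j" for i j
  proof -
    from that obtain k where k: "k \<le> d" and ij: "i < n" "j < n"
      "min \<bar>int i - int j\<bar> (int n - \<bar>int i - int j\<bar>) = 2 * int k + 1"
      by (auto simp: torus_adj_def)
    have "\<bar>int i - int j\<bar> = int (j - i)" using that(2) by simp
    then consider "j - i = 2 * k + 1" | "n - (j - i) = 2 * k + 1"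
      using ij that(2) by (auto simp: min_def split: if_splits)
    then show ?thesis
    proof cases
      case 1
      show ?thesis by (rule path_adjacent) (use 1 that k in auto)
    next
      case 2
      have "i + n - j = 2 * k + 1" using 2 that ij by simp
      then have "\<bar>word_path d 0 s (w @ w) (i + n) - word_path d 0 s (w @ w) j\<bar> = 1"
        by (intro path_adjacent) (use k ij in simp_all)
      then show ?thesis
        using path_closed_twice[OF w, of "i + n" 0] path_closed_twice[OF w, of j 0] ij
        by simp
    qed
  qed
  have sym: "torus_adj n d i j \<longleftrightarrow> torus_adj n d j i" for i j
    by (auto simp: torus_adj_def abs_minus_commute)
  have neq: "\<not> torus_adj n d i i" for i
    by (auto simp: torus_adj_def min_def)
  show ?thesis
    unfolding torus_Hom_def
  proof (intro CollectI conjI allI impI)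
    show "hom_of_word n d s w \<in> {..<n} \<rightarrow>\<^sub>E UNIV" "hom_of_word n d s w 0 = 0"
      using assms by (auto simp: hom_of_word_def)
  next
    fix i j assume ij: "torus_adj n d i j"
    then have "i < n" "j < n" by (auto simp: torus_adj_def)
    moreover have "\<bar>word_path d 0 s w i - word_path d 0 s w j\<bar> = 1"
      using main[of i j] main[of j i] ij sym neq by (metis abs_minus_commute linorder_cases)
    ultimately show "\<bar>hom_of_word n d s w i - hom_of_word n d s w j\<bar> = 1"
      by (simp add: hom_of_word_def)
  qed
qed

lemma inj_on_hom_of_word:
  assumes "d > 0"
  shows "inj_on (hom_of_word n d s) (closed_words n d s)"
proof (rule inj_onI)
  fix w w' assume w: "w \<in> closed_words n d s" "w' \<in> closed_words n d s"
    and eq: "hom_of_word n d s w = hom_of_word n d s w'"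
  have "word_path d 0 s w i = word_path d 0 s w' i" for i
  proof (cases "i < n")
    case True
    then show ?thesis using fun_cong[OF eq, of i] by (simp add: hom_of_word_def)
  next
    case False
    then show ?thesis using w by (simp add: path_beyond closed_words_def)
  qed
  then show "w = w'"
    by (intro path_inject[OF assms]) (use w in \<open>auto simp: closed_words_def\<close>)
qed

text \<open>No letter has a jump of the path strictly inside it, so the jump at \<open>t + N\<close> forces a letter
  to end there.\<close>

lemma word_path_parse:
  fixes g :: "nat \<Rightarrow> int"
  assumes d: "d > 0"
    and adj: "\<And>i k. odd k \<Longrightarrow> k \<le> 2 * d + 1 \<Longrightarrow> \<bar>g (i + k) - g i\<bar> = 1"
  shows "\<lbrakk>\<forall>j\<le>2 * d. even j \<longrightarrow> g (t + j) = g t; t + N > 0; g (t + N - 1) \<noteq> g (t + N + 1)\<rbrakk> \<Longrightarrow>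
    \<exists>w. duration d w = N \<and> (\<forall>i\<le>N + 1. word_path d (g t) (g (t + 1) > g t) w i = g (t + i))"
proof (induction N arbitrary: t rule: less_induct)
  case (less N)
  note flat = less.prems(1)
  define s where "s = (g (t + 1) > g t)"
  have g1: "g (t + 1) = g t + sg s"
    using adj[of 1 t] by (auto simp: s_def sg_def)
  show ?case
  proof (cases "N = 0")
    case True
    then have "word_path d (g t) s [] i = g (t + i)" if "i \<le> N + 1" for i
      using that g1 True by (auto simp: alt_def le_Suc_eq)
    then show ?thesis using True by (intro exI[of _ "[]"]) (auto simp: s_def)
  next
    case N0: False
    show ?thesis
    \<comment> \<open>The value \<open>2 * d + 2\<close> steps ahead decides the letter. If it
      equals \<open>g t\<close>, the current class is still constant when seen from
      \<open>t + 2\<close>, and the letter is an \<open>Sg\<close>. Otherwise it differs by 2, which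
      makes the other class constant too, and the letter is \<open>Jp\<close>.\<close>
    proof (cases "g (t + 2 * d + 2) = g t")
      case True
      have g2: "g (t + 2) = g t" using flat[rule_format, of 2] d by simp
      have "N \<noteq> 1" using less.prems(3) g2 by auto
      then have N2: "N \<ge> 2" using N0 by simp
      have flat2: "\<forall>j\<le>2 * d. even j \<longrightarrow> g (t + 2 + j) = g (t + 2)"
      proof (intro allI impI)
        fix j assume j: "j \<le> 2 * d" "even j"
        show "g (t + 2 + j) = g (t + 2)"
        proof (cases "j = 2 * d")
          case True
          then show ?thesis using \<open>g (t + 2 * d + 2) = g t\<close> g2
            by (simp add: algebra_simps)
        next
          case False
          then have "j + 2 \<le> 2 * d" using j by presburger
          then have "g (t + (j + 2)) = g t" using flat[rule_format, of "j + 2"] j(2) by simp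
          then show ?thesis using g2 by (simp add: algebra_simps)
        qed
      qed
      have e: "t + 2 + (N - 2) = t + N" using N2 by simp
      have jump2: "t + 2 + (N - 2) > 0" "g (t + 2 + (N - 2) - 1) \<noteq> g (t + 2 + (N - 2) + 1)"
        unfolding e using less.prems(2,3) by simp_all
      obtain w where w: "duration d w = N - 2"
        "\<forall>i\<le>N - 2 + 1. word_path d (g (t + 2)) (g (t + 2 + 1) > g (t + 2)) w i = g (t + 2 + i)"
        using less.IH[OF _ flat2 jump2] N2 by auto
      define b where "b = (g (t + 2 + 1) > g (t + 2))"
      have "word_path d (g t) s (Sg b # w) i = g (t + i)" if "i \<le> N + 1" for i
      proof (cases "i < 2")
        case True
        then show ?thesis using g1 by (auto simp: alt_def less_2_cases_iff)
      next
        case False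
        then have "word_path d (g t) b w (i - 2) = g (t + 2 + (i - 2))"
          using w(2) that N2 g2 unfolding b_def by auto
        moreover have "t + 2 + (i - 2) = t + i" using False by simp
        ultimately show ?thesis using False by simp
      qed
      then show ?thesis using w(1) N2
        by (intro exI[of _ "Sg b # w"]) (auto simp: s_def)
    next
      case False
      have top: "\<bar>g (t + 2 * d + 2) - g (t + j)\<bar> = 1" if "odd j" "j \<le> 2 * d + 1" for j
        using adj[of "2 * d + 2 - j" "t + j"] that odd_pos[OF that(1)] by simp
      have side: "\<bar>g (t + j) - g t\<bar> = 1" if "odd j" "j \<le> 2 * d + 1" for j
        using adj[of j t] that by simp
      have gtop: "g (t + 2 * d + 2) = g t + 2 * sg s"
        using top[of 1] False g1 sg_cases[of s] by auto
      have odd_val: "g (t + j) = g t + sg s" if "odd j" "j \<le> 2 * d + 1" for j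
        using top[OF that] side[OF that] gtop sg_cases[of s] by auto
      have even_val: "g (t + j) = g t" if "even j" "j \<le> 2 * d" for j
        using flat that by simp
      \<comment> \<open>Both classes are constant on this window, so no jump sits at a position
        before \<open>2 * d + 1\<close>.\<close>
      have N_ge: "N \<ge> 2 * d + 1"
      proof (rule ccontr)
        assume "\<not> N \<ge> 2 * d + 1"
        then have N: "N \<le> 2 * d" by simp
        show False
        proof (cases "even N")
          case True
          then show False
            using odd_val[of "N - 1"] odd_val[of "N + 1"] N N0 less.prems(3) by auto
        next
          case odd: False
          then have "N + 1 \<le> 2 * d" using N by presburger
          then show False
            using even_val[of "N - 1"] even_val[of "N + 1"] N N0 odd less.prems(3) by auto
        qed
      qed
      define t' where "t' = t + (2 * d + 1)"
      have gt': "g t' = g t + sg s" using odd_val[of "2 * d + 1"] by (simp add: t'_def)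
      \<comment> \<open>For \<open>j > 0\<close> these positions are adjacent to
        \<open>t + 2 * d\<close> and to \<open>t + 2 * d + 2\<close>, whose values differ by 2, and
        hence take the middle value.\<close>
      have flat': "\<forall>j\<le>2 * d. even j \<longrightarrow> g (t' + j) = g t'"
      proof (intro allI impI)
        fix j assume j: "j \<le> 2 * d" "even j"
        show "g (t' + j) = g t'"
        proof (cases "j = 0")
          case False
          have "\<bar>g (t' + j) - g (t + 2 * d)\<bar> = 1"
            using adj[of "j + 1" "t + 2 * d"] j by (simp add: t'_def algebra_simps)
          moreover have "\<bar>g (t' + j) - g (t + 2 * d + 2)\<bar> = 1"
            using adj[of "j - 1" "t + 2 * d + 2"] j False by (simp add: t'_def algebra_simps)
          ultimately show ?thesis
            using gt' gtop even_val[of "2 * d"] sg_cases[of s] by (auto simp: add.assoc)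
        qed simp
      qed
      have sg': "g (t' + 1) > g t' \<longleftrightarrow> s"
        using gtop gt' by (auto simp: t'_def sg_def algebra_simps)
      have e: "t' + (N - (2 * d + 1)) = t + N" using N_ge by (simp add: t'_def)
      have jump': "t' + (N - (2 * d + 1)) > 0"
        "g (t' + (N - (2 * d + 1)) - 1) \<noteq> g (t' + (N - (2 * d + 1)) + 1)"
        unfolding e using less.prems(2,3) by simp_all
      obtain w where w: "duration d w = N - (2 * d + 1)"
        "\<forall>i\<le>N - (2 * d + 1) + 1. word_path d (g t') s w i = g (t' + i)"
        using less.IH[OF _ flat' jump', unfolded sg'] N_ge by auto
      have "word_path d (g t) s (Jp # w) i = g (t + i)" if "i \<le> N + 1" for i
      proof (cases "i < 2 * d + 1")
        case True
        then show ?thesis using odd_val[of i] even_val[of i] by (simp add: alt_def)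
      next
        case False
        then have "word_path d (g t + sg s) s w (i - (2 * d + 1)) = g (t' + (i - (2 * d + 1)))"
          using w(2) that N_ge gt' by auto
        moreover have "t' + (i - (2 * d + 1)) = t + i" using False by (simp add: t'_def)
        ultimately show ?thesis using False by simp
      qed
      then show ?thesis using w(1) N_ge
        by (intro exI[of _ "Jp # w"]) (auto simp: s_def)
    qed
  qed
qed

section \<open>Rotation of closed words and parsing of a homomorphism\<close>

lemma split_at_time:
  "\<tau> < duration d w \<Longrightarrow>
    \<exists>u a v. w = u @ a # v \<and> duration d u \<le> \<tau> \<and> \<tau> < duration d u + len d a"
proof (induction w arbitrary: \<tau>)
  case (Cons a w)
  show ?case
  proof (cases "\<tau> < len d a")
    case True
    then show ?thesis by (intro exI[of _ "[]"]) auto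
  next
    case False
    then obtain u b v where "w = u @ b # v" "duration d u \<le> \<tau> - len d a"
      "\<tau> - len d a < duration d u + len d b"
      using Cons.IH[of "\<tau> - len d a"] Cons.prems by fastforce
    then show ?thesis using False by (intro exI[of _ "a # u"]) auto
  qed
qed simp

lemma closed_words_rotate:
  assumes w: "u @ v \<in> closed_words n d s"
  shows "v @ u \<in> closed_words n d (final_sign s u)"
    and "i < n \<Longrightarrow> word_path d (disp s u) (final_sign s u) (v @ u) i
      = word_path d 0 s (u @ v) ((i + duration d u) mod n)"
proof -
  have e: "duration d u + duration d v = n" "disp s u + disp (final_sign s u) v = 0"
    "final_sign (final_sign s u) v = s"
    using w by (auto simp: closed_words_def disp_append final_sign_append)
  show "v @ u \<in> closed_words n d (final_sign s u)"
    using e by (auto simp: closed_words_def disp_append final_sign_append)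
  assume i: "i < n"
  show "word_path d (disp s u) (final_sign s u) (v @ u) i
      = word_path d 0 s (u @ v) ((i + duration d u) mod n)"
  proof (cases "i < duration d v")
    case True
    then show ?thesis using e i by (auto simp: path_append)
  next
    case False
    then have "i + duration d u = i - duration d v + n"
      using e i by simp
    then have "(i + duration d u) mod n = i - duration d v"
      using i by (metis mod_add_self2 mod_less less_imp_diff_less)
    moreover have "i - duration d v < duration d u" using False e i by simp
    ultimately show ?thesis using False e i by (auto simp: path_append)
  qed
qed

text \<open>Parsing starts just after a jump; by periodicity the same jump recurs one turn later,
  where the word has to end, so the word is closed. Rotation then puts the letter in progress at the
  origin first, and \<open>c\<close> is its age there. The subtracted value restores
  \<open>f 0 = 0\<close>. The bound on \<open>n\<close> makes every odd step
  \<open>k \<le> 2 * d + 1\<close> at most \<open>n / 2\<close>, so that it is a cyclic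
  distance.\<close>

lemma torus_Hom_parse:
  assumes f: "f \<in> torus_Hom n d" and d: "d > 0" and n: "even n" "n \<ge> 4 * d + 4"
  shows "\<exists>s a v c. a # v \<in> closed_words n d s \<and> c < len d a \<and>
    (\<forall>i<n. f i = word_path d 0 s (a # v) ((i + c) mod n) - word_path d 0 s (a # v) c)"
proof -
  define g where "g i = f (i mod n)" for i
  have f_adj: "\<bar>f i - f j\<bar> = 1" if "torus_adj n d i j" for i j
    using f that by (auto simp: torus_Hom_def)
  have f0: "f 0 = 0" using f by (simp add: torus_Hom_def)
  have adj: "\<bar>g (i + k) - g i\<bar> = 1" if k: "odd k" "k \<le> 2 * d + 1" for i k
  proof -
    define a where "a = i mod n"
    have a: "a < n" using n by (simp add: a_def)
    have b: "(i + k) mod n = (if a + k < n then a + k else a + k - n)"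
    proof -
      have "(i + k) mod n = (a + k) mod n" by (simp add: a_def mod_add_left_eq)
      then show ?thesis using a k n by (auto simp: mod_if)
    qed
    obtain m where m: "k = 2 * m + 1" using k(1) oddE by blast
    have "torus_adj n d ((i + k) mod n) a"
      unfolding torus_adj_def b using a k n m by (auto intro!: exI[of _ m] simp: min_def)
    then show ?thesis using f_adj unfolding g_def a_def by blast
  qed
  have per: "g (i + n) = g i" for i by (simp add: g_def)
  show ?thesis
  proof (cases "\<exists>t. g t \<noteq> g (t + 2)")
    \<comment> \<open>Without a jump no letter boundary is forced: \<open>f\<close> alternates
      between two values and is spelled by copies of \<open>Sg s\<close>.\<close>
    case False
    define s where "s = (g 1 > 0)"
    have g0: "g 0 = 0" using f0 by (simp add: g_def)
    have g1: "g 1 = sg s" using adj[of 1 0] g0 by (auto simp: s_def sg_def)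
    have galt: "g i = alt 0 s i" for i
    proof (induction i rule: nat_less_induct)
      case (1 i)
      consider "i = 0" | "i = 1" | j where "i = j + 2"
        by (metis One_nat_def Suc_1 add.commute less_2_cases not_less le_iff_add)
      then show ?case
      proof cases
        case 3
        then show ?thesis using 1[rule_format, of j] False by (simp add: alt_def)
      qed (use g0 g1 in \<open>auto simp: alt_def\<close>)
    qed
    define m where "m = n div 2"
    have m: "n = 2 * m" "m > 0" using n by (auto simp: m_def)
    define w where "w = replicate m (Sg s)"
    have 1: "duration d w = n" "disp s w = 0" "final_sign s w = s"
    proof -
      have "disp s (replicate k (Sg s)) = 0" "final_sign s (replicate k (Sg s)) = s" for k
        by (induction k) auto
      then show "duration d w = n" "disp s w = 0" "final_sign s w = s"
        using m(1) by (auto simp: w_def duration_def sum_list_replicate)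
    qed
    have "word_path d y s (replicate k (Sg s)) i = alt y s i" for k y i
      by (induction k arbitrary: i) (auto simp: alt_def)
    then have "word_path d 0 s w i = g i" for i using galt by (simp add: w_def)
    moreover obtain m' where "m = Suc m'" using m(2) by (cases m) auto
    ultimately show ?thesis using 1 f0
      by (intro exI[of _ s] exI[of _ "Sg s"] exI[of _ "replicate m' (Sg s)"] exI[of _ 0])
        (auto simp: closed_words_def w_def g_def)
  next
    case True
    then obtain t1 where t1: "g t1 \<noteq> g (t1 + 2)" by blast
    define t where "t = t1 + 1"
    \<comment> \<open>Each \<open>t + j\<close> is adjacent to both sides \<open>t1\<close> and
      \<open>t1 + 2\<close> of the jump, whose values differ by 2.\<close>
    have flat: "\<forall>j\<le>2 * d. even j \<longrightarrow> g (t + j) = g t"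
    proof (intro allI impI)
      fix j assume j: "j \<le> 2 * d" "even j"
      have *: "\<bar>g (t + j) - g t1\<bar> = 1" if "even j" "j \<le> 2 * d" for j
        using adj[of "j + 1" t1] that by (simp add: t_def algebra_simps)
      have **: "\<bar>g (t + j) - g (t1 + 2)\<bar> = 1" if "even j" "j \<le> 2 * d" for j
      proof (cases "j = 0")
        case True
        then show ?thesis using adj[of 1 t] by (auto simp: t_def)
      next
        case False
        then show ?thesis using adj[of "j - 1" "t1 + 2"] that by (simp add: t_def algebra_simps)
      qed
      from *[of j] **[of j] *[of 0] **[of 0] j t1 show "g (t + j) = g t" by auto
    qed
    define s where "s = (g (t + 1) > g t)"
    have jump: "g (t + n - 1) \<noteq> g (t + n + 1)"
      using t1 per[of t1] per[of "t1 + 2"] by (simp add: t_def add.commute add.left_commute)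
    obtain w where w: "duration d w = n" "\<forall>i\<le>n + 1. word_path d (g t) s w i = g (t + i)"
      using word_path_parse[OF d adj flat _ jump] unfolding s_def t_def by auto
    have e1: "g t + disp s w = g t"
      using w path_beyond[of d w n "g t" s] per[of t] by (auto simp: alt_def)
    \<comment> \<open>The agreement one step beyond the end of the word is what identifies the final
      sign.\<close>
    have "g t + disp s w + sg (final_sign s w) = g (t + 1)"
      using w path_beyond[of d w "n + 1" "g t" s] per[of "t + 1"]
      by (auto simp: alt_def algebra_simps)
    moreover have "g (t + 1) = g t + sg s"
      using adj[of 1 t] by (auto simp: s_def sg_def)
    ultimately have closed: "w \<in> closed_words n d s"
      using w e1 by (auto simp: closed_words_def)
    have gw: "g (t + i) = g t + word_path d 0 s w (i mod n)" for i
    proof -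
      have "i mod n < n" using n by simp
      then have "word_path d (g t) s w (i mod n) = g (t + i mod n)" using w(2) by simp
      also have "\<dots> = g (t + i)" by (simp add: g_def mod_add_right_eq)
      finally show ?thesis using path_shift[of d 0 "g t" s w "i mod n"] by simp
    qed
    \<comment> \<open>The waiting time from \<open>t\<close> to the origin of the cycle; the outer
      \<open>mod n\<close> yields 0 instead of \<open>n\<close> when \<open>t\<close> is already a
      multiple of \<open>n\<close>.\<close>
    define \<tau> where "\<tau> = (n - t mod n) mod n"
    have tau: "\<tau> < n" "(t + \<tau>) mod n = 0"
    proof -
      show "\<tau> < n" using n by (simp add: \<tau>_def)
      have "(t + \<tau>) mod n = (t mod n + (n - t mod n)) mod n"
        by (simp add: \<tau>_def mod_add_left_eq mod_add_right_eq)
      also have "t mod n + (n - t mod n) = n" using n by (simp add: less_imp_le)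
      finally show "(t + \<tau>) mod n = 0" by simp
    qed
    obtain u a v where uv: "w = u @ a # v" "duration d u \<le> \<tau>" "\<tau> < duration d u + len d a"
      using split_at_time[of \<tau> d w] tau w(1) by auto
    define c where "c = \<tau> - duration d u"
    define s' where "s' = final_sign s u"
    have cl: "u @ (a # v) \<in> closed_words n d s" using closed uv(1) by simp
    have cl': "a # v @ u \<in> closed_words n d s'"
      using closed_words_rotate(1)[OF cl] by (simp add: s'_def)
    have c: "c < len d a" "\<tau> = c + duration d u" using uv by (auto simp: c_def)
    have "c < n" using c tau by simp
    have rot: "word_path d 0 s' (a # v @ u) j + disp s u = word_path d 0 s w ((j + duration d u) mod n)"
      if "j < n" for j
      using closed_words_rotate(2)[OF cl that] path_shift[of d 0 "disp s u" s' "a # v @ u" j]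
      by (simp add: s'_def uv(1))
    have val: "f i = word_path d 0 s' (a # v @ u) ((i + c) mod n) - word_path d 0 s' (a # v @ u) c"
      if "i < n" for i
    proof -
      have "f i = g (t + (\<tau> + i))"
      proof -
        have "(t + (\<tau> + i)) mod n = ((t + \<tau>) mod n + i) mod n"
          by (simp add: mod_add_left_eq add.assoc)
        then show ?thesis using tau(2) that by (simp add: g_def)
      qed
      also have "\<dots> = g t + word_path d 0 s w ((\<tau> + i) mod n)" by (rule gw)
      also have "(\<tau> + i) mod n = ((i + c) mod n + duration d u) mod n"
        by (simp only: c(2) mod_add_left_eq) (simp add: ac_simps)
      also have "word_path d 0 s w \<dots> = word_path d 0 s' (a # v @ u) ((i + c) mod n) + disp s u"
        using rot[of "(i + c) mod n"] n by simp
      finally have 1: "f i = g t + (word_path d 0 s' (a # v @ u) ((i + c) mod n) + disp s u)" .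
      have "0 = g (t + \<tau>)" using tau f0 by (simp add: g_def)
      also have "\<dots> = g t + word_path d 0 s w (\<tau> mod n)" by (rule gw)
      also have "word_path d 0 s w (\<tau> mod n) = word_path d 0 s' (a # v @ u) c + disp s u"
        using rot[of c] \<open>c < n\<close> c(2) by simp
      finally show ?thesis using 1 by simp
    qed
    show ?thesis using cl' c(1) val
      by (intro exI[of _ s'] exI[of _ a] exI[of _ "v @ u"] exI[of _ c]) auto
  qed
qed

section \<open>Range and counting\<close>

text \<open>Only heights at letter boundaries count; inside a letter the path differs from them by
  at most 1.\<close>

fun peak :: "int \<Rightarrow> bool \<Rightarrow> letter list \<Rightarrow> int" where
  "peak y s [] = \<bar>y\<bar>"
| "peak y s (Sg b # w) = max \<bar>y\<bar> (peak y b w)"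
| "peak y s (Jp # w) = max \<bar>y\<bar> (peak (y + sg s) s w)"

lemma abs_le_peak: "\<bar>y\<bar> \<le> peak y s w"
  by (induction y s w rule: peak.induct) auto

lemma peak_nonneg: "0 \<le> peak y s w"
  using abs_le_peak[of y s w] by linarith

lemma peak_append: "peak y s (u @ w) = max (peak y s u) (peak (y + disp s u) (final_sign s u) w)"
proof (induction y s u rule: peak.induct)
  case (1 y s)
  then show ?case by (simp add: max_absorb2 abs_le_peak)
next
  case (2 y s b u)
  then show ?case by (simp only: append_Cons peak.simps disp.simps final_sign.simps max.assoc)
next
  case (3 y s u)
  then show ?case
    by (simp only: append_Cons peak.simps disp.simps final_sign.simps max.assoc add.assoc)
qed

lemma abs_disp_le_peak: "\<bar>y + disp s u\<bar> \<le> peak y s u"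
  using peak_append[of y s u "[]"] by simp

lemma peak_take: "peak y s (take k w) \<le> peak y s w"
  using peak_append[of y s "take k w" "drop k w"] by simp

lemma peak_shift: "peak (y + z) s w \<le> \<bar>z\<bar> + peak y s w"
proof (induction y s w rule: peak.induct)
  case (2 y s b w)
  then show ?case by auto
next
  case (3 y s w)
  then have "peak (y + z + sg s) s w \<le> \<bar>z\<bar> + peak (y + sg s) s w"
    by (simp add: algebra_simps)
  then show ?case by auto
qed auto

lemma abs_path_le_peak: "\<bar>word_path d y s w i\<bar> \<le> peak y s w + 1"
proof (induction d y s w i rule: word_path.induct)
  case (1 d y s i)
  then show ?case using abs_sg[of s] by (auto simp: alt_def simp del: abs_sg)
next
  case (2 d y s b w i)
  then show ?case using abs_sg[of s] by (auto simp: alt_def simp del: abs_sg)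
next
  case (3 d y s w i)
  then show ?case using abs_sg[of s] by (auto simp: alt_def simp del: abs_sg)
qed

text \<open>By the discrete intermediate value theorem the image contains every integer between 0
  and \<open>p m\<close>.\<close>

lemma card_image_ge_abs:
  fixes p :: "nat \<Rightarrow> int"
  assumes "p 0 = 0" "\<And>i. \<bar>p (Suc i) - p i\<bar> \<le> 1" "m < n"
  shows "\<bar>p m\<bar> + 1 \<le> int (card (p ` {..<n}))"
proof -
  have main: "\<bar>r m\<bar> + 1 \<le> int (card (r ` {..<n}))"
    if r: "r 0 = 0" "\<And>i. \<bar>r (Suc i) - r i\<bar> \<le> 1" "r m \<ge> 0" for r :: "nat \<Rightarrow> int"
  proof -
    have "{0..r m} \<subseteq> r ` {..<n}"
    proof
      fix k assume k: "k \<in> {0..r m}"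
      obtain i where "i \<le> m" "r i = k"
        using nat_intermed_int_val[of 0 m r k] r k by auto
      then show "k \<in> r ` {..<n}" using assms(3) by auto
    qed
    then have "card {0..r m} \<le> card (r ` {..<n})"
      by (intro card_mono) auto
    then show ?thesis using r(3) by simp
  qed
  show ?thesis
  proof (cases "p m \<ge> 0")
    case True
    then show ?thesis using main[of p] assms by simp
  next
    case False
    have "(\<lambda>i. - p i) ` {..<n} = uminus ` (p ` {..<n})" by auto
    then have "card ((\<lambda>i. - p i) ` {..<n}) = card (p ` {..<n})"
      by (simp add: card_image)
    then show ?thesis using main[of "\<lambda>i. - p i"] assms False
      by (simp add: abs_minus_commute)
  qed
qed

text \<open>A cyclic shift of the positions and the subtraction of a constant leave the cardinality
  of the image unchanged, so the range can be counted on the path of the word itself.\<close>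

lemma
  assumes w: "w \<in> closed_words n d s" and d: "d > 0" and n: "n > 0"
    and f: "\<forall>i<n. f i = word_path d 0 s w ((i + c) mod n) - word_path d 0 s w c"
  shows card_Rng_le_peak: "int (card (Rng n f)) \<le> 2 * peak 0 s w + 3"
    and abs_disp_less_card_Rng: "w = u @ v \<Longrightarrow> \<bar>disp s u\<bar> + 1 \<le> int (card (Rng n f))"
proof -
  let ?p = "word_path d 0 s w"
  have perm: "(\<lambda>i. (i + c) mod n) ` {..<n} = {..<n}"
  proof (intro equalityI subsetI)
    fix j assume "j \<in> {..<n}"
    then have "((j + (n - c mod n)) mod n + c) mod n = j"
    proof -
      have "((j + (n - c mod n)) mod n + c) mod n = ((j + (n - c mod n)) + c mod n) mod n"
        by (simp only: mod_add_left_eq mod_add_right_eq)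
      also have "(j + (n - c mod n)) + c mod n = j + n"
        using mod_less_divisor[OF n, of c] by linarith
      finally show ?thesis using \<open>j \<in> {..<n}\<close> by simp
    qed
    then show "j \<in> (\<lambda>i. (i + c) mod n) ` {..<n}" 
      by (intro image_eqI[of _ _ "(j + (n - c mod n)) mod n"]) (use n in simp_all)
  qed (use n in auto)
  have "Rng n f = (\<lambda>z. z - ?p c) ` (?p ` {..<n})"
  proof -
    have "Rng n f = (\<lambda>i. ?p ((i + c) mod n) - ?p c) ` {..<n}"
      unfolding Rng_def using f by (intro image_cong) auto
    also have "\<dots> = (\<lambda>z. z - ?p c) ` (?p ` ((\<lambda>i. (i + c) mod n) ` {..<n}))"
      by (simp add: image_image)
    finally show ?thesis using perm by simp
  qed
  moreover have "inj (\<lambda>z :: int. z - ?p c)" by (auto simp: inj_def)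
  ultimately have card: "card (Rng n f) = card (?p ` {..<n})"
    by (simp add: card_image inj_on_subset[OF _ subset_UNIV])
  have "?p ` {..<n} \<subseteq> {- peak 0 s w - 1..peak 0 s w + 1}"
  proof
    fix z assume "z \<in> ?p ` {..<n}"
    then obtain i where "z = ?p i" by blast
    then show "z \<in> {- peak 0 s w - 1..peak 0 s w + 1}"
      using abs_path_le_peak[of d 0 s w i] by auto
  qed
  then have "card (?p ` {..<n}) \<le> card {- peak 0 s w - 1..peak 0 s w + 1}"
    by (intro card_mono) auto
  then show "int (card (Rng n f)) \<le> 2 * peak 0 s w + 3"
    using card peak_nonneg[of 0 s w] by simp
  assume uv: "w = u @ v"
  have step: "\<bar>?p (Suc i) - ?p i\<bar> \<le> 1" for i
    using path_adjacent[of i "Suc i" d 0 s w] by simp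
  show "\<bar>disp s u\<bar> + 1 \<le> int (card (Rng n f))"
  proof (cases "duration d u < n")
    case True
    have "?p (duration d u) = disp s u" by (simp add: uv path_append)
    then show ?thesis
      using card_image_ge_abs[of ?p "duration d u" n] step True card by simp
  next
    case False
    then have "duration d v = 0" using w uv by (auto simp: closed_words_def)
    then have "disp s u = 0" using w uv duration_eq_0_iff[OF d] by (auto simp: closed_words_def)
    then show ?thesis
      using card_image_ge_abs[of ?p 0 n] step n card by simp
  qed
qed

lemma finite_closed_words: "d > 0 \<Longrightarrow> finite (closed_words n d s)"
  by (rule finite_subset[OF _ finite_duration[of d n]]) (auto simp: closed_words_def)

text \<open>Every homomorphism comes from some triple of a sign, a closed word and a phase
  \<open>c\<close> inside the first letter. Multiple representations only enlarge the right-hand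
  side, and the number of phases produces the factor \<open>len d (hd w)\<close>.\<close>

lemma sum_torus_Hom_le:
  fixes \<phi> :: "(nat \<Rightarrow> int) \<Rightarrow> real" and \<gamma> :: "bool \<Rightarrow> letter list \<Rightarrow> real"
  assumes d: "d > 0" and n: "even n" "n \<ge> 4 * d + 4"
    and nonneg: "\<And>s w. \<gamma> s w \<ge> 0"
    and le: "\<And>f s w c. w \<in> closed_words n d s \<Longrightarrow>
      \<forall>i<n. f i = word_path d 0 s w ((i + c) mod n) - word_path d 0 s w c \<Longrightarrow> \<phi> f \<le> \<gamma> s w"
  shows "(\<Sum>f\<in>torus_Hom n d. \<phi> f)
    \<le> (\<Sum>s\<in>UNIV. \<Sum>w\<in>closed_words n d s. real (len d (hd w)) * \<gamma> s w)"
proof -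
  let ?T = "SIGMA s:UNIV. SIGMA w:closed_words n d s. {..<len d (hd w)}"
  let ?F = "\<lambda>(s, w, c). \<lambda>i\<in>{..<n}. word_path d 0 s w ((i + c) mod n) - word_path d 0 s w c"
  have fin: "finite (closed_words n d s)" for s using finite_closed_words[OF d] .
  have "(\<Sum>f\<in>torus_Hom n d. \<phi> f) \<le> (\<Sum>(s, w, c)\<in>?T. \<gamma> s w)"
  proof (rule sum_le_included[where i = ?F])
    show "finite (torus_Hom n d)" using n by (intro finite_torus_Hom) auto
    show "finite ?T" using fin by auto
    show "\<forall>y\<in>?T. 0 \<le> (case y of (s, w, c) \<Rightarrow> \<gamma> s w)" using nonneg by auto
    show "\<forall>f\<in>torus_Hom n d. \<exists>y\<in>?T. ?F y = f \<and> \<phi> f \<le> (case y of (s, w, c) \<Rightarrow> \<gamma> s w)"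
    proof
      fix f assume f: "f \<in> torus_Hom n d"
      obtain s a v c where *: "a # v \<in> closed_words n d s" "c < len d a"
        "\<forall>i<n. f i = word_path d 0 s (a # v) ((i + c) mod n) - word_path d 0 s (a # v) c"
        using torus_Hom_parse[OF f d n] by blast
      have "?F (s, a # v, c) = f"
        using f * by (auto simp: torus_Hom_def PiE_def extensional_def fun_eq_iff)
      moreover have "\<phi> f \<le> \<gamma> s (a # v)" using le[OF *(1,3)] .
      ultimately show "\<exists>y\<in>?T. ?F y = f \<and> \<phi> f \<le> (case y of (s, w, c) \<Rightarrow> \<gamma> s w)"
        using * by (intro bexI[of _ "(s, a # v, c)"]) auto
    qed
  qed
  also have "\<dots> = (\<Sum>s\<in>UNIV. \<Sum>w\<in>closed_words n d s. \<Sum>c<len d (hd w). \<gamma> s w)"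
  proof -
    have "(\<Sum>(s, w, c)\<in>?T. \<gamma> s w) =
      (\<Sum>s\<in>UNIV. \<Sum>(w, c)\<in>(SIGMA w:closed_words n d s. {..<len d (hd w)}). \<gamma> s w)"
      using fin by (subst sum.Sigma) (auto simp: split_def)
    also have "\<dots> = (\<Sum>s\<in>UNIV. \<Sum>w\<in>closed_words n d s. \<Sum>c<len d (hd w). \<gamma> s w)"
      using fin by (intro sum.cong refl, subst sum.Sigma) (auto simp: split_def)
    finally show ?thesis .
  qed
  finally show ?thesis by simp
qed

section \<open>Gluing two halves into a closed word\<close>

fun flip_letter :: "letter \<Rightarrow> letter" where
  "flip_letter (Sg b) = Sg (\<not> b)"
| "flip_letter Jp = Jp"

lemma sg_not [simp]: "sg (\<not> s) = - sg s"
  by (simp add: sg_def)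

lemma disp_flip: "disp (\<not> s) (map flip_letter w) = - disp s w"
  by (induction s w rule: disp.induct) auto

lemma duration_flip: "duration d (map flip_letter w) = duration d w"
proof (induction w)
  case (Cons a w)
  then show ?case by (cases a) auto
qed simp

lemma flip_letter_inject: "flip_letter a = flip_letter b \<longleftrightarrow> a = b"
  by (cases a; cases b) auto

lemma append_eq_duration:
  assumes "d > 0" "u @ v = u' @ v'" "duration d u = duration d u'"
  shows "u = u' \<and> v = v'"
proof -
  obtain r where "u = u' @ r \<or> u' = u @ r"
    using assms(2) by (auto simp: append_eq_append_conv2)
  then have "duration d r = 0" using assms(3) by auto
  then have "r = []" using duration_eq_0_iff[OF assms(1)] by simp
  then show ?thesis using \<open>u = u' @ r \<or> u' = u @ r\<close> assms(2) by auto
qed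

definition words_to :: "nat \<Rightarrow> nat \<Rightarrow> int \<Rightarrow> letter list set" where
  "words_to t d y = {w. duration d w = t \<and> disp True w = y}"

lemma finite_words_to: "d > 0 \<Longrightarrow> finite (words_to t d y)"
  by (rule finite_subset[OF _ finite_duration[of d t]]) (auto simp: words_to_def)

text \<open>Each pair \<open>u\<close>, \<open>v\<close> with a common displacement \<open>y\<close>
  is glued into a closed word: \<open>u\<close> climbs by \<open>y\<close>, and the flipped
  \<open>v\<close>, read from the opposite sign, comes back. The letters in between set the signs,
  and leading copies of \<open>Sg True\<close> fill up the duration. Known durations allow the pair
  to be recovered. The sum of squares is the form that Cauchy-Schwarz bounds from below.\<close>

lemma card_torus_Hom_ge:
  assumes d: "d > 0" and n: "n = 2 * m + 2 * t + 4" "m > 0" and Y: "finite Y"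
  shows "(\<Sum>y\<in>Y. (card (words_to t d y))\<^sup>2) \<le> card (torus_Hom n d)"
proof -
  let ?T = "SIGMA y:Y. words_to t d y \<times> words_to t d y"
  let ?w = "\<lambda>(y :: int, u, v). replicate m (Sg True) @ u @ [Sg False] @ map flip_letter v @ [Sg True]"
  have rep: "disp True (replicate m (Sg True)) = 0" "final_sign True (replicate m (Sg True)) = True"
    by (induction m) auto
  have inj: "inj_on ?w ?T"
  proof (rule inj_onI)
    fix p p' assume p: "p \<in> ?T" "p' \<in> ?T" "?w p = ?w p'"
    obtain y u v y' u' v' where pp: "p = (y, u, v)" "p' = (y', u', v')"
      by (cases p; cases p') auto
    have u: "u \<in> words_to t d y" "u' \<in> words_to t d y'"
      "v \<in> words_to t d y" "v' \<in> words_to t d y'"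
      and eq: "replicate m (Sg True) @ u @ [Sg False] @ map flip_letter v @ [Sg True] =
        replicate m (Sg True) @ u' @ [Sg False] @ map flip_letter v' @ [Sg True]"
      using p unfolding pp by auto
    then have "u = u' \<and> [Sg False] @ map flip_letter v @ [Sg True] = [Sg False] @ map flip_letter v' @ [Sg True]"
      by (intro append_eq_duration[OF d]) (auto simp: words_to_def)
    then have "u = u'" "map flip_letter v = map flip_letter v'" by auto
    moreover have "inj flip_letter" by (auto simp: inj_def flip_letter_inject)
    ultimately show "p = p'"
      using u unfolding pp by (auto simp: words_to_def dest: map_injective)
  qed
  have sub: "?w ` ?T \<subseteq> closed_words n d True"
  proof clarify
    fix y u v assume "u \<in> words_to t d y" "v \<in> words_to t d y"
    then show "replicate m (Sg True) @ u @ [Sg False] @ map flip_letter v @ [Sg True]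
        \<in> closed_words n d True"
      using rep n disp_flip[of True v]
      by (auto simp: closed_words_def words_to_def disp_append final_sign_append duration_flip)
        (auto simp: duration_def sum_list_replicate)
  qed
  have "(\<Sum>y\<in>Y. (card (words_to t d y))\<^sup>2) = card ?T"
    using Y finite_words_to[OF d] by (subst card_SigmaI) (auto simp: card_cartesian_product power2_eq_square)
  also have "\<dots> = card (?w ` ?T)" using inj by (simp add: card_image)
  also have "\<dots> \<le> card (closed_words n d True)"
    by (intro card_mono finite_closed_words d sub)
  also have "\<dots> = card (hom_of_word n d True ` closed_words n d True)"
    using inj_on_hom_of_word[OF d] by (simp add: card_image)
  also have "\<dots> \<le> card (torus_Hom n d)"
    using n d by (intro card_mono finite_torus_Hom) (auto intro: hom_of_word_in_torus_Hom)
  finally show ?thesis .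
qed

section \<open>Ranges with two or three values\<close>

lemma torus_adj_Suc: "Suc i < n \<Longrightarrow> torus_adj n d (Suc i) i"
  unfolding torus_adj_def by (auto intro!: exI[of _ 0])

lemma torus_Hom_Suc:
  "f \<in> torus_Hom n d \<Longrightarrow> Suc i < n \<Longrightarrow> \<bar>f (Suc i) - f i\<bar> = 1"
  using torus_adj_Suc by (auto simp: torus_Hom_def)

lemma finite_Rng [simp]: "finite (Rng n f)"
  by (simp add: Rng_def)

lemma card_Rng_ge_2:
  assumes "f \<in> torus_Hom n d" "n \<ge> 2"
  shows "card (Rng n f) \<ge> 2"
proof -
  have "{f 0, f 1} \<subseteq> Rng n f" using assms by (auto simp: Rng_def)
  then have "card {f 0, f 1} \<le> card (Rng n f)" by (intro card_mono) auto
  moreover have "f 0 \<noteq> f 1" using torus_Hom_Suc[OF assms(1), of 0] assms(2) by auto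
  ultimately show ?thesis by simp
qed

text \<open>An odd cyclic distance is at most \<open>n / 2\<close>, hence at most
  \<open>2 * d + 1\<close>, so the graph is complete bipartite. If the odd class takes both values 1
  and -1, the even class must be constantly 0.\<close>

lemma card_Rng_le_3:
  assumes f: "f \<in> torus_Hom n d" and n: "n \<ge> 2" "even n" "n < 4 * d + 4"
  shows "card (Rng n f) \<le> 3"
proof -
  have adj: "\<bar>f i - f j\<bar> = 1" if "i < n" "j < n" "odd i" "even j" for i j
  proof -
    have "odd (min \<bar>int i - int j\<bar> (int n - \<bar>int i - int j\<bar>))"
      using that n(2) by (auto simp: min_def)
    then obtain k where k: "min \<bar>int i - int j\<bar> (int n - \<bar>int i - int j\<bar>) = 2 * k + 1"
      by (auto elim: oddE)
    have "min \<bar>int i - int j\<bar> (int n - \<bar>int i - int j\<bar>) \<ge> 0" using that by auto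
    then have "k \<ge> 0" using k by linarith
    have "2 * (2 * k + 1) \<le> int n" using k by (simp add: min_def split: if_splits)
    moreover have "int n < 4 * int d + 4" using n(3) by linarith
    ultimately have "k \<le> int d" by presburger
    then have "torus_adj n d i j"
      unfolding torus_adj_def using that k \<open>k \<ge> 0\<close> by (auto intro!: exI[of _ "nat k"])
    then show ?thesis using f by (auto simp: torus_Hom_def)
  qed
  have f0: "f 0 = 0" using f by (simp add: torus_Hom_def)
  have odd1: "\<bar>f i\<bar> = 1" if "i < n" "odd i" for i
    using adj[of i 0] that f0 n by simp
  have "\<exists>a. Rng n f \<subseteq> {a - 1..a + 1}"
  proof (cases "\<exists>i<n. odd i \<and> f i \<noteq> f 1")
    case True
    then obtain i where i: "i < n" "odd i" "f i \<noteq> f 1" by blast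
    have "f j = 0" if "j < n" "even j" for j
      using adj[of i j] adj[of 1 j] odd1[of i] odd1[of 1] i that n by (auto simp: abs_if split: if_splits)
    then have "f j \<in> {-1..1}" if "j < n" for j
      using odd1[of j] that by (cases "even j") (auto simp: abs_if split: if_splits)
    then show ?thesis by (intro exI[of _ 0]) (auto simp: Rng_def)
  next
    case False
    have "f j \<in> {f 1 - 1..f 1 + 1}" if "j < n" for j
      using False adj[of 1 j] that n by (cases "even j") (auto simp: abs_if split: if_splits)
    then show ?thesis by (intro exI[of _ "f 1"]) (auto simp: Rng_def)
  qed
  then obtain a where "Rng n f \<subseteq> {a - 1..a + 1}" by blast
  then have "card (Rng n f) \<le> card {a - 1..a + 1}" by (intro card_mono) auto
  then show ?thesis by simp
qed

text \<open>With two values the function has to alternate, and only the direction of its first step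
  is free.\<close>

lemma card_Rng_less_3:
  assumes "n \<ge> 2"
  shows "card {f \<in> torus_Hom n d. card (Rng n f) < 3} \<le> 2"
proof -
  let ?g = "\<lambda>s. \<lambda>i\<in>{..<n}. alt 0 s i"
  have "{f \<in> torus_Hom n d. card (Rng n f) < 3} \<subseteq> {?g True, ?g False}"
  proof
    fix f assume "f \<in> {f \<in> torus_Hom n d. card (Rng n f) < 3}"
    then have f: "f \<in> torus_Hom n d" and c: "card (Rng n f) < 3" by auto
    define s where "s = (f 1 > 0)"
    have f0: "f 0 = 0" using f by (simp add: torus_Hom_def)
    have f1: "f 1 = sg s" using torus_Hom_Suc[OF f, of 0] assms f0 by (auto simp: s_def sg_def)
    have "{f 0, f 1} \<subseteq> Rng n f" using assms by (auto simp: Rng_def)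
    then have sub: "{0, sg s} \<subseteq> Rng n f" by (simp only: f0 f1)
    have "card {0, sg s} = 2" using sg_cases[of s] by auto
    then have R: "Rng n f = {0, sg s}"
      using card_seteq[OF _ sub] c by simp
    have "f i = alt 0 s i" if "i < n" for i
      using that
    proof (induction i)
      case (Suc i)
      have "f (Suc i) \<in> {0, sg s}" using R Suc.prems by (auto simp: Rng_def)
      then show ?case using Suc torus_Hom_Suc[OF f, of i] sg_cases[of s] by (auto simp: alt_def split: if_splits)
    qed (simp add: alt_def f0)
    then have "f = ?g s"
      using f by (auto simp: torus_Hom_def PiE_def extensional_def fun_eq_iff)
    then show "f \<in> {?g True, ?g False}" by (cases s) auto
  qed
  then have "card {f \<in> torus_Hom n d. card (Rng n f) < 3} \<le> card {?g True, ?g False}"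
    by (intro card_mono) auto
  also have "\<dots> \<le> 2" by (simp add: card_insert_if)
  finally show ?thesis .
qed

text \<open>Zero on even positions and free signs on odd ones. Dividing the two functions of
  \<open>card_Rng_less_3\<close> by this count gives the error term
  \<open>2 powr (1 - n / 2)\<close>.\<close>

lemma card_torus_Hom_ge_power:
  assumes n: "even n" "n > 0"
  shows "2 ^ (n div 2) \<le> card (torus_Hom n d)"
proof -
  let ?A = "{i. i < n \<and> odd i}"
  let ?g = "\<lambda>X. \<lambda>i\<in>{..<n}. if even i then 0 else if i \<in> X then 1 else (- 1 :: int)"
  have sub: "?g ` Pow ?A \<subseteq> torus_Hom n d"
  proof clarify
    fix X assume "X \<subseteq> ?A"
    have "\<bar>?g X i - ?g X j\<bar> = 1" if "torus_adj n d i j" for i j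
    proof -
      have ij: "i < n" "j < n" using that by (auto simp: torus_adj_def)
      have "odd (min \<bar>int i - int j\<bar> (int n - \<bar>int i - int j\<bar>))"
        using that by (auto simp: torus_adj_def)
      then have "odd (int i - int j)"
        using n(1) by (auto simp: min_def split: if_splits)
      then have "odd i \<noteq> odd j" by simp
      then show ?thesis using ij by auto
    qed
    then show "?g X \<in> torus_Hom n d" using n unfolding torus_Hom_def by auto
  qed
  have inj: "inj_on ?g (Pow ?A)"
  proof (rule inj_onI)
    fix X X' assume X: "X \<in> Pow ?A" "X' \<in> Pow ?A" and eq: "?g X = ?g X'"
    have "i \<in> X \<longleftrightarrow> i \<in> X'" if "i \<in> ?A" for i
      using fun_cong[OF eq, of i] that by (auto split: if_splits)
    then show "X = X'" using X by blast
  qed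
  have "?A = (\<lambda>k. 2 * k + 1) ` {..<n div 2}"
    using n by (auto elim!: oddE)
  then have "card ?A = n div 2"
    by (simp add: card_image inj_on_def)
  then have "2 ^ (n div 2) = card (Pow ?A)" by (simp add: card_Pow)
  also have "\<dots> = card (?g ` Pow ?A)" using inj by (simp add: card_image)
  also have "\<dots> \<le> card (torus_Hom n d)"
    using sub n by (intro card_mono finite_torus_Hom)
  finally show ?thesis .
qed

section \<open>Anticoncentration\<close>

text \<open>For central coefficients of even rows,
  \<open>(2 * m + 1) * (2 * m + 3) \<le> 4 * (m + 1) ^ 2\<close> drives the induction; in an odd row
  the largest coefficient is half of the next central one.\<close>

lemma binomial_sq_le: "real (r choose k) ^ 2 * (real r + 1) \<le> 4 ^ r"
proof -
  have even: "real ((2 * m) choose m) ^ 2 * (2 * real m + 1) \<le> 4 ^ (2 * m)" for m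
  proof (induction m)
    case (Suc m)
    have "Suc m * ((2 * Suc m) choose (Suc m)) = 2 * (2 * m + 1) * ((2 * m) choose m)"
    proof -
      have "Suc m * ((2 * m + 1) choose Suc m) = (2 * m + 1) * ((2 * m) choose m)"
        using Suc_times_binomial[of m "2 * m"] by simp
      moreover have "(2 * m + 1) choose m = (2 * m + 1) choose Suc m"
        using binomial_symmetric[of m "2 * m + 1"] by simp
      ultimately show ?thesis by (simp add: algebra_simps)
    qed
    then have "real (Suc m * ((2 * Suc m) choose (Suc m))) = real (2 * (2 * m + 1) * ((2 * m) choose m))"
      by (rule arg_cong)
    then have e: "real ((2 * Suc m) choose (Suc m)) =
        2 * (2 * real m + 1) / (real m + 1) * real ((2 * m) choose m)"
      by (simp add: field_simps)
    define B where "B = real ((2 * m) choose m)"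
    have "real ((2 * Suc m) choose (Suc m)) ^ 2 * (2 * real (Suc m) + 1) =
        (B ^ 2 * (2 * real m + 1)) * (4 * (2 * real m + 1) * (2 * real m + 3) / (real m + 1) ^ 2)"
      unfolding e B_def by (simp add: field_simps power2_eq_square)
    also have "\<dots> \<le> 4 ^ (2 * m) * 16"
    proof (rule mult_mono)
      show "4 * (2 * real m + 1) * (2 * real m + 3) / (real m + 1) ^ 2 \<le> 16"
      proof (subst pos_divide_le_eq)
        show "0 < (real m + 1) ^ 2" by simp
        show "4 * (2 * real m + 1) * (2 * real m + 3) \<le> 16 * (real m + 1) ^ 2"
          by (simp add: power2_eq_square algebra_simps)
      qed
    qed (use Suc.IH in \<open>auto simp: B_def\<close>)
    finally show ?case by simp
  qed simp
  have mid: "real (r choose (r div 2)) ^ 2 * (real r + 1) \<le> 4 ^ r"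
  proof (cases "even r")
    case True
    then show ?thesis using even[of "r div 2"] by (auto elim!: evenE)
  next
    case False
    then obtain m where r: "r = 2 * m + 1" by (elim oddE)
    have "(2 * m + 1) choose m = (2 * m + 1) choose Suc m"
      using binomial_symmetric[of m "2 * m + 1"] by simp
    then have "(2 * Suc m) choose Suc m = 2 * ((2 * m + 1) choose m)" by simp
    then have e: "real ((2 * Suc m) choose Suc m) = 2 * real ((2 * m + 1) choose m)" by simp
    have "(2 * real ((2 * m + 1) choose m)) ^ 2 * (2 * real (Suc m) + 1) \<le> 4 ^ (2 * Suc m)"
      using even[of "Suc m"] unfolding e .
    then have "4 * (real ((2 * m + 1) choose m) ^ 2 * (2 * real m + 3)) \<le> 4 ^ (2 * Suc m)"
      unfolding power_mult_distrib by (simp add: algebra_simps)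
    moreover have "real ((2 * m + 1) choose m) ^ 2 * (2 * real m + 2) \<le>
        real ((2 * m + 1) choose m) ^ 2 * (2 * real m + 3)"
      by (intro mult_left_mono) auto
    moreover have "(4 :: real) ^ (2 * Suc m) = 4 * 4 ^ (2 * m + 1)" by simp
    ultimately have "real ((2 * m + 1) choose m) ^ 2 * (2 * real m + 2) \<le> 4 ^ (2 * m + 1)"
      by linarith
    then show ?thesis by (simp add: r ac_simps)
  qed
  have "real (r choose k) \<le> real (r choose (r div 2))"
    using binomial_maximum by simp
  then have "real (r choose k) ^ 2 * (real r + 1) \<le> real (r choose (r div 2)) ^ 2 * (real r + 1)"
    by (intro mult_right_mono power_mono) auto
  then show ?thesis using mid by linarith
qed

lemma binomial_le_inverse_sqrt: "real (r choose k) / 2 ^ r \<le> 1 / sqrt (real r + 1)"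
proof -
  have "(real (r choose k) / 2 ^ r) ^ 2 \<le> 1 / (real r + 1)"
    using binomial_sq_le[of r k]
    by (simp add: field_simps power2_eq_square flip: power_mult_distrib)
  then have "sqrt ((real (r choose k) / 2 ^ r) ^ 2) \<le> sqrt (1 / (real r + 1))"
    by (rule real_sqrt_le_mono)
  then show ?thesis by (simp add: real_sqrt_divide)
qed

lemma sum_choose_Suc:
  fixes F :: "nat \<Rightarrow> real"
  shows "(\<Sum>k\<le>Suc r. real (Suc r choose k) * F k) = (\<Sum>k\<le>r. real (r choose k) * (F k + F (Suc k)))"
proof -
  have "(\<Sum>k\<le>Suc r. real (Suc r choose k) * F k)
      = F 0 + (\<Sum>k\<le>r. real (Suc r choose Suc k) * F (Suc k))"
    by (subst sum.atMost_Suc_shift) simp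
  also have "\<dots> = F 0 + (\<Sum>k\<le>r. real (r choose Suc k) * F (Suc k))
      + (\<Sum>k\<le>r. real (r choose k) * F (Suc k))"
    by (simp add: sum.distrib algebra_simps)
  also have "F 0 + (\<Sum>k\<le>r. real (r choose Suc k) * F (Suc k)) = (\<Sum>k\<le>Suc r. real (r choose k) * F k)"
    by (subst sum.atMost_Suc_shift) simp
  also have "\<dots> = (\<Sum>k\<le>r. real (r choose k) * F k)" by simp
  finally show ?thesis by (simp add: sum.distrib algebra_simps)
qed

text \<open>\<open>X\<close> measures the fair signs collected so far, and with probability
  \<open>p\<close> one more is gained. By convexity the average exceeds
  \<open>1 / sqrt (X + p)\<close>; conceding half of the mean gain repairs this. The proof bounds
  the square of the average by the average of the squares.\<close>

lemma inverse_sqrt_step: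
  assumes X: "X \<ge> (1 :: real)" and p: "0 \<le> p" "p \<le> 1"
  shows "(1 - p) * (1 / sqrt X) + p * (1 / sqrt (X + 1)) \<le> 1 / sqrt (X + p / 2)"
proof -
  let ?a = "1 / sqrt X" and ?b = "1 / sqrt (X + 1)"
  have "(1 - p) * a ^ 2 + p * b ^ 2 - ((1 - p) * a + p * b) ^ 2 = p * (1 - p) * (a - b) ^ 2"
    for a b :: real
    by (simp add: algebra_simps power2_eq_square)
  from this[of ?a ?b] have "((1 - p) * ?a + p * ?b) ^ 2 \<le> (1 - p) * ?a ^ 2 + p * ?b ^ 2"
    using p by (metis diff_ge_0_iff_ge mult_nonneg_nonneg zero_le_power2)
  also have "\<dots> = (1 - p) / X + p / (X + 1)"
    using X by (simp add: power_divide)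
  also have "\<dots> \<le> 1 / (X + p / 2)"
  proof -
    have "(1 - p) / X + p / (X + 1) = (X + 1 - p) / (X * (X + 1))"
      using X by (simp add: field_simps)
    moreover have "(X + 1 - p) * (X + p / 2) \<le> X * (X + 1)"
    proof -
      have "0 \<le> p * (X - 1 + p)" using X p by simp
      then show ?thesis by (simp add: algebra_simps)
    qed
    ultimately show ?thesis
      using X p by (simp add: divide_le_eq le_divide_eq)
  qed
  finally have "sqrt (((1 - p) * ?a + p * ?b) ^ 2) \<le> sqrt (1 / (X + p / 2))"
    by (rule real_sqrt_le_mono)
  then show ?thesis using X p by (simp add: real_sqrt_divide)
qed

section \<open>Letter boundaries in time\<close>

lemma duration_take_mono: "j \<le> k \<Longrightarrow> duration d (take j w) \<le> duration d (take k w)"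
proof -
  assume "j \<le> k"
  then have "take k w = take j w @ take (k - j) (drop j w)"
    by (metis le_add_diff_inverse take_add)
  then show ?thesis by simp
qed

lemma duration_take_strict:
  assumes "d > 0" "j < k" "k \<le> length w"
  shows "duration d (take j w) < duration d (take k w)"
proof -
  have "take k w = take j w @ take (k - j) (drop j w)"
    using assms(2) by (metis le_add_diff_inverse less_imp_le take_add)
  moreover have "duration d (take (k - j) (drop j w)) > 0"
    using length_le_duration[OF assms(1), of "take (k - j) (drop j w)"] assms by simp
  ultimately show ?thesis by simp
qed

text \<open>The exact return event. Starting time and height are parameters so that the word can be
  cut after a prefix and the starting height can be summed over.\<close>

definition hits :: "nat \<Rightarrow> nat \<Rightarrow> int \<Rightarrow> bool \<Rightarrow> nat \<Rightarrow> int \<Rightarrow> letter list \<Rightarrow> bool" where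
  "hits d t z s \<tau> y w \<longleftrightarrow>
     (\<exists>k\<le>length w. \<tau> + duration d (take k w) = t \<and> y + disp s (take k w) = z)"

lemma hits_append:
  assumes "hits d t z s \<tau> y (u @ w)" "\<tau> + duration d u \<le> t" "d > 0"
  shows "hits d t z (final_sign s u) (\<tau> + duration d u) (y + disp s u) w"
proof -
  obtain k where k: "k \<le> length (u @ w)" "\<tau> + duration d (take k (u @ w)) = t"
    "y + disp s (take k (u @ w)) = z"
    using assms(1) by (auto simp: hits_def)
  have "k \<ge> length u"
  proof (rule ccontr)
    assume "\<not> k \<ge> length u"
    then have "duration d (take k (u @ w)) < duration d (take (length u) (u @ w))"
      by (intro duration_take_strict assms) auto
    then show False using k assms by simp
  qed
  then show ?thesis
    using k unfolding hits_def
    by (intro exI[of _ "k - length u"]) (auto simp: disp_append add.assoc)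
qed

text \<open>Durations grow strictly along prefixes, so the time \<open>t\<close> fixes the prefix,
  and the displacement of a prefix does not depend on the starting height.\<close>

lemma hits_unique:
  assumes "hits d t z s \<tau> y w" "hits d t z s \<tau> y' w" "d > 0"
  shows "y = y'"
proof -
  obtain k k' where k: "k \<le> length w" "\<tau> + duration d (take k w) = t" "y + disp s (take k w) = z"
    and k': "k' \<le> length w" "\<tau> + duration d (take k' w) = t" "y' + disp s (take k' w) = z"
    using assms(1,2) by (auto simp: hits_def)
  have "k = k'"
    using duration_take_strict[OF assms(3), of k k' w] duration_take_strict[OF assms(3), of k' k w]
      k k' by (cases k k' rule: linorder_cases) auto
  then show ?thesis using k k' by simp
qed

text \<open>As a function of the starting height the hitting probability thus has total mass at most
  1, as the anticoncentration bound requires.\<close>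

lemma sum_hits_le_1: "finite Y \<Longrightarrow> d > 0 \<Longrightarrow> (\<Sum>y\<in>Y. of_bool (hits d t z s \<tau> y w)) \<le> (1 :: real)"
proof -
  assume Y: "finite Y" and d: "d > 0"
  have "(\<Sum>y\<in>Y. of_bool (hits d t z s \<tau> y w)) = real (card {y \<in> Y. hits d t z s \<tau> y w})"
    using Y by (simp add: Int_def)
  moreover have "card {y \<in> Y. hits d t z s \<tau> y w} \<le> 1"
    using hits_unique[OF _ _ d] Y by (subst One_nat_def, subst card_le_Suc0_iff_eq) auto
  ultimately show ?thesis by simp
qed

section \<open>Weights of letters and expectation over random words\<close>

locale letter_weights =
  fixes d :: nat and x :: real
  assumes d_pos: "d > 0" and x_pos: "x > 0" and x_eq: "2 * x ^ 2 + x ^ (2 * d + 1) = 1"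
begin

definition q :: real where
  "q = x ^ (2 * d + 1)"

lemma x_sq: "x ^ 2 = (1 - q) / 2"
  using x_eq by (simp add: q_def)

lemma q_pos: "q > 0"
  using x_pos by (simp add: q_def)

lemma x_less_3_4: "x < 3 / 4"
proof (rule ccontr)
  assume "\<not> x < 3 / 4"
  then have "x ^ 2 \<ge> (3 / 4) ^ 2" by (intro power_mono) auto
  then show False using x_sq q_pos by (simp add: power2_eq_square)
qed

lemma x_ge_half: "x \<ge> 1 / 2"
proof (rule ccontr)
  assume "\<not> x \<ge> 1 / 2"
  then have *: "x < 1 / 2" by simp
  have "x ^ 2 \<le> (1 / 2) ^ 2" using * x_pos by (intro power_mono) auto
  moreover have "q \<le> x ^ 1"
    unfolding q_def using * x_pos by (intro power_decreasing) auto
  ultimately show False using x_sq * by (simp add: power2_eq_square)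
qed

lemma q_le_half: "q \<le> 1 / 2"
proof -
  have "(1 / 2) ^ 2 \<le> x ^ 2" using x_ge_half by (intro power_mono) auto
  then show ?thesis using x_sq by (simp add: power2_eq_square)
qed

lemma q_eq: "q = x * (1 - q) ^ d / 2 ^ d"
proof -
  have "q = x * (x ^ 2) ^ d" by (simp add: q_def power_mult)
  also have "\<dots> = x * (1 - q) ^ d / 2 ^ d" unfolding x_sq by (simp add: power_divide)
  finally show ?thesis .
qed

lemma q_le: "q \<le> (3 / 4) / 2 ^ d"
proof -
  have "(1 - q) ^ d \<le> 1" using q_pos q_le_half by (intro power_le_one) auto
  then have "x * (1 - q) ^ d \<le> (3 / 4) * 1"
    using x_less_3_4 x_pos q_le_half by (intro mult_mono) auto
  then show ?thesis using q_eq by (simp add: field_simps)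
qed

text \<open>The mean duration of a letter is \<open>2 + (2 * d - 1) * q\<close>, so this keeps it
  bounded uniformly in \<open>d\<close>. The constant is \<open>3 / 4\<close> from
  \<open>q_le\<close> times the largest value \<open>3 / 4\<close> of
  \<open>(2 * d - 1) / 2 ^ d\<close>, attained at \<open>d = 2\<close>.\<close>

lemma q_mult_le: "(2 * real d - 1) * q \<le> 9 / 16"
proof -
  have "4 * (2 * real k + 1) \<le> 3 * 2 ^ (Suc k)" for k
  proof (cases k)
    case (Suc m)
    have "4 * (2 * real (Suc m) + 1) \<le> 3 * 2 ^ (Suc (Suc m))"
      by (induction m) auto
    then show ?thesis using Suc by simp
  qed simp
  from this[of "d - 1"] have "4 * (2 * real d - 1) \<le> 3 * 2 ^ d"
    using d_pos by (simp add: of_nat_diff)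
  then have "(2 * real d - 1) / 2 ^ d \<le> 3 / 4" by (simp add: field_simps)
  have "(2 * real d - 1) * q \<le> (2 * real d - 1) * ((3 / 4) / 2 ^ d)"
    using q_le d_pos by (intro mult_left_mono) auto
  also have "\<dots> = ((2 * real d - 1) / 2 ^ d) * (3 / 4)" by simp
  also have "\<dots> \<le> (3 / 4) * (3 / 4)"
    using \<open>(2 * real d - 1) / 2 ^ d \<le> 3 / 4\<close> by (intro mult_right_mono) auto
  finally show ?thesis by simp
qed

text \<open>As \<open>d * q\<close> stays below \<open>3 / 4\<close>, Bernoulli keeps the factor
  \<open>(1 - q) ^ d\<close> in \<open>q_eq\<close> above \<open>1 / 4\<close>.\<close>

lemma q_ge: "(1 / 8) / 2 ^ d \<le> q"
proof -
  have "real d * q \<le> 3 / 4"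
    using q_mult_le d_pos q_le_half q_pos by (simp add: algebra_simps)
  moreover have "1 + real d * (- q) \<le> (1 + - q) ^ d"
    using q_le_half by (intro Bernoulli_inequality) auto
  ultimately have "(1 - q) ^ d \<ge> 1 / 4" by simp
  then have "x * (1 - q) ^ d \<ge> (1 / 2) * (1 / 4)"
    using x_ge_half by (intro mult_mono) auto
  then show ?thesis using q_eq by (simp add: field_simps)
qed

text \<open>\<open>expect L\<close> is the expectation over \<open>L\<close> independent letters, a letter \<open>a\<close> having
  probability \<open>x ^ len d a\<close>; the equation defining \<open>x\<close> says that these sum to 1.\<close>

primrec expect :: "nat \<Rightarrow> (letter list \<Rightarrow> real) \<Rightarrow> real" where
  "expect 0 \<phi> = \<phi> []"
| "expect (Suc L) \<phi> = x ^ 2 * expect L (\<lambda>w. \<phi> (Sg True # w)) + x ^ 2 * expect L (\<lambda>w. \<phi> (Sg False # w))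
     + q * expect L (\<lambda>w. \<phi> (Jp # w))"

lemma expect_mono: "(\<And>w. length w = L \<Longrightarrow> \<phi> w \<le> \<psi> w) \<Longrightarrow> expect L \<phi> \<le> expect L \<psi>"
proof (induction L arbitrary: \<phi> \<psi>)
  case (Suc L)
  then show ?case using q_pos by (auto intro!: add_mono mult_left_mono)
qed simp

lemma expect_cong: "(\<And>w. length w = L \<Longrightarrow> \<phi> w = \<psi> w) \<Longrightarrow> expect L \<phi> = expect L \<psi>"
  by (intro antisym expect_mono) auto

lemma expect_const [simp]: "expect L (\<lambda>_. c) = c"
proof (induction L)
  case (Suc L)
  have "expect (Suc L) (\<lambda>_. c) = (2 * x ^ 2 + q) * c" by (simp add: Suc algebra_simps)
  then show ?case using x_eq by (simp add: q_def)
qed simp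

lemma expect_add: "expect L (\<lambda>w. \<phi> w + \<psi> w) = expect L \<phi> + expect L \<psi>"
  by (induction L arbitrary: \<phi> \<psi>) (simp_all add: algebra_simps)

lemma expect_cmult: "expect L (\<lambda>w. c * \<phi> w) = c * expect L \<phi>"
  by (induction L arbitrary: \<phi>) (simp_all add: algebra_simps)

lemma expect_sum: "finite I \<Longrightarrow> expect L (\<lambda>w. \<Sum>i\<in>I. \<phi> i w) = (\<Sum>i\<in>I. expect L (\<phi> i))"
  by (induction I rule: finite_induct) (simp_all add: expect_add)

lemma expect_nonneg: "(\<And>w. \<phi> w \<ge> 0) \<Longrightarrow> expect L \<phi> \<ge> 0"
  using expect_mono[of L "\<lambda>_. 0" \<phi>] by simp

lemma expect_append: "expect (K + L) \<phi> = expect K (\<lambda>u. expect L (\<lambda>v. \<phi> (u @ v)))"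
  by (induction K arbitrary: \<phi>) simp_all

lemma expect_take: "k \<le> L \<Longrightarrow> expect L (\<lambda>w. h (take k w)) = expect k h"
proof -
  assume "k \<le> L"
  then have "expect L (\<lambda>w. h (take k w)) = expect k (\<lambda>u. expect (L - k) (\<lambda>v. h (take k (u @ v))))"
    using expect_append[of k "L - k" "\<lambda>w. h (take k w)"] by simp
  also have "\<dots> = expect k h" by (rule expect_cong) simp
  finally show ?thesis .
qed

lemma expect_eq_sum: "expect L \<phi> = (\<Sum>w | length w = L. x ^ duration d w * \<phi> w)"
proof (induction L arbitrary: \<phi>)
  case (Suc L)
  have "(\<Sum>w | length w = Suc L. x ^ duration d w * \<phi> w)
      = (\<Sum>(a, w)\<in>UNIV \<times> {w. length w = L}. x ^ duration d (a # w) * \<phi> (a # w))"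
    by (rule sum.reindex_bij_witness[of _ "\<lambda>(a, w). a # w" "\<lambda>w. (hd w, tl w)"])
      (auto simp: length_Suc_conv)
  also have "\<dots> = (\<Sum>a\<in>UNIV. \<Sum>w | length w = L. x ^ duration d (a # w) * \<phi> (a # w))"
    by (subst sum.cartesian_product) simp
  also have "\<dots> = expect (Suc L) \<phi>"
    unfolding UNIV_letter by (simp add: Suc.IH sum_distrib_left power_add q_def mult.assoc power2_eq_square)
  finally show ?case by simp
qed simp

text \<open>The bridge from fixed duration to a fixed number of letters. A word of duration
  \<open>t\<close> has at most \<open>t\<close> letters, so its weight is the probability that it is
  a prefix of \<open>L\<close> random letters; at most one prefix ends at time \<open>t\<close>, so
  these events are disjoint.\<close>

lemma sum_duration_le_expect:
  assumes g: "\<And>w. g w \<ge> 0" and h: "\<And>w. h w \<ge> 0" and "t \<le> L"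
    and le: "\<And>w k. length w = L \<Longrightarrow> k \<le> L \<Longrightarrow> duration d (take k w) = t \<Longrightarrow> g (take k w) \<le> h w"
  shows "x ^ t * (\<Sum>w | duration d w = t. g w) \<le> expect L h"
proof -
  let ?g = "\<lambda>w. of_bool (duration d w = t) * g w"
  have fin: "finite {w :: letter list. length w = k}" for k
  proof -
    have "{w :: letter list. length w = k} \<subseteq> (\<Union>i\<le>(2 * d + 1) * k. {w. duration d w = i})"
    proof
      fix w :: "letter list" assume "w \<in> {w. length w = k}"
      moreover have "duration d w \<le> (2 * d + 1) * length w"
      proof (induction w)
        case (Cons a w)
        then show ?case using len_le[OF d_pos, of a] by simp
      qed simp
      ultimately show "w \<in> (\<Union>i\<le>(2 * d + 1) * k. {w. duration d w = i})" by auto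
    qed
    then show ?thesis by (rule finite_subset) (use finite_duration[OF d_pos] in auto)
  qed
  have eq: "{w. duration d w = t} = (\<Union>k\<le>L. {w. length w = k \<and> duration d w = t})"
  proof -
    have "length w \<le> L" if "duration d w = t" for w
      using length_le_duration[OF d_pos, of w] assms(3) that by linarith
    then show ?thesis by auto
  qed
  have "x ^ t * (\<Sum>w | duration d w = t. g w)
      = (\<Sum>w\<in>(\<Union>k\<le>L. {w. length w = k \<and> duration d w = t}). x ^ t * g w)"
    by (simp add: sum_distrib_left eq)
  also have "\<dots> = (\<Sum>k\<le>L. \<Sum>w | length w = k \<and> duration d w = t. x ^ t * g w)"
    using finite_duration[OF d_pos, of t] by (intro sum.UNION_disjoint) auto
  also have "\<dots> = (\<Sum>k\<le>L. \<Sum>w | length w = k. x ^ duration d w * ?g w)"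
    by (intro sum.cong refl sum.mono_neutral_cong_left fin) auto
  also have "\<dots> = (\<Sum>k\<le>L. expect k ?g)" by (simp add: expect_eq_sum)
  also have "\<dots> = (\<Sum>k\<le>L. expect L (\<lambda>w. ?g (take k w)))"
    by (intro sum.cong refl) (simp add: expect_take[of _ L ?g])
  also have "\<dots> = expect L (\<lambda>w. \<Sum>k\<le>L. ?g (take k w))"
    by (rule expect_sum[symmetric]) simp
  also have "\<dots> \<le> expect L h"
  proof (rule expect_mono)
    fix w :: "letter list" assume w: "length w = L"
    show "(\<Sum>k\<le>L. ?g (take k w)) \<le> h w"
    proof (cases "\<exists>k\<le>L. duration d (take k w) = t")
      case True
      then obtain k where k: "k \<le> L" "duration d (take k w) = t" by blast
      have "j = k" if "j \<le> L" "duration d (take j w) = t" for j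
      proof (cases j k rule: linorder_cases)
        case less
        then show ?thesis using duration_take_strict[OF d_pos less, of w] that k w by simp
      next
        case greater
        then show ?thesis using duration_take_strict[OF d_pos greater, of w] that k w by simp
      qed
      then have "?g (take j w) = 0" if "j \<in> {..L} - {k}" for j
        using that by (cases "duration d (take j w) = t") auto
      then have "(\<Sum>k\<le>L. ?g (take k w)) = (\<Sum>k\<in>{k}. ?g (take k w))"
        using k(1) by (intro sum.mono_neutral_right ballI) simp_all
      then show ?thesis using le[OF w k] k by simp
    next
      case False
      then have "(\<Sum>k\<le>L. ?g (take k w)) = 0" by (intro sum.neutral) simp
      then show ?thesis using h[of w] by simp
    qed
  qed
  finally show ?thesis .
qed

section \<open>Smoothing by fair signs\<close>

definition run :: "nat \<Rightarrow> (bool \<Rightarrow> nat \<Rightarrow> int \<Rightarrow> real) \<Rightarrow> bool \<Rightarrow> nat \<Rightarrow> int \<Rightarrow> real" where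
  "run K \<Phi> s \<tau> y = expect K (\<lambda>u. \<Phi> (final_sign s u) (\<tau> + duration d u) (y + disp s u))"

lemma run_Suc: "run (Suc K) \<Phi> s \<tau> y = x ^ 2 * run K \<Phi> True (\<tau> + 2) y
    + x ^ 2 * run K \<Phi> False (\<tau> + 2) y + q * run K \<Phi> s (\<tau> + (2 * d + 1)) (y + sg s)"
  by (simp add: run_def add.assoc)

definition avg :: "(bool \<Rightarrow> nat \<Rightarrow> int \<Rightarrow> real) \<Rightarrow> bool \<Rightarrow> nat \<Rightarrow> int \<Rightarrow> real" where
  "avg \<Phi> s \<tau> y = (\<Phi> s \<tau> (y - 1) + \<Phi> s \<tau> (y + 1)) / 2"

lemma run_avg: "run K (avg \<Phi>) s \<tau> y = (run K \<Phi> s \<tau> (y - 1) + run K \<Phi> s \<tau> (y + 1)) / 2"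
proof -
  have "run K (avg \<Phi>) s \<tau> y = expect K (\<lambda>u. (1 / 2) * (\<Phi> (final_sign s u) (\<tau> + duration d u) (y - 1 + disp s u)
      + \<Phi> (final_sign s u) (\<tau> + duration d u) (y + 1 + disp s u)))"
    unfolding run_def avg_def by (intro expect_cong) (simp add: algebra_simps)
  also have "\<dots> = (1 / 2) * (run K \<Phi> s \<tau> (y - 1) + run K \<Phi> s \<tau> (y + 1))"
    unfolding run_def by (simp only: expect_cmult expect_add)
  finally show ?thesis by simp
qed

lemma avg_power:
  "(avg ^^ r) \<Phi> s \<tau> y = (\<Sum>k\<le>r. real (r choose k) / 2 ^ r * \<Phi> s \<tau> (y + 2 * int k - int r))"
proof (induction r arbitrary: \<Phi>)
  case (Suc r)
  have "(avg ^^ Suc r) \<Phi> s \<tau> y = (avg ^^ r) (avg \<Phi>) s \<tau> y"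
    by (simp only: funpow_Suc_right o_apply)
  also have "\<dots> = (\<Sum>k\<le>r. real (r choose k) / 2 ^ r * avg \<Phi> s \<tau> (y + 2 * int k - int r))"
    by (rule Suc.IH)
  also have "\<dots> = (\<Sum>k\<le>r. real (r choose k) * (\<Phi> s \<tau> (y + 2 * int k - int (Suc r))
      + \<Phi> s \<tau> (y + 2 * int (Suc k) - int (Suc r)))) / 2 ^ Suc r"
    unfolding sum_divide_distrib
    by (intro sum.cong refl) (simp add: avg_def field_simps)
  also have "\<dots> = (\<Sum>k\<le>Suc r. real (Suc r choose k) * \<Phi> s \<tau> (y + 2 * int k - int (Suc r))) / 2 ^ Suc r"
    by (subst sum_choose_Suc) simp
  finally show ?case by (simp only: sum_divide_distrib) simp
qed simp

text \<open>The binomial weights are at most \<open>1 / sqrt (r + 1)\<close> and sit at distinct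
  heights, where the total mass of \<open>\<Phi>\<close> is at most \<open>G\<close>.\<close>

lemma avg_power_le:
  assumes "\<And>s \<tau> y. \<Phi> s \<tau> y \<ge> 0"
    and "\<And>s \<tau> Y. finite Y \<Longrightarrow> (\<Sum>y\<in>Y. \<Phi> s \<tau> y) \<le> G"
  shows "(avg ^^ r) \<Phi> s \<tau> y \<le> G / sqrt (real r + 1)"
proof -
  have "(avg ^^ r) \<Phi> s \<tau> y \<le> (\<Sum>k\<le>r. 1 / sqrt (real r + 1) * \<Phi> s \<tau> (y + 2 * int k - int r))"
    unfolding avg_power by (intro sum_mono mult_right_mono binomial_le_inverse_sqrt assms)
  also have "\<dots> = 1 / sqrt (real r + 1) * (\<Sum>k\<le>r. \<Phi> s \<tau> (y + 2 * int k - int r))"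
    by (simp add: sum_distrib_left)
  also have "(\<Sum>k\<le>r. \<Phi> s \<tau> (y + 2 * int k - int r))
      = (\<Sum>z\<in>(\<lambda>k. y + 2 * int k - int r) ` {..r}. \<Phi> s \<tau> z)"
    by (subst sum.reindex) (auto simp: inj_on_def)
  also have "1 / sqrt (real r + 1) * \<dots> \<le> 1 / sqrt (real r + 1) * G"
    by (intro mult_left_mono assms) auto
  finally show ?thesis by simp
qed

text \<open>\<open>2 * \<kappa>\<close> is the probability \<open>(1 - q) * q * (1 - q)\<close> of a
  triple \<open>Sg b, Jp, Sg c\<close>; the half is the loss in
  \<open>inverse_sqrt_step\<close>.\<close>

definition \<kappa> :: real where
  "\<kappa> = q * (1 - q) ^ 2 / 2"

lemma kappa_bounds: "0 < \<kappa>" "2 * \<kappa> \<le> 1" "q / 8 \<le> \<kappa>"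
proof -
  show "0 < \<kappa>" using q_pos q_le_half by (simp add: \<kappa>_def)
  have "(1 - q) ^ 2 \<le> 1" using q_pos q_le_half by (intro power_le_one) auto
  then have "q * (1 - q) ^ 2 \<le> (1 / 2) * 1"
    using q_pos q_le_half by (intro mult_mono) auto
  then show "2 * \<kappa> \<le> 1" by (simp add: \<kappa>_def)
  have "(1 / 2) ^ 2 \<le> (1 - q) ^ 2" using q_le_half by (intro power_mono) auto
  then have "q * (1 / 4) \<le> q * (1 - q) ^ 2"
    using q_pos by (intro mult_left_mono) (auto simp: power2_eq_square)
  then show "q / 8 \<le> \<kappa>" by (simp add: \<kappa>_def)
qed

text \<open>A triple of letters of the shape \<open>Sg b, Jp, Sg c\<close> moves the height by
  \<open>sg b\<close>, and \<open>b\<close> influences nothing else.\<close>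

lemma run_avg_power_le:
  assumes nonneg: "\<And>s \<tau> y. \<Phi> s \<tau> y \<ge> 0"
    and sum: "\<And>s \<tau> Y. finite Y \<Longrightarrow> (\<Sum>y\<in>Y. \<Phi> s \<tau> y) \<le> G"
  shows "run (3 * N) ((avg ^^ r) \<Phi>) s \<tau> y \<le> G / sqrt (1 + real r + real N * \<kappa>)"
\<comment> \<open>\<open>r\<close> counts the fair signs already extracted. A successful triple
  raises it by one, so the claim is proved for all \<open>r\<close> at once.\<close>
proof (induction N arbitrary: r s \<tau> y)
  case 0
  show ?case using avg_power_le[of \<Phi> G r, OF nonneg sum] by (simp add: run_def add.commute)
next
  case (Suc N)
  have G: "G \<ge> 0" using sum[of "{}"] by simp
  define R where "R = run (3 * N) ((avg ^^ r) \<Phi>)"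
  define X where "X = 1 + real r + real N * \<kappa>"
  have X: "X \<ge> 1" using kappa_bounds by (simp add: X_def)
  define A where "A = G / sqrt X"
  define B where "B = G / sqrt (X + 1)"
  have RA: "R s \<tau> y \<le> A" for s \<tau> y
    using Suc.IH by (simp add: R_def A_def X_def)
  have RB: "R s \<tau> (y - 1) + R s \<tau> (y + 1) \<le> 2 * B" for s \<tau> y
  proof -
    have "run (3 * N) ((avg ^^ Suc r) \<Phi>) s \<tau> y \<le> B"
      using Suc.IH[of "Suc r" s \<tau> y] by (simp add: B_def X_def algebra_simps)
    then show ?thesis by (simp add: run_avg R_def)
  qed
  define R1 where "R1 = run (Suc (3 * N)) ((avg ^^ r) \<Phi>)"
  define R2 where "R2 = run (Suc (Suc (3 * N))) ((avg ^^ r) \<Phi>)"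
  have R1: "R1 s \<tau> y = x ^ 2 * R True (\<tau> + 2) y + x ^ 2 * R False (\<tau> + 2) y
      + q * R s (\<tau> + (2 * d + 1)) (y + sg s)" for s \<tau> y
    by (simp only: R1_def R_def run_Suc)
  have R2: "R2 s \<tau> y = x ^ 2 * R1 True (\<tau> + 2) y + x ^ 2 * R1 False (\<tau> + 2) y
      + q * R1 s (\<tau> + (2 * d + 1)) (y + sg s)" for s \<tau> y
    by (simp only: R1_def R2_def run_Suc)
  have conv: "x ^ 2 * a + x ^ 2 * b + q * c \<le> A" if "a \<le> A" "b \<le> A" "c \<le> A" for a b c
  proof -
    have "x ^ 2 * a + x ^ 2 * b + q * c \<le> x ^ 2 * A + x ^ 2 * A + q * A"
      using that q_pos by (intro add_mono mult_left_mono) auto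
    also have "\<dots> = A" by (simp add: x_sq field_simps)
    finally show ?thesis .
  qed
  have R1A: "R1 s \<tau> y \<le> A" for s \<tau> y unfolding R1 by (intro conv RA)
  have R2A: "R2 s \<tau> y \<le> A" for s \<tau> y unfolding R2 by (intro conv R1A)
  \<comment> \<open>The walks that took opposite signs \<open>b\<close> stand at
    \<open>y + 1\<close> and \<open>y - 1\<close>. Once \<open>Sg c\<close> has replaced the sign
    they differ in height only and form one fair average, to which the bound \<open>B\<close> with
    an additional sign applies.\<close>
  have R1B: "R1 True \<tau> (y + 1) + R1 False \<tau> (y - 1) \<le> 4 * x ^ 2 * B + 2 * q * A" for \<tau> y
  proof -
    have "R1 True \<tau> (y + 1) + R1 False \<tau> (y - 1) =
        x ^ 2 * (R True (\<tau> + 2) (y - 1) + R True (\<tau> + 2) (y + 1))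
        + x ^ 2 * (R False (\<tau> + 2) (y - 1) + R False (\<tau> + 2) (y + 1))
        + q * (R True (\<tau> + (2 * d + 1)) (y + 2) + R False (\<tau> + (2 * d + 1)) (y - 2))"
      by (simp add: R1 sg_def algebra_simps)
    also have "\<dots> \<le> x ^ 2 * (2 * B) + x ^ 2 * (2 * B) + q * (A + A)"
      using q_pos by (intro add_mono mult_left_mono RB RA) auto
    finally show ?thesis by (simp add: ac_simps)
  qed
  have R2B: "R2 True \<tau> y + R2 False \<tau> y \<le> 4 * x ^ 2 * A + q * (4 * x ^ 2 * B + 2 * q * A)" for \<tau> y
  proof -
    have "R2 True \<tau> y + R2 False \<tau> y =
        x ^ 2 * (R1 True (\<tau> + 2) y + R1 False (\<tau> + 2) y + R1 True (\<tau> + 2) y + R1 False (\<tau> + 2) y)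
        + q * (R1 True (\<tau> + (2 * d + 1)) (y + 1) + R1 False (\<tau> + (2 * d + 1)) (y - 1))"
      by (simp add: R2 sg_def algebra_simps)
    also have "\<dots> \<le> x ^ 2 * (A + A + A + A) + q * (4 * x ^ 2 * B + 2 * q * A)"
      using q_pos by (intro add_mono mult_left_mono R1B R1A) auto
    finally show ?thesis by simp
  qed
  have "run (3 * Suc N) ((avg ^^ r) \<Phi>) s \<tau> y
      = x ^ 2 * (R2 True (\<tau> + 2) y + R2 False (\<tau> + 2) y) + q * R2 s (\<tau> + (2 * d + 1)) (y + sg s)"
    by (simp only: R2_def mult_Suc_right numeral_3_eq_3 add_Suc_right add_Suc add_0 run_Suc
        distrib_left)
  also have "\<dots> \<le> x ^ 2 * (4 * x ^ 2 * A + q * (4 * x ^ 2 * B + 2 * q * A)) + q * A"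
    using q_pos by (intro add_mono mult_left_mono R2B R2A) auto
  also have "\<dots> = (1 - 2 * \<kappa>) * A + (2 * \<kappa>) * B"
    unfolding x_sq \<kappa>_def by (simp add: field_simps power2_eq_square)
  also have "\<dots> = G * ((1 - 2 * \<kappa>) * (1 / sqrt X) + (2 * \<kappa>) * (1 / sqrt (X + 1)))"
    by (simp add: A_def B_def algebra_simps)
  also have "\<dots> \<le> G * (1 / sqrt (X + 2 * \<kappa> / 2))"
    using kappa_bounds X G by (intro mult_left_mono inverse_sqrt_step) auto
  finally show ?case by (simp add: X_def algebra_simps)
qed

lemma anticoncentration:
  assumes "\<And>s \<tau> y. \<Phi> s \<tau> y \<ge> 0"
    and "\<And>s \<tau> Y. finite Y \<Longrightarrow> (\<Sum>y\<in>Y. \<Phi> s \<tau> y) \<le> G"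
  shows "run (3 * N) \<Phi> s \<tau> y \<le> G / sqrt (1 + real N * \<kappa>)"
  using run_avg_power_le[of \<Phi> G N 0, OF assms] by simp

end

section \<open>Maximal inequality and hitting estimates\<close>

context letter_weights
begin

text \<open>The mean number of \<open>Jp\<close> before the next \<open>Sg\<close>. The current sign
  acts only during that time, so \<open>mart\<close> is the expected height when the sign is next
  redrawn.\<close>

definition \<alpha> :: real where
  "\<alpha> = q / (1 - q)"

lemma alpha_bounds: "0 < \<alpha>" "\<alpha> \<le> 1"
  using q_pos q_le_half by (auto simp: \<alpha>_def divide_simps)

lemma alpha_eq: "q * (1 + \<alpha>) = \<alpha>"
  using q_le_half by (simp add: \<alpha>_def field_simps)

text \<open>\<open>\<alpha>\<close> is the constant that makes \<open>mart\<close> a martingale.\<close>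

definition mart :: "int \<Rightarrow> bool \<Rightarrow> real" where
  "mart y s = real_of_int y + \<alpha> * real_of_int (sg s)"

lemma mart_mean:
  "x ^ 2 * mart y True + x ^ 2 * mart y False + q * mart (y + sg s) s = mart y s"
proof -
  have "x ^ 2 * mart y True + x ^ 2 * mart y False + q * mart (y + sg s) s
      = (1 - q) * y + q * y + (q * (1 + \<alpha>)) * sg s"
    unfolding x_sq by (simp add: mart_def sg_def field_simps)
  then show ?thesis unfolding alpha_eq by (simp add: mart_def algebra_simps)
qed

lemma mart_sq_mean:
  "x ^ 2 * (mart y True) ^ 2 + x ^ 2 * (mart y False) ^ 2 + q * (mart (y + sg s) s) ^ 2
    \<le> (mart y s) ^ 2 + 3 * q"
proof -
  have s2: "real_of_int (sg s) * real_of_int (sg s) = 1" by (simp add: sg_def)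
  have "x ^ 2 * (mart y True) ^ 2 + x ^ 2 * (mart y False) ^ 2 + q * (mart (y + sg s) s) ^ 2
      = (1 - q) * (y * y + \<alpha> * \<alpha>) + q * (y + (1 + \<alpha>) * sg s) ^ 2"
    unfolding x_sq by (simp add: mart_def sg_def field_simps power2_eq_square)
  also have "\<dots> = (1 - q) * (y * y + \<alpha> * \<alpha>) + q * (y * y) + 2 * (q * (1 + \<alpha>)) * sg s * y
      + (q * (1 + \<alpha>)) * (1 + \<alpha>) * (sg s * sg s)"
    by (simp add: power2_eq_square algebra_simps)
  also have "\<dots> = (y * y + 2 * \<alpha> * sg s * y + \<alpha> * \<alpha>) + (\<alpha> + (1 - q) * \<alpha> * \<alpha>)"
    unfolding alpha_eq of_int_mult s2 by (simp add: algebra_simps)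
  also have "y * y + 2 * \<alpha> * sg s * y + \<alpha> * \<alpha> = (mart y s) ^ 2"
    using s2 by (simp add: mart_def power2_eq_square algebra_simps)
  also have "(1 - q) * \<alpha> = q" using q_le_half by (simp add: \<alpha>_def)
  finally have e: "x ^ 2 * (mart y True) ^ 2 + x ^ 2 * (mart y False) ^ 2 + q * (mart (y + sg s) s) ^ 2
      = (mart y s) ^ 2 + (\<alpha> + q * \<alpha>)" .
  have "q * (1 + \<alpha>) \<le> q * 2" using alpha_bounds q_pos by (intro mult_left_mono) auto
  moreover have "q * \<alpha> \<le> q * 1" using alpha_bounds q_pos by (intro mult_left_mono) auto
  ultimately have "\<alpha> + q * \<alpha> \<le> 3 * q" by (simp add: alpha_eq)
  then show ?thesis unfolding e by simp
qed

fun mart_max :: "int \<Rightarrow> bool \<Rightarrow> letter list \<Rightarrow> real" where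
  "mart_max y s [] = \<bar>mart y s\<bar>"
| "mart_max y s (Sg b # w) = max \<bar>mart y s\<bar> (mart_max y b w)"
| "mart_max y s (Jp # w) = max \<bar>mart y s\<bar> (mart_max (y + sg s) s w)"

lemma abs_mart_le_max: "\<bar>mart y s\<bar> \<le> mart_max y s w"
  by (induction y s w rule: mart_max.induct) auto

lemma peak_le_mart_max: "real_of_int (peak y s w) \<le> mart_max y s w + 1"
proof -
  have *: "\<bar>real_of_int y\<bar> \<le> \<bar>mart y s\<bar> + 1" for y s
    using alpha_bounds by (auto simp: mart_def sg_def abs_if split: if_splits)
  show ?thesis
  proof (induction y s w rule: peak.induct)
    case (1 y s)
    then show ?case using * by simp
  next
    case (2 y s b w)
    then show ?case using *[of y s] by simp
  next
    case (3 y s w)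
    then show ?case using *[of y s] by simp
  qed
qed

text \<open>Doob's maximal inequality, by means of the potential \<open>4 X\<^sup>2 - 4 M X + 2 M\<^sup>2\<close> of
  the current value \<open>X\<close> and the running maximum \<open>M\<close>.\<close>

lemma Doob:
  assumes "\<bar>mart y s\<bar> \<le> M"
  shows "expect L (\<lambda>w. (max M (mart_max y s w)) ^ 2)
    \<le> 4 * (mart y s) ^ 2 - 4 * M * \<bar>mart y s\<bar> + 2 * M ^ 2 + 12 * (real L * q)"
  using assms
proof (induction L arbitrary: y s M)
  case 0
  \<comment> \<open>The potential exceeds \<open>M ^ 2\<close> by exactly this square.\<close>
  have "0 \<le> (2 * \<bar>mart y s\<bar> - M) ^ 2" by simp
  then have "M ^ 2 \<le> 4 * \<bar>mart y s\<bar> ^ 2 - 4 * M * \<bar>mart y s\<bar> + 2 * M ^ 2"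
    by (simp add: power2_eq_square algebra_simps)
  then show ?case using 0 by (simp add: max_absorb1)
next
  case (Suc L)
  have M: "M \<ge> 0" using Suc.prems by simp
  define c where "c = 2 * M ^ 2 + 12 * (real L * q)"
  have step: "expect L (\<lambda>w. (max M (max \<bar>mart y s\<bar> (mart_max y' s' w))) ^ 2)
      \<le> 4 * (mart y' s') ^ 2 - 4 * M * \<bar>mart y' s'\<bar> + c" for y' s'
  proof -
    define M' where "M' = max M \<bar>mart y' s'\<bar>"
    have "max M (max \<bar>mart y s\<bar> (mart_max y' s' w)) = max M' (mart_max y' s' w)" for w
      using Suc.prems abs_mart_le_max[of y' s' w] by (auto simp: M'_def)
    then have "expect L (\<lambda>w. (max M (max \<bar>mart y s\<bar> (mart_max y' s' w))) ^ 2)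
        \<le> 4 * (mart y' s') ^ 2 - 4 * M' * \<bar>mart y' s'\<bar> + 2 * M' ^ 2 + 12 * (real L * q)"
      using Suc.IH[of y' s' M'] by (simp add: M'_def)
    \<comment> \<open>Raising the maximum to the current absolute value lowers the potential by
      twice the square of the increase.\<close>
    moreover have "- 4 * M' * \<bar>mart y' s'\<bar> + 2 * M' ^ 2 \<le> - 4 * M * \<bar>mart y' s'\<bar> + 2 * M ^ 2"
    proof (cases "\<bar>mart y' s'\<bar> \<le> M")
      case False
      have "0 \<le> 2 * (\<bar>mart y' s'\<bar> - M) ^ 2" by simp
      then show ?thesis using False by (simp add: M'_def power2_eq_square algebra_simps)
    qed (simp add: M'_def max_absorb1)
    ultimately show ?thesis unfolding c_def by linarith
  qed
  define a where "a = (\<lambda>y s. 4 * (mart y s) ^ 2 - 4 * M * \<bar>mart y s\<bar> + c)"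
  have "expect (Suc L) (\<lambda>w. (max M (mart_max y s w)) ^ 2)
      \<le> x ^ 2 * a y True + x ^ 2 * a y False + q * a (y + sg s) s"
    unfolding a_def expect.simps mart_max.simps
    using q_pos by (intro add_mono mult_left_mono step) simp_all
  also have "\<dots> = 4 * (x ^ 2 * (mart y True) ^ 2 + x ^ 2 * (mart y False) ^ 2 + q * (mart (y + sg s) s) ^ 2)
      - 4 * M * (x ^ 2 * \<bar>mart y True\<bar> + x ^ 2 * \<bar>mart y False\<bar> + q * \<bar>mart (y + sg s) s\<bar>)
      + (2 * x ^ 2 + q) * c"
    by (simp add: a_def algebra_simps)
  also have "\<dots> \<le> 4 * ((mart y s) ^ 2 + 3 * q) - 4 * M * \<bar>mart y s\<bar> + c"
  proof -
    have "\<bar>mart y s\<bar> = \<bar>x ^ 2 * mart y True + x ^ 2 * mart y False + q * mart (y + sg s) s\<bar>"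
      by (simp only: mart_mean)
    also have "\<dots> \<le> \<bar>x ^ 2 * mart y True\<bar> + \<bar>x ^ 2 * mart y False\<bar> + \<bar>q * mart (y + sg s) s\<bar>"
      by linarith
    also have "\<dots> = x ^ 2 * \<bar>mart y True\<bar> + x ^ 2 * \<bar>mart y False\<bar> + q * \<bar>mart (y + sg s) s\<bar>"
      using q_pos by (simp add: abs_mult)
    finally have "4 * M * \<bar>mart y s\<bar>
        \<le> 4 * M * (x ^ 2 * \<bar>mart y True\<bar> + x ^ 2 * \<bar>mart y False\<bar> + q * \<bar>mart (y + sg s) s\<bar>)"
      using M by (intro mult_left_mono) auto
    moreover have "2 * x ^ 2 + q = 1" using x_eq by (simp add: q_def)
    ultimately show ?thesis using mart_sq_mean[of y s] by simp
  qed
  also have "\<dots> = 4 * (mart y s) ^ 2 - 4 * M * \<bar>mart y s\<bar> + 2 * M ^ 2 + 12 * (real (Suc L) * q)"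
    by (simp add: c_def algebra_simps)
  finally show ?case .
qed

text \<open>Started with \<open>M = \<bar>mart y s\<bar>\<close>, \<open>Doob\<close> leaves
  \<open>2 * (mart y s) ^ 2 \<le> 8\<close>; passing from \<open>mart_max\<close> to
  \<open>peak\<close> through \<open>(a + 1) ^ 2 \<le> 2 * a ^ 2 + 2\<close> doubles the bound and
  adds 2.\<close>

lemma expect_peak_sq:
  assumes "\<bar>y\<bar> \<le> 1"
  shows "expect L (\<lambda>w. (real_of_int (peak y s w)) ^ 2) \<le> 18 + 24 * (real L * q)"
proof -
  have m: "\<bar>mart y s\<bar> \<le> 2"
  proof -
    have "\<bar>real_of_int y\<bar> \<le> 1" using assms by linarith
    then show ?thesis using alpha_bounds by (auto simp: mart_def sg_def abs_if split: if_splits)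
  qed
  have "(mart y s) ^ 2 \<le> 4"
    using power_mono[OF m, of 2] by simp
  have "expect L (\<lambda>w. (max \<bar>mart y s\<bar> (mart_max y s w)) ^ 2)
      \<le> 4 * (mart y s) ^ 2 - 4 * \<bar>mart y s\<bar> * \<bar>mart y s\<bar> + 2 * \<bar>mart y s\<bar> ^ 2 + 12 * (real L * q)"
    by (rule Doob) simp
  also have "\<dots> = 2 * (mart y s) ^ 2 + 12 * (real L * q)"
    by (simp add: power2_eq_square flip: abs_mult)
  also have "\<dots> \<le> 8 + 12 * (real L * q)" using \<open>(mart y s) ^ 2 \<le> 4\<close> by simp
  finally have D: "expect L (\<lambda>w. (mart_max y s w) ^ 2) \<le> 8 + 12 * (real L * q)"
    by (simp add: max_absorb2 abs_mart_le_max)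
  have "expect L (\<lambda>w. (real_of_int (peak y s w)) ^ 2) \<le> expect L (\<lambda>w. 2 * (mart_max y s w) ^ 2 + 2)"
  proof (rule expect_mono)
    fix w
    have "(real_of_int (peak y s w)) ^ 2 \<le> (mart_max y s w + 1) ^ 2"
      using peak_le_mart_max peak_nonneg by (intro power_mono) auto
    also have "\<dots> \<le> 2 * (mart_max y s w) ^ 2 + 2"
      using zero_le_power2[of "mart_max y s w - 1"] by (simp add: power2_eq_square algebra_simps)
    finally show "(real_of_int (peak y s w)) ^ 2 \<le> 2 * (mart_max y s w) ^ 2 + 2" .
  qed
  also have "\<dots> = 2 * expect L (\<lambda>w. (mart_max y s w) ^ 2) + 2" by (simp add: expect_add expect_cmult)
  finally show ?thesis using D by simp
qed

section \<open>Duration of a fixed number of letters\<close>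

definition jumps :: "letter list \<Rightarrow> nat" where
  "jumps w = length (filter (\<lambda>a. a = Jp) w)"

lemma duration_eq_jumps: "real (duration d w) = 2 * real (length w) + (2 * real d - 1) * real (jumps w)"
proof (induction w)
  case (Cons a w)
  then show ?case by (cases a) (auto simp: jumps_def algebra_simps)
qed (simp add: jumps_def)

text \<open>The variance of a binomial count; the offset \<open>c\<close> absorbs the first letter
  in the induction.\<close>

lemma jumps_variance:
  "expect L (\<lambda>w. (c + real (jumps w) - real L * q) ^ 2) = c ^ 2 + real L * q * (1 - q)"
proof (induction L arbitrary: c)
  case (Suc L)
  have "expect (Suc L) (\<lambda>w. (c + real (jumps w) - real (Suc L) * q) ^ 2)
      = 2 * x ^ 2 * expect L (\<lambda>w. ((c - q) + real (jumps w) - real L * q) ^ 2)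
      + q * expect L (\<lambda>w. ((c + 1 - q) + real (jumps w) - real L * q) ^ 2)"
    by (simp add: jumps_def algebra_simps)
  also have "\<dots> = (1 - q) * ((c - q) ^ 2 + real L * q * (1 - q))
      + q * ((c + 1 - q) ^ 2 + real L * q * (1 - q))"
    unfolding Suc.IH x_sq by simp
  also have "\<dots> = c ^ 2 + real (Suc L) * q * (1 - q)"
    by (simp add: power2_eq_square algebra_simps)
  finally show ?case .
qed (simp add: jumps_def)

text \<open>Two smoothing stretches of \<open>3 * block t\<close> letters each are reserved,
  together at most \<open>t / 8\<close> letters; the factor 8 leaves room for the deviation in
  \<open>expect_late\<close>.\<close>

definition block :: "nat \<Rightarrow> nat" where
  "block t = t div 48"

lemma block_le: "6 * block t \<le> t"
  by (simp add: block_def)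

text \<open>Chebyshev. If \<open>L \<le> t / 8\<close> letters outlast \<open>t\<close>, the extra
  time of the \<open>Jp\<close> is at least \<open>3 / 4 * t\<close>; since
  \<open>(2 * d - 1) * q \<le> 1\<close>, there are at least \<open>3 / 4 * t * q\<close> of them,
  against a mean and a variance of at most \<open>t * q / 8\<close>.\<close>

lemma expect_late:
  "(1 + real t * q) * expect (6 * block t) (\<lambda>w. of_bool (t < duration d w)) \<le> 2"
proof -
  let ?L = "6 * block t"
  define P where "P = expect ?L (\<lambda>w. of_bool (t < duration d w))"
  define Q where "Q = real t * q"
  have Q: "Q \<ge> 0" using q_pos by (simp add: Q_def)
  have L: "8 * real ?L \<le> real t"
  proof -
    have "8 * ?L \<le> t" by (simp add: block_def)
    then have "real (8 * ?L) \<le> real t" by (simp only: of_nat_le_iff)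
    then show ?thesis by simp
  qed
  have LQ: "8 * (real ?L * q) \<le> Q"
    using mult_right_mono[OF L, of q] q_pos by (simp add: Q_def mult.assoc)
  have P1: "P \<le> 1" "P \<ge> 0"
    unfolding P_def using expect_mono[of ?L "\<lambda>w. of_bool (t < duration d w)" "\<lambda>_. 1"]
    by (auto intro!: expect_nonneg)
  have "(5 / 8 * Q) ^ 2 * P = expect ?L (\<lambda>w. (5 / 8 * Q) ^ 2 * of_bool (t < duration d w))"
    by (simp only: P_def expect_cmult)
  also have "\<dots> \<le> expect ?L (\<lambda>w. (0 + real (jumps w) - real ?L * q) ^ 2)"
  proof (rule expect_mono)
    fix w :: "letter list" assume w: "length w = ?L"
    show "(5 / 8 * Q) ^ 2 * of_bool (t < duration d w) \<le> (0 + real (jumps w) - real ?L * q) ^ 2"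
    proof (cases "t < duration d w")
      case True
      then have "real t \<le> 2 * real ?L + (2 * real d - 1) * real (jumps w)"
        using duration_eq_jumps[of w] w by linarith
      then have "3 / 4 * real t \<le> (2 * real d - 1) * real (jumps w)" using L by linarith
      then have "3 / 4 * real t * q \<le> ((2 * real d - 1) * real (jumps w)) * q"
        using q_pos by (intro mult_right_mono) auto
      also have "\<dots> = ((2 * real d - 1) * q) * real (jumps w)" by simp
      also have "\<dots> \<le> 1 * real (jumps w)"
        using q_mult_le by (intro mult_right_mono) auto
      finally have "3 / 4 * Q \<le> real (jumps w)" by (simp add: Q_def)
      then have "5 / 8 * Q \<le> real (jumps w) - real ?L * q" using LQ by linarith
      then have "(5 / 8 * Q) ^ 2 \<le> (real (jumps w) - real ?L * q) ^ 2"
        using Q by (intro power_mono) auto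
      then show ?thesis using True by simp
    qed simp
  qed
  also have "\<dots> = real ?L * q * (1 - q)" by (subst jumps_variance) simp
  also have "\<dots> \<le> real ?L * q * 1" using q_pos by (intro mult_left_mono) auto
  finally have "(5 / 8 * Q) ^ 2 * P \<le> Q / 8" using LQ by linarith
  then have "Q * (25 * (Q * P)) \<le> Q * 8" by (simp add: power2_eq_square ac_simps)
  then have "Q * P \<le> 1"
  proof (cases "Q = 0")
    case False
    then have "25 * (Q * P) \<le> 8"
      using \<open>Q * (25 * (Q * P)) \<le> Q * 8\<close> Q mult_le_cancel_left_pos[of Q "25 * (Q * P)" 8] by simp
    then show ?thesis by simp
  qed simp
  then have "(1 + Q) * P \<le> 2" using P1 by (simp add: algebra_simps)
  then show ?thesis by (simp add: P_def Q_def)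
qed

text \<open>\<open>t < 48 * (block t + 1)\<close> and \<open>q \<le> 8 * \<kappa>\<close> give the
  factor \<open>48 * 8 = 384\<close>, rounded up to \<open>20 ^ 2\<close>.\<close>

lemma block_kappa:
  "1 / sqrt (1 + real (block t) * \<kappa>) \<le> 20 / sqrt (1 + real t * q)"
proof -
  have "real t < 48 * (real (block t) + 1)"
  proof -
    have "t < 48 * (block t + 1)" 
      unfolding block_def by presburger
    then have "real t < real (48 * (block t + 1))" by (simp only: of_nat_less_iff)
    then show ?thesis by simp
  qed
  then have "real t * q \<le> 48 * (real (block t) + 1) * q"
    using q_pos by (intro mult_right_mono) auto
  also have "\<dots> = 48 * (real (block t) * q) + 48 * q" by (simp add: algebra_simps)
  also have "\<dots> \<le> 48 * (real (block t) * (8 * \<kappa>)) + 24"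
    using kappa_bounds q_le_half by (intro add_mono mult_left_mono) auto
  finally have "1 + real t * q \<le> 384 * (1 + real (block t) * \<kappa>)" by simp
  also have "\<dots> \<le> 400 * (1 + real (block t) * \<kappa>)"
    using kappa_bounds by (intro mult_right_mono) auto
  finally have "sqrt (1 + real t * q) \<le> sqrt (400 * (1 + real (block t) * \<kappa>))"
    by (rule real_sqrt_le_mono)
  also have "\<dots> = 20 * sqrt (1 + real (block t) * \<kappa>)"
  proof -
    have "sqrt (400 :: real) = 20" by (rule real_sqrt_unique) simp_all
    then show ?thesis by (simp only: real_sqrt_mult)
  qed
  finally have *: "sqrt (1 + real t * q) \<le> 20 * sqrt (1 + real (block t) * \<kappa>)" .
  have "sqrt (1 + real t * q) > 0" "sqrt (1 + real (block t) * \<kappa>) > 0"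
    using q_pos kappa_bounds by (auto intro!: add_pos_nonneg)
  then show ?thesis using * by (simp add: field_simps)
qed

section \<open>Return at a prescribed time\<close>

lemma run_hits_le:
  "run (3 * N) (\<lambda>s \<tau> y. expect M (\<lambda>v. of_bool (hits d t z s \<tau> y v))) s \<tau> y \<le> 1 / sqrt (1 + real N * \<kappa>)"
proof (rule anticoncentration)
  fix s \<tau> and Y :: "int set" assume Y: "finite Y"
  have "(\<Sum>y\<in>Y. expect M (\<lambda>v. of_bool (hits d t z s \<tau> y v)))
      = expect M (\<lambda>v. \<Sum>y\<in>Y. of_bool (hits d t z s \<tau> y v))"
    by (rule expect_sum[OF Y, symmetric])
  also have "\<dots> \<le> expect M (\<lambda>_. 1)"
    by (rule expect_mono) (rule sum_hits_le_1[OF Y d_pos])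
  finally show "(\<Sum>y\<in>Y. expect M (\<lambda>v. of_bool (hits d t z s \<tau> y v))) \<le> 1" by simp
qed (auto intro: expect_nonneg)

lemma expect_peak:
  assumes "\<bar>y\<bar> \<le> 1" "L \<le> t"
  shows "expect L (\<lambda>w. real_of_int (peak y s w)) \<le> 13 * sqrt (1 + real t * q)"
proof -
  define b where "b = sqrt (1 + real t * q)"
  have b: "b > 0" "b ^ 2 = 1 + real t * q" using q_pos by (auto simp: b_def intro!: add_pos_nonneg)
  have "real L * q \<le> real t * q" using assms q_pos by (intro mult_right_mono) auto
  have "expect L (\<lambda>w. real_of_int (peak y s w))
      \<le> expect L (\<lambda>w. (1 / (2 * b)) * (real_of_int (peak y s w)) ^ 2 + b / 2)"
  proof (rule expect_mono)
    fix w
    define p where "p = real_of_int (peak y s w)"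
    have "0 \<le> (p - b) ^ 2" by simp
    then have "p * (2 * b) \<le> p ^ 2 + b ^ 2" by (simp add: power2_eq_square algebra_simps)
    then have "p \<le> (p ^ 2 + b ^ 2) / (2 * b)" using b by (simp add: pos_le_divide_eq)
    also have "\<dots> = (1 / (2 * b)) * p ^ 2 + b / 2"
      using b by (simp add: field_simps power2_eq_square)
    finally show "real_of_int (peak y s w) \<le> (1 / (2 * b)) * (real_of_int (peak y s w)) ^ 2 + b / 2"
      by (simp add: p_def)
  qed
  also have "\<dots> = (1 / (2 * b)) * expect L (\<lambda>w. (real_of_int (peak y s w)) ^ 2) + b / 2"
    by (simp only: expect_add expect_cmult expect_const)
  also have "\<dots> \<le> (1 / (2 * b)) * (24 * b ^ 2) + b / 2"
    using expect_peak_sq[OF assms(1), of L s] b \<open>real L * q \<le> real t * q\<close>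
    by (intro add_mono mult_left_mono) auto
  also have "\<dots> = 12 * b + b / 2" using b(1) by (simp add: power2_eq_square)
  also have "\<dots> \<le> 13 * b" using b by simp
  finally show ?thesis by (simp add: b_def)
qed

text \<open>The peak has order \<open>b\<close> and the return has probability of order
  \<open>1 / b\<close>, but they are dependent. \<open>T1\<close> takes the peak on the first
  stretch and lets the second one smooth the return; \<open>T2\<close> takes the peak after the
  first stretch and lets the first one smooth. \<open>late\<close> covers the case that the
  stretches are not over by time \<open>t\<close>. The pieces contribute at most 1040, 580 and
  97.\<close>

lemma expect_peak_hits:
  assumes y0: "\<bar>y0\<bar> \<le> 1"
  shows "expect t (\<lambda>w. (2 * real_of_int (peak y0 s w) + 3) * of_bool (hits d t z s 0 y0 w)) \<le> 2000"
proof -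
  define N where "N = block t"
  define M where "M = t - 6 * N"
  define b where "b = sqrt (1 + real t * q)"
  have b: "b \<ge> 1" "b ^ 2 = 1 + real t * q" using q_pos by (auto simp: b_def)
  have t: "t = 6 * N + M" "t = 3 * N + (3 * N + M)" using block_le[of t] by (auto simp: N_def M_def)
  define D where "D w = 2 * real_of_int (peak y0 s w) + 3" for w
  have D0: "D w \<ge> 0" for w using peak_nonneg[of y0 s w] by (simp add: D_def)
  define \<Phi>1 where "\<Phi>1 = (\<lambda>s \<tau> y. expect M (\<lambda>v. of_bool (hits d t z s \<tau> y v)))"
  define \<Phi>2 where "\<Phi>2 = (\<lambda>s \<tau> y. expect (3 * N + M)
    (\<lambda>v. (2 * real_of_int (peak 0 s v) + 3) * of_bool (hits d t z s \<tau> y v)))"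
  define late where "late = (\<lambda>w. D w * of_bool (t < duration d (take (6 * N) w)))"
  define T1 where "T1 = (\<lambda>w. 4 * real_of_int (peak y0 s (take (3 * N) w)) *
    of_bool (hits d t z (final_sign s (take (6 * N) w)) (duration d (take (6 * N) w))
      (y0 + disp s (take (6 * N) w)) (drop (6 * N) w)))"
  define T2 where "T2 = (\<lambda>w. (2 * real_of_int (peak 0 (final_sign s (take (3 * N) w)) (drop (3 * N) w)) + 3) *
    of_bool (hits d t z (final_sign s (take (3 * N) w)) (duration d (take (3 * N) w))
      (y0 + disp s (take (3 * N) w)) (drop (3 * N) w)))"
  have split: "D w * of_bool (hits d t z s 0 y0 w) \<le> late w + (T1 w + T2 w)" for w
  proof -
    have nonneg: "late w \<ge> 0" "T1 w \<ge> 0" "T2 w \<ge> 0"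
      using D0 peak_nonneg by (auto simp: late_def T1_def T2_def)
    consider "\<not> hits d t z s 0 y0 w" | "t < duration d (take (6 * N) w)"
      | "hits d t z s 0 y0 w" "duration d (take (6 * N) w) \<le> t" by linarith
    then show ?thesis
    proof cases
      case 3
      have "duration d (take (3 * N) w) \<le> t"
        using 3 duration_take_mono[of "3 * N" "6 * N" d w] by simp
      then have h2: "hits d t z (final_sign s (take (3 * N) w)) (duration d (take (3 * N) w))
          (y0 + disp s (take (3 * N) w)) (drop (3 * N) w)"
        using hits_append[of d t z s 0 y0 "take (3 * N) w" "drop (3 * N) w"] 3 d_pos by simp
      have h1: "hits d t z (final_sign s (take (6 * N) w)) (duration d (take (6 * N) w))
          (y0 + disp s (take (6 * N) w)) (drop (6 * N) w)"
        using hits_append[of d t z s 0 y0 "take (6 * N) w" "drop (6 * N) w"] 3 d_pos by simp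
      let ?u = "take (3 * N) w" and ?v = "drop (3 * N) w"
      have "peak y0 s w = max (peak y0 s ?u) (peak (0 + (y0 + disp s ?u)) (final_sign s ?u) ?v)"
        using peak_append[of y0 s ?u ?v] by simp
      \<comment> \<open>Recentring the remainder at height 0 leaves the sign as its only link to the
        first stretch, so its peak can serve as a weight in \<open>\<Phi>2\<close>.\<close>
      also have "\<dots> \<le> max (peak y0 s ?u) (\<bar>y0 + disp s ?u\<bar> + peak 0 (final_sign s ?u) ?v)"
        using peak_shift[of 0 "y0 + disp s ?u" "final_sign s ?u" ?v] by simp
      also have "\<dots> \<le> 2 * peak y0 s ?u + peak 0 (final_sign s ?u) ?v"
        using abs_disp_le_peak[of y0 s ?u] peak_nonneg[of y0 s ?u] peak_nonneg[of 0 "final_sign s ?u" ?v]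
        by simp
      finally have "real_of_int (peak y0 s w) \<le> 2 * real_of_int (peak y0 s ?u)
          + real_of_int (peak 0 (final_sign s ?u) ?v)" by linarith
      then have "D w \<le> T1 w + T2 w" using h1 h2 by (simp add: D_def T1_def T2_def)
      then show ?thesis using nonneg 3 by simp
    qed (use nonneg D0[of w] in \<open>simp_all add: late_def\<close>)
  qed
  have a: "1 / sqrt (1 + real N * \<kappa>) \<le> 20 / b"
    using block_kappa[of t] by (simp add: N_def b_def)
  have late: "expect t late \<le> 97"
  proof -
    have "expect t late \<le> expect t (\<lambda>w. (1 / (2 * b ^ 2)) * (D w) ^ 2
        + b ^ 2 / 2 * of_bool (t < duration d (take (6 * N) w)))"
    proof (rule expect_mono)
      fix w
      \<comment> \<open>The arithmetic-geometric mean inequality with weight \<open>b ^ 2\<close>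
        balances a second moment of order \<open>b ^ 2\<close> against a lateness probability of
        order \<open>1 / b ^ 2\<close>.\<close>
      have "0 \<le> (D w - b ^ 2) ^ 2" by simp
      then have "D w * (2 * b ^ 2) \<le> (D w) ^ 2 + b ^ 2 * b ^ 2" by (simp add: power2_eq_square algebra_simps)
      then have "D w \<le> ((D w) ^ 2 + b ^ 2 * b ^ 2) / (2 * b ^ 2)"
        using b(1) by (subst pos_le_divide_eq) auto
      also have "\<dots> = (1 / (2 * b ^ 2)) * (D w) ^ 2 + b ^ 2 / 2"
        using b(1) by (simp add: add_divide_distrib power2_eq_square)
      finally have "D w \<le> (1 / (2 * b ^ 2)) * (D w) ^ 2 + b ^ 2 / 2" .
      then show "late w \<le> (1 / (2 * b ^ 2)) * (D w) ^ 2
          + b ^ 2 / 2 * of_bool (t < duration d (take (6 * N) w))"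
        by (simp add: late_def)
    qed
    also have "\<dots> = (1 / (2 * b ^ 2)) * expect t (\<lambda>w. (D w) ^ 2)
        + b ^ 2 / 2 * expect (6 * N) (\<lambda>w. of_bool (t < duration d w))"
      using expect_take[of "6 * N" t "\<lambda>w. of_bool (t < duration d w)"] block_le[of t]
      by (simp only: expect_add expect_cmult N_def)
    also have "\<dots> \<le> (1 / (2 * b ^ 2)) * (192 * b ^ 2) + 1"
    proof (intro add_mono mult_left_mono)
      show "b ^ 2 / 2 * expect (6 * N) (\<lambda>w. of_bool (t < duration d w)) \<le> 1"
        using expect_late[of t] unfolding b(2) N_def by simp
      have "expect t (\<lambda>w. (D w) ^ 2) \<le> expect t (\<lambda>w. 8 * (real_of_int (peak y0 s w)) ^ 2 + 18)"
      proof (rule expect_mono)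
        fix w
        have "0 \<le> (2 * real_of_int (peak y0 s w) - 3) ^ 2" by simp
        then show "(D w) ^ 2 \<le> 8 * (real_of_int (peak y0 s w)) ^ 2 + 18"
          by (simp add: D_def power2_eq_square algebra_simps)
      qed
      also have "\<dots> = 8 * expect t (\<lambda>w. (real_of_int (peak y0 s w)) ^ 2) + 18"
        by (simp add: expect_add expect_cmult)
      finally show "expect t (\<lambda>w. (D w) ^ 2) \<le> 192 * b ^ 2"
        using expect_peak_sq[OF y0, of t s] unfolding b(2) by simp
    qed simp
    also have "\<dots> = 97" using b(1) by simp
    finally show ?thesis .
  qed
  have T1: "expect t T1 \<le> 1040"
  proof -
    have "expect t T1 = expect (3 * N) (\<lambda>u. expect (3 * N) (\<lambda>u'. expect M (\<lambda>v. T1 (u @ u' @ v))))"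
      by (simp only: t(2) expect_append)
    also have "\<dots> = expect (3 * N) (\<lambda>u. 4 * real_of_int (peak y0 s u) *
        run (3 * N) \<Phi>1 (final_sign s u) (duration d u) (y0 + disp s u))"
    proof (rule expect_cong)
      fix u :: "letter list" assume u: "length u = 3 * N"
      have "expect (3 * N) (\<lambda>u'. expect M (\<lambda>v. T1 (u @ u' @ v))) = expect (3 * N) (\<lambda>u'. 4 * real_of_int (peak y0 s u) *
          \<Phi>1 (final_sign (final_sign s u) u') (duration d u + duration d u')
            (y0 + disp s u + disp (final_sign s u) u'))"
      proof (rule expect_cong)
        fix u' :: "letter list" assume u': "length u' = 3 * N"
        have "expect M (\<lambda>v. T1 (u @ u' @ v)) = expect M (\<lambda>v. 4 * real_of_int (peak y0 s u) *
          of_bool (hits d t z (final_sign (final_sign s u) u') (duration d u + duration d u')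
            (y0 + disp s u + disp (final_sign s u) u') v))"
          using u u' by (intro expect_cong) (simp add: T1_def final_sign_append disp_append add.assoc)
        then show "expect M (\<lambda>v. T1 (u @ u' @ v)) = 4 * real_of_int (peak y0 s u) *
          \<Phi>1 (final_sign (final_sign s u) u') (duration d u + duration d u')
            (y0 + disp s u + disp (final_sign s u) u')"
          by (simp only: expect_cmult \<Phi>1_def)
      qed
      then show "expect (3 * N) (\<lambda>u'. expect M (\<lambda>v. T1 (u @ u' @ v))) = 4 * real_of_int (peak y0 s u) *
          run (3 * N) \<Phi>1 (final_sign s u) (duration d u) (y0 + disp s u)"
        by (simp only: expect_cmult run_def)
    qed
    also have "\<dots> \<le> expect (3 * N) (\<lambda>u. (4 * (20 / b)) * real_of_int (peak y0 s u))"
    proof (rule expect_mono)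
      fix u
      have "run (3 * N) \<Phi>1 (final_sign s u) (duration d u) (y0 + disp s u) \<le> 20 / b"
        using run_hits_le a unfolding \<Phi>1_def by (rule order_trans)
      then have "4 * real_of_int (peak y0 s u) * run (3 * N) \<Phi>1 (final_sign s u) (duration d u) (y0 + disp s u)
          \<le> 4 * real_of_int (peak y0 s u) * (20 / b)"
        using peak_nonneg[of y0 s u] by (intro mult_left_mono) auto
      then show "4 * real_of_int (peak y0 s u) * run (3 * N) \<Phi>1 (final_sign s u) (duration d u) (y0 + disp s u)
          \<le> (4 * (20 / b)) * real_of_int (peak y0 s u)" by (simp add: ac_simps)
    qed
    also have "\<dots> = (4 * (20 / b)) * expect (3 * N) (\<lambda>u. real_of_int (peak y0 s u))"
      by (simp only: expect_cmult)
    also have "\<dots> \<le> (4 * (20 / b)) * (13 * b)"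
      using expect_peak[OF y0, of "3 * N" t s] t b(1) by (intro mult_left_mono) (auto simp: b_def)
    also have "\<dots> = 1040" using b(1) by simp
    finally show ?thesis .
  qed
  have T2: "expect t T2 \<le> 580"
  proof -
    have "expect t T2 = expect (3 * N) (\<lambda>u. expect (3 * N + M) (\<lambda>v. T2 (u @ v)))"
      by (subst t(2)) (simp only: expect_append[of "3 * N"])
    also have "\<dots> = run (3 * N) \<Phi>2 s 0 y0"
      unfolding run_def \<Phi>2_def by (intro expect_cong) (simp add: T2_def)
    also have "\<dots> \<le> 29 * b / sqrt (1 + real N * \<kappa>)"
    proof (rule anticoncentration)
      show "\<Phi>2 s \<tau> y \<ge> 0" for s \<tau> y
        unfolding \<Phi>2_def using peak_nonneg[of 0] by (intro expect_nonneg) (auto intro!: add_nonneg_nonneg)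
      fix s \<tau> and Y :: "int set" assume Y: "finite Y"
      have "(\<Sum>y\<in>Y. \<Phi>2 s \<tau> y) = expect (3 * N + M) (\<lambda>v. \<Sum>y\<in>Y.
          (2 * real_of_int (peak 0 s v) + 3) * of_bool (hits d t z s \<tau> y v))"
        unfolding \<Phi>2_def by (rule expect_sum[OF Y, symmetric])
      also have "\<dots> \<le> expect (3 * N + M) (\<lambda>v. 2 * real_of_int (peak 0 s v) + 3)"
      proof (rule expect_mono)
        fix v
        have "(\<Sum>y\<in>Y. (2 * real_of_int (peak 0 s v) + 3) * of_bool (hits d t z s \<tau> y v))
            = (2 * real_of_int (peak 0 s v) + 3) * (\<Sum>y\<in>Y. of_bool (hits d t z s \<tau> y v))"
          by (simp only: sum_distrib_left)
        also have "\<dots> \<le> (2 * real_of_int (peak 0 s v) + 3) * 1"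
          using peak_nonneg[of 0 s v] by (intro mult_left_mono sum_hits_le_1 Y d_pos) auto
        finally show "(\<Sum>y\<in>Y. (2 * real_of_int (peak 0 s v) + 3) * of_bool (hits d t z s \<tau> y v))
            \<le> 2 * real_of_int (peak 0 s v) + 3" by simp
      qed
      also have "\<dots> = 2 * expect (3 * N + M) (\<lambda>v. real_of_int (peak 0 s v)) + 3"
        by (simp add: expect_add expect_cmult)
      also have "\<dots> \<le> 2 * (13 * b) + 3 * b"
      proof -
        have "expect (3 * N + M) (\<lambda>v. real_of_int (peak 0 s v)) \<le> 13 * b"
          unfolding b_def by (rule expect_peak) (simp, subst t(2), simp)
        then show ?thesis using b(1) by simp
      qed
      finally show "(\<Sum>y\<in>Y. \<Phi>2 s \<tau> y) \<le> 29 * b" by simp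
    qed
    also have "\<dots> = 29 * b * (1 / sqrt (1 + real N * \<kappa>))" by simp
    also have "\<dots> \<le> 29 * b * (20 / b)" using a b by (intro mult_left_mono) auto
    also have "\<dots> = 580" using b by simp
    finally show ?thesis .
  qed
  have "expect t (\<lambda>w. D w * of_bool (hits d t z s 0 y0 w)) \<le> expect t (\<lambda>w. late w + (T1 w + T2 w))"
    by (intro expect_mono split)
  also have "\<dots> = expect t late + (expect t T1 + expect t T2)" by (simp only: expect_add)
  finally show ?thesis using late T1 T2 by (simp add: D_def)
qed

text \<open>Anticoncentration is used twice: the first stretch makes it unlikely to end in the
  window of \<open>2 * R + 1\<close> heights, and the second one, from wherever it starts, makes the
  exact return unlikely. Each gives a factor \<open>20 / b\<close>.\<close>

lemma expect_small_hits:
  fixes R t :: nat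
  defines "N \<equiv> block t"
  shows "expect t (\<lambda>w. of_bool (t < duration d (take (6 * N) w)) +
      of_bool (hits d t z s 0 y0 w \<and> duration d (take (6 * N) w) \<le> t \<and> \<bar>y0 + disp s (take (3 * N) w)\<bar> \<le> int R))
    \<le> (802 + 800 * real R) / (1 + real t * q)"
proof -
  define M where "M = t - 6 * N"
  define b where "b = sqrt (1 + real t * q)"
  have b: "b \<ge> 1" "b ^ 2 = 1 + real t * q" using q_pos by (auto simp: b_def)
  have t: "t = 6 * N + M" "t = 3 * N + (3 * N + M)" using block_le[of t] by (auto simp: N_def M_def)
  have a: "1 / sqrt (1 + real N * \<kappa>) \<le> 20 / b"
    using block_kappa[of t] by (simp add: N_def b_def)
  define \<Phi>1 where "\<Phi>1 = (\<lambda>s \<tau> y. expect M (\<lambda>v. of_bool (hits d t z s \<tau> y v)))"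
  define \<Phi>3 where "\<Phi>3 = (\<lambda>(s :: bool) (\<tau> :: nat) y. of_bool (\<bar>y\<bar> \<le> int R) :: real)"
  define T where "T = (\<lambda>w. of_bool (\<bar>y0 + disp s (take (3 * N) w)\<bar> \<le> int R) *
    of_bool (hits d t z (final_sign s (take (6 * N) w)) (duration d (take (6 * N) w))
      (y0 + disp s (take (6 * N) w)) (drop (6 * N) w)) :: real)"
  have "expect t T = expect (3 * N) (\<lambda>u. expect (3 * N) (\<lambda>u'. expect M (\<lambda>v. T (u @ u' @ v))))"
    by (simp only: t(2) expect_append)
  also have "\<dots> = expect (3 * N) (\<lambda>u. of_bool (\<bar>y0 + disp s u\<bar> \<le> int R) *
      run (3 * N) \<Phi>1 (final_sign s u) (duration d u) (y0 + disp s u))"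
  proof (rule expect_cong)
    fix u :: "letter list" assume u: "length u = 3 * N"
    have "expect (3 * N) (\<lambda>u'. expect M (\<lambda>v. T (u @ u' @ v))) = expect (3 * N) (\<lambda>u'. of_bool (\<bar>y0 + disp s u\<bar> \<le> int R) *
        \<Phi>1 (final_sign (final_sign s u) u') (duration d u + duration d u')
          (y0 + disp s u + disp (final_sign s u) u'))"
    proof (rule expect_cong)
      fix u' :: "letter list" assume u': "length u' = 3 * N"
      have "expect M (\<lambda>v. T (u @ u' @ v)) = expect M (\<lambda>v. of_bool (\<bar>y0 + disp s u\<bar> \<le> int R) *
        of_bool (hits d t z (final_sign (final_sign s u) u') (duration d u + duration d u')
          (y0 + disp s u + disp (final_sign s u) u') v))"
        using u u' by (intro expect_cong) (simp add: T_def final_sign_append disp_append add.assoc)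
      then show "expect M (\<lambda>v. T (u @ u' @ v)) = of_bool (\<bar>y0 + disp s u\<bar> \<le> int R) *
        \<Phi>1 (final_sign (final_sign s u) u') (duration d u + duration d u')
          (y0 + disp s u + disp (final_sign s u) u')"
        by (simp only: expect_cmult \<Phi>1_def)
    qed
    then show "expect (3 * N) (\<lambda>u'. expect M (\<lambda>v. T (u @ u' @ v))) = of_bool (\<bar>y0 + disp s u\<bar> \<le> int R) *
        run (3 * N) \<Phi>1 (final_sign s u) (duration d u) (y0 + disp s u)"
      by (simp only: expect_cmult run_def)
  qed
  also have "\<dots> \<le> expect (3 * N) (\<lambda>u. (20 / b) * of_bool (\<bar>y0 + disp s u\<bar> \<le> int R))"
  proof (rule expect_mono)
    fix u
    have "run (3 * N) \<Phi>1 (final_sign s u) (duration d u) (y0 + disp s u) \<le> 20 / b"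
      using run_hits_le a unfolding \<Phi>1_def by (rule order_trans)
    then show "of_bool (\<bar>y0 + disp s u\<bar> \<le> int R) * run (3 * N) \<Phi>1 (final_sign s u) (duration d u) (y0 + disp s u)
        \<le> (20 / b) * of_bool (\<bar>y0 + disp s u\<bar> \<le> int R)" by simp
  qed
  also have "\<dots> = (20 / b) * run (3 * N) \<Phi>3 s 0 y0"
    by (simp only: expect_cmult run_def \<Phi>3_def)
  also have "\<dots> \<le> (20 / b) * ((2 * real R + 1) / sqrt (1 + real N * \<kappa>))"
  proof (intro mult_left_mono anticoncentration)
    fix Y :: "int set" assume "finite Y"
    then have "(\<Sum>y\<in>Y. \<Phi>3 s \<tau> y) = real (card {y \<in> Y. \<bar>y\<bar> \<le> int R})" for s \<tau>
      by (simp add: \<Phi>3_def Int_def)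
    also have "card {y \<in> Y. \<bar>y\<bar> \<le> int R} \<le> card {- int R..int R}"
      by (intro card_mono) auto
    finally show "(\<Sum>y\<in>Y. \<Phi>3 s \<tau> y) \<le> 2 * real R + 1" for s \<tau> by simp
  qed (use b in \<open>auto simp: \<Phi>3_def\<close>)
  also have "\<dots> = (20 / b) * ((2 * real R + 1) * (1 / sqrt (1 + real N * \<kappa>)))" by simp
  also have "\<dots> \<le> (20 / b) * ((2 * real R + 1) * (20 / b))"
    using a b by (intro mult_left_mono) auto
  also have "\<dots> = (400 + 800 * real R) / b ^ 2"
    by (simp add: power2_eq_square field_simps)
  finally have T: "expect t T \<le> (400 + 800 * real R) / b ^ 2" .
  have "expect t (\<lambda>w. of_bool (t < duration d (take (6 * N) w)) +
      of_bool (hits d t z s 0 y0 w \<and> duration d (take (6 * N) w) \<le> t \<and> \<bar>y0 + disp s (take (3 * N) w)\<bar> \<le> int R))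
    \<le> expect t (\<lambda>w. of_bool (t < duration d (take (6 * N) w)) + T w)"
  proof (intro expect_mono add_left_mono)
    fix w
    have "T w \<ge> 0" by (simp add: T_def)
    moreover have "T w = 1" if "hits d t z s 0 y0 w" "duration d (take (6 * N) w) \<le> t"
      "\<bar>y0 + disp s (take (3 * N) w)\<bar> \<le> int R"
      using hits_append[of d t z s 0 y0 "take (6 * N) w" "drop (6 * N) w"] d_pos that
      by (simp add: T_def)
    ultimately show "of_bool (hits d t z s 0 y0 w \<and> duration d (take (6 * N) w) \<le> t \<and>
        \<bar>y0 + disp s (take (3 * N) w)\<bar> \<le> int R) \<le> T w" by auto
  qed
  also have "\<dots> = expect (6 * N) (\<lambda>w. of_bool (t < duration d w)) + expect t T"
    using expect_take[of "6 * N" t "\<lambda>w. of_bool (t < duration d w)"] block_le[of t]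
    by (simp only: expect_add N_def)
  also have "expect (6 * N) (\<lambda>w. of_bool (t < duration d w)) \<le> 2 / b ^ 2"
  proof (subst pos_le_divide_eq)
    show "0 < b ^ 2" using b(1) by simp
    show "expect (6 * N) (\<lambda>w. of_bool (t < duration d w)) * b ^ 2 \<le> 2"
      using expect_late[of t] unfolding b(2) N_def by (simp only: mult.commute)
  qed
  also have "2 / b ^ 2 + expect t T \<le> 2 / b ^ 2 + (400 + 800 * real R) / b ^ 2"
    using T by simp
  also have "\<dots> \<le> (802 + 800 * real R) / b ^ 2"
    using b(1) by (simp add: divide_right_mono flip: add_divide_distrib)
  finally show ?thesis by (simp add: b(2))
qed

end

section \<open>Weighted counts\<close>

context letter_weights
begin

text \<open>\<open>renewal t\<close> is the probability that some letter of the random word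
  ends at time \<open>t\<close>. Negative times avoid truncated subtraction in the recursion.\<close>

definition renewal :: "int \<Rightarrow> real" where
  "renewal t = (if t < 0 then 0 else x ^ nat t * real (card {w. duration d w = nat t}))"

lemma renewal_le_1: "renewal t \<le> 1"
proof (cases "t < 0")
  case False
  have "x ^ nat t * (\<Sum>w | duration d w = nat t. 1) \<le> expect (nat t) (\<lambda>_. 1)"
    by (rule sum_duration_le_expect) auto
  then show ?thesis using False by (simp add: renewal_def)
qed (simp add: renewal_def)

lemma renewal_0: "renewal 0 = 1"
proof -
  have "{w. duration d w = 0} = {[]}" using duration_eq_0_iff[OF d_pos] by auto
  then show ?thesis by (simp add: renewal_def)
qed

lemma renewal_rec:
  assumes "t > 0"
  shows "renewal t = (1 - q) * renewal (t - 2) + q * renewal (t - int (2 * d + 1))"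
proof -
  define T where "T = nat t"
  have t: "t = int T" "T > 0" using assms by (auto simp: T_def)
  define S where "S a = {w. len d a + duration d w = T}" for a
  have fin: "finite (S a)" for a
    by (rule finite_subset[OF _ finite_duration[OF d_pos, of "T - len d a"]]) (auto simp: S_def)
  have "{w. duration d w = T} = (\<Union>a. (#) a ` S a)"
  proof (intro equalityI subsetI)
    fix w assume "w \<in> {w. duration d w = T}"
    then show "w \<in> (\<Union>a. (#) a ` S a)" using t by (cases w) (auto simp: S_def)
  qed (auto simp: S_def)
  then have "card {w. duration d w = T} = (\<Sum>a\<in>UNIV. card ((#) a ` S a))"
    using fin by (subst card_UN_disjoint[symmetric]) (auto simp: UNIV_letter)
  also have "\<dots> = (\<Sum>a\<in>UNIV. card (S a))"
    by (intro sum.cong refl card_image) auto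
  finally have "renewal t = (\<Sum>a\<in>UNIV. x ^ T * real (card (S a)))"
    using t by (simp add: renewal_def sum_distrib_left)
  also have "\<dots> = (\<Sum>a\<in>UNIV. x ^ len d a * renewal (t - int (len d a)))"
  proof (intro sum.cong refl)
    fix a
    show "x ^ T * real (card (S a)) = x ^ len d a * renewal (t - int (len d a))"
    proof (cases "len d a \<le> T")
      case True
      then have "S a = {w. duration d w = T - len d a}" by (auto simp: S_def)
      moreover have "nat (t - int (len d a)) = T - len d a" using t by simp
      moreover have "x ^ T = x ^ len d a * x ^ (T - len d a)"
        using True by (simp flip: power_add)
      ultimately show ?thesis using True t by (simp add: renewal_def)
    next
      case False
      then have "S a = {}" by (auto simp: S_def)
      then show ?thesis using False t by (simp add: renewal_def)
    qed
  qed
  also have "\<dots> = 2 * x ^ 2 * renewal (t - 2) + q * renewal (t - int (2 * d + 1))"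
    by (simp add: UNIV_letter q_def)
  finally show ?thesis by (simp add: x_sq)
qed

text \<open>Exactly one letter covers the time \<open>t\<close>. The terms sort by its starting
  time: any letter begun at \<open>t\<close> or \<open>t - 1\<close>, or a \<open>Jp\<close> begun
  \<open>j\<close> steps earlier with \<open>j\<close> from 2 to \<open>2 * d\<close>.\<close>

lemma renewal_sum: "renewal (int t) + renewal (int t - 1) + q * (\<Sum>j=2..2 * d. renewal (int t - int j)) = 1"
proof (induction t)
  case 0
  have "(\<Sum>j=2..2 * d. renewal (int 0 - int j)) = 0" by (intro sum.neutral) (auto simp: renewal_def)
  then show ?case using renewal_0 by (simp add: renewal_def)
next
  case (Suc t)
  obtain D where D: "2 * d = Suc D" "D \<ge> 1" using d_pos by (cases "2 * d") auto
  have "(\<Sum>j=2..2 * d. renewal (int (Suc t) - int j)) = (\<Sum>j=1..D. renewal (int t - int j))"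
    unfolding D using sum.shift_bounds_cl_Suc_ivl[of "\<lambda>j. renewal (int (Suc t) - int j)" 1 D]
    by (simp add: numeral_2_eq_2)
  moreover have "(\<Sum>j=1..D. renewal (int t - int j)) + renewal (int t - int (2 * d))
      = renewal (int t - 1) + (\<Sum>j=2..2 * d. renewal (int t - int j))"
  proof -
    have "(\<Sum>j=1..Suc D. renewal (int t - int j)) = (\<Sum>j=1..D. renewal (int t - int j)) + renewal (int t - int (Suc D))"
      by simp
    moreover have "(\<Sum>j=1..Suc D. renewal (int t - int j)) = renewal (int t - 1) + (\<Sum>j=2..Suc D. renewal (int t - int j))"
      using sum.atLeast_Suc_atMost[of 1 "Suc D" "\<lambda>j. renewal (int t - int j)"] by (simp add: numeral_2_eq_2)
    ultimately show ?thesis unfolding D by linarith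
  qed
  moreover have "renewal (int (Suc t)) = (1 - q) * renewal (int t - 1) + q * renewal (int t - int (2 * d))"
    using renewal_rec[of "int (Suc t)"] by (simp add: algebra_simps)
  moreover have "(1 - q) * a + q * u + r + q * S = r + a + q * S'" if "S + u = a + S'" for a u r S S' :: real
    using arg_cong[OF that, of "\<lambda>z. q * z"] by (simp add: algebra_simps)
  ultimately have "renewal (int (Suc t)) + renewal (int (Suc t) - 1) + q * (\<Sum>j=2..2 * d. renewal (int (Suc t) - int j))
      = renewal (int t) + renewal (int t - 1) + q * (\<Sum>j=2..2 * d. renewal (int t - int j))"
    by simp
  then show ?case using Suc.IH by simp
qed

text \<open>Two consecutive times are needed because words without \<open>Jp\<close> reach even
  times only. By \<open>q_mult_le\<close> the sum in \<open>renewal_sum\<close> takes at most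
  \<open>9 / 16\<close>, so one of the two values is at least \<open>7 / 32\<close>.\<close>

lemma renewal_large: "\<exists>t'\<in>{t, t + 1}. renewal (int t') \<ge> 1 / 5"
proof -
  have "(\<Sum>j=2..2 * d. renewal (int (t + 1) - int j)) \<le> (\<Sum>j=2..2 * d. 1)"
    by (intro sum_mono renewal_le_1)
  also have "\<dots> = 2 * real d - 1" using d_pos by (simp add: of_nat_diff)
  finally have "q * (\<Sum>j=2..2 * d. renewal (int (t + 1) - int j)) \<le> q * (2 * real d - 1)"
    using q_pos by (intro mult_left_mono) auto
  then have "renewal (int (t + 1)) + renewal (int t) \<ge> 7 / 16"
    using renewal_sum[of "t + 1"] q_mult_le by (simp add: mult.commute)
  then show ?thesis by auto
qed

section \<open>Lower bound for the number of homomorphisms\<close>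

text \<open>By Chebyshev, heights beyond \<open>16 * b\<close> carry weight at most
  \<open>24 / 256\<close>, so the at most \<open>35 * b\<close> heights in \<open>Y\<close> carry
  \<open>1 / 10\<close>. Cauchy-Schwarz turns this into
  \<open>(1 / 10) ^ 2 / (35 * b)\<close>.\<close>

lemma sum_words_to_sq:
  assumes t: "renewal (int t) \<ge> 1 / 5"
  shows "\<exists>Y. finite Y \<and>
    1 / (3500 * sqrt (1 + real t * q)) \<le> x ^ (2 * t) * (\<Sum>y\<in>Y. real ((card (words_to t d y))\<^sup>2))"
proof -
  define b where "b = sqrt (1 + real t * q)"
  have b: "b \<ge> 1" "b ^ 2 = 1 + real t * q" using q_pos by (auto simp: b_def)
  define R where "R = \<lceil>16 * b\<rceil>"
  have R: "16 * b \<le> real_of_int R" "real_of_int R \<le> 16 * b + 1" by (simp_all add: R_def)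
  have R0: "R \<ge> 0" using R b by linarith
  define Y where "Y = {- R..R}"
  define W where "W = {w. duration d w = t}"
  have finW: "finite W" unfolding W_def by (rule finite_duration[OF d_pos])
  define A where "A y = x ^ t * real (card (words_to t d y))" for y
  have "x ^ t * (\<Sum>w | duration d w = t. (real_of_int (disp True w)) ^ 2)
      \<le> expect t (\<lambda>w. (real_of_int (peak 0 True w)) ^ 2)"
  proof (rule sum_duration_le_expect)
    fix w k
    have "\<bar>disp True (take k w)\<bar> \<le> peak 0 True w"
      using abs_disp_le_peak[of 0 True "take k w"] peak_take[of 0 True k w] by simp
    then have "\<bar>real_of_int (disp True (take k w))\<bar> ^ 2 \<le> (real_of_int (peak 0 True w)) ^ 2"
      by (intro power_mono) linarith+
    then show "(real_of_int (disp True (take k w))) ^ 2 \<le> (real_of_int (peak 0 True w)) ^ 2" by simp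
  qed auto
  also have "\<dots> \<le> 24 * b ^ 2"
    using expect_peak_sq[of 0 t True] unfolding b(2) by simp
  finally have second: "x ^ t * (\<Sum>w\<in>W. (real_of_int (disp True w)) ^ 2) \<le> 24 * b ^ 2"
    by (simp add: W_def)
  define far where "far = {w \<in> W. \<bar>disp True w\<bar> > R}"
  have "(16 * b) ^ 2 * (x ^ t * real (card far)) = x ^ t * (\<Sum>w\<in>far. (16 * b) ^ 2)"
    by (simp add: mult_ac)
  also have "\<dots> \<le> x ^ t * (\<Sum>w\<in>far. (real_of_int (disp True w)) ^ 2)"
  proof (intro mult_left_mono sum_mono)
    fix w assume "w \<in> far"
    then have "16 * b \<le> \<bar>real_of_int (disp True w)\<bar>" using R by (auto simp: far_def)
    then have "(16 * b) ^ 2 \<le> \<bar>real_of_int (disp True w)\<bar> ^ 2" using b by (intro power_mono) auto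
    then show "(16 * b) ^ 2 \<le> (real_of_int (disp True w)) ^ 2" by simp
  qed (use x_pos in auto)
  also have "\<dots> \<le> x ^ t * (\<Sum>w\<in>W. (real_of_int (disp True w)) ^ 2)"
    using x_pos finW by (intro mult_left_mono sum_mono2) (auto simp: far_def)
  also have "\<dots> \<le> 24 * b ^ 2" by (rule second)
  finally have "b ^ 2 * (256 * (x ^ t * real (card far))) \<le> b ^ 2 * 24"
    by (simp add: power_mult_distrib mult_ac)
  then have far: "x ^ t * real (card far) \<le> 1 / 10"
    using b(1) by (subst (asm) mult_le_cancel_left_pos) (auto simp: mult.commute)
  have "W \<subseteq> far \<union> (\<Union>y\<in>Y. words_to t d y)"
    by (auto simp: far_def W_def Y_def words_to_def)
  then have "card W \<le> card (far \<union> (\<Union>y\<in>Y. words_to t d y))"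
    using finW finite_words_to[OF d_pos] by (intro card_mono) (auto simp: Y_def far_def)
  also have "\<dots> \<le> card far + card (\<Union>y\<in>Y. words_to t d y)" by (rule card_Un_le)
  also have "\<dots> \<le> card far + (\<Sum>y\<in>Y. card (words_to t d y))"
    by (intro add_left_mono card_UN_le) (simp add: Y_def)
  finally have "real (card W) \<le> real (card far) + (\<Sum>y\<in>Y. real (card (words_to t d y)))"
    by (simp flip: of_nat_sum of_nat_add)
  then have "x ^ t * real (card W) \<le> x ^ t * (real (card far) + (\<Sum>y\<in>Y. real (card (words_to t d y))))"
    using x_pos by (intro mult_left_mono) auto
  also have "\<dots> = x ^ t * real (card far) + (\<Sum>y\<in>Y. A y)"
    by (simp add: A_def distrib_left sum_distrib_left)
  finally have "1 / 10 \<le> (\<Sum>y\<in>Y. A y)"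
    using t far by (simp add: renewal_def W_def)
  then have "(1 / 10) ^ 2 \<le> (\<Sum>y\<in>Y. A y) ^ 2" by (intro power_mono) auto
  also have "\<dots> \<le> real (card Y) * (\<Sum>y\<in>Y. (A y) ^ 2)"
    using sum_squared_le_sum_of_squares[of A Y] by (simp add: mult.commute)
  also have "\<dots> \<le> (35 * b) * (\<Sum>y\<in>Y. (A y) ^ 2)"
  proof (intro mult_right_mono sum_nonneg)
    have "real (card Y) = 2 * real_of_int R + 1" using R0 by (simp add: Y_def)
    then show "real (card Y) \<le> 35 * b" using R b by simp
  qed simp
  also have "(\<Sum>y\<in>Y. (A y) ^ 2) = x ^ (2 * t) * (\<Sum>y\<in>Y. real ((card (words_to t d y))\<^sup>2))"
    by (simp add: A_def power_mult_distrib sum_distrib_left power_mult mult.commute flip: power_mult)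
  finally have "1 / 100 \<le> (35 * b) * (x ^ (2 * t) * (\<Sum>y\<in>Y. real ((card (words_to t d y))\<^sup>2)))"
    by (simp add: power2_eq_square)
  then have "1 / (3500 * b) \<le> x ^ (2 * t) * (\<Sum>y\<in>Y. real ((card (words_to t d y))\<^sup>2))"
    using b(1) by (simp add: field_simps)
  then show ?thesis unfolding b_def by (intro exI[of _ Y]) (auto simp: Y_def)
qed

text \<open>Each half lasts \<open>t\<close>, one of two times slightly below \<open>n / 2\<close>
  with a large renewal probability. The other letters last at most 8 and cost at most
  \<open>1 / 256\<close>; the constant is \<open>256 * 3500\<close>.\<close>

lemma torus_Hom_weight_ge:
  assumes n: "even n" "n \<ge> 8"
  shows "1 / (896000 * sqrt (1 + real n * q)) \<le> x ^ n * real (card (torus_Hom n d))"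
proof -
  obtain m where m: "n = 2 * m" "m \<ge> 4" using n by (auto elim!: evenE)
  obtain t where t: "t \<in> {m - 4, m - 4 + 1}" "renewal (int t) \<ge> 1 / 5"
    using renewal_large by blast
  define k where "k = m - t - 2"
  have k: "n = 2 * k + 2 * t + 4" "k > 0" "k \<le> 2" using t m by (auto simp: k_def)
  obtain Y where Y: "finite Y"
    "1 / (3500 * sqrt (1 + real t * q)) \<le> x ^ (2 * t) * (\<Sum>y\<in>Y. real ((card (words_to t d y))\<^sup>2))"
    using sum_words_to_sq[OF t(2)] by blast
  have "(\<Sum>y\<in>Y. (card (words_to t d y))\<^sup>2) \<le> card (torus_Hom n d)"
    by (rule card_torus_Hom_ge[OF d_pos k(1,2) Y(1)])
  then have "real (\<Sum>y\<in>Y. (card (words_to t d y))\<^sup>2) \<le> real (card (torus_Hom n d))"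
    by (simp only: of_nat_le_iff)
  then have c: "(\<Sum>y\<in>Y. real ((card (words_to t d y))\<^sup>2)) \<le> real (card (torus_Hom n d))"
    by (simp only: of_nat_sum)
  have "1 / 256 = (1 / 2 :: real) ^ 8" by (simp add: power_divide)
  also have "\<dots> \<le> (1 / 2) ^ (2 * k + 4)" using k by (intro power_decreasing) auto
  also have "\<dots> \<le> x ^ (2 * k + 4)" using x_ge_half by (intro power_mono) auto
  finally have x8: "1 / 256 \<le> x ^ (2 * k + 4)" .
  have "sqrt (1 + real t * q) \<le> sqrt (1 + real n * q)"
    using k(1) q_pos by (intro real_sqrt_le_mono add_left_mono mult_right_mono) auto
  moreover have "sqrt (1 + real t * q) > 0" using q_pos by (auto intro!: add_pos_nonneg)
  ultimately have "1 / (3500 * sqrt (1 + real n * q)) \<le> 1 / (3500 * sqrt (1 + real t * q))"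
    by (intro divide_left_mono) auto
  also note Y(2)
  also have "x ^ (2 * t) * (\<Sum>y\<in>Y. real ((card (words_to t d y))\<^sup>2)) \<le> x ^ (2 * t) * real (card (torus_Hom n d))"
    using c x_pos by (intro mult_left_mono) auto
  finally have "1 / 256 * (1 / (3500 * sqrt (1 + real n * q)))
      \<le> x ^ (2 * k + 4) * (x ^ (2 * t) * real (card (torus_Hom n d)))"
    using x8 x_pos q_pos by (intro mult_mono) auto
  also have "\<dots> = x ^ n * real (card (torus_Hom n d))"
    unfolding k(1) by (simp add: power_add)
  finally show ?thesis by simp
qed

text \<open>The walk is cut after its first letter because the origin is a uniformly chosen
  point of that letter, whence the size-biasing factor \<open>len d (hd w)\<close>.\<close>

lemma closed_words_weight_le:
  fixes \<gamma> :: "bool \<Rightarrow> letter list \<Rightarrow> real" and g :: "int \<Rightarrow> bool \<Rightarrow> letter list \<Rightarrow> real"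
  assumes n: "n \<ge> 4 * d + 4"
    and g: "\<And>y s w. g y s w \<ge> 0" and B: "B \<ge> 0"
    and \<gamma>: "\<And>s b w. \<gamma> s (Sg b # w) \<le> g 0 b w" "\<And>s w. \<gamma> s (Jp # w) \<le> g (sg s) s w"
    and bound: "\<And>y s t. \<bar>y\<bar> \<le> 1 \<Longrightarrow> n \<le> 2 * t \<Longrightarrow>
      x ^ t * (\<Sum>w | duration d w = t. of_bool (y + disp s w = 0) * g y s w) \<le> B"
  shows "x ^ n * (\<Sum>s\<in>UNIV. \<Sum>w\<in>closed_words n d s. real (len d (hd w)) * \<gamma> s w) \<le> 8 * B"
proof -
  have main: "x ^ n * (\<Sum>w\<in>closed_words n d s. real (len d (hd w)) * \<gamma> s w) \<le> 4 * B" for s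
  proof -
    define yy where "yy a = (if a = Jp then sg s else 0)" for a
    define ss where "ss a = (case a of Sg b \<Rightarrow> b | Jp \<Rightarrow> s)" for a
    define h where "h a w = of_bool (yy a + disp (ss a) w = 0) * g (yy a) (ss a) w" for a w
    have h0: "h a w \<ge> 0" for a w using g by (simp add: h_def)
    \<comment> \<open>The first letter takes at most half of \<open>n\<close>, so the rest still has
      duration of order \<open>n\<close>.\<close>
    have len: "len d a \<le> n" "n \<le> 2 * (n - len d a)" for a
      using len_le[OF d_pos, of a] n by auto
    have "(\<Sum>w\<in>closed_words n d s. real (len d (hd w)) * \<gamma> s w)
        \<le> (\<Sum>(a, w)\<in>(SIGMA a:UNIV. {w. duration d w = n - len d a}). real (len d a) * h a w)"
    proof (rule sum_le_included[where i = "\<lambda>(a, w). a # w"])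
      show "finite (closed_words n d s)" by (rule finite_closed_words[OF d_pos])
      show "finite (SIGMA a:UNIV. {w. duration d w = n - len d a})"
        by (intro finite_SigmaI finite_duration[OF d_pos]) (simp add: UNIV_letter)
      show "\<forall>y\<in>SIGMA a:UNIV. {w. duration d w = n - len d a}.
          0 \<le> (case y of (a, w) \<Rightarrow> real (len d a) * h a w)" using h0 by auto
      show "\<forall>w\<in>closed_words n d s. \<exists>y\<in>SIGMA a:UNIV. {w. duration d w = n - len d a}.
          (case y of (a, w) \<Rightarrow> a # w) = w \<and>
          real (len d (hd w)) * \<gamma> s w \<le> (case y of (a, w) \<Rightarrow> real (len d a) * h a w)"
      proof
        fix w assume w: "w \<in> closed_words n d s"
        then obtain a v where av: "w = a # v" using n by (cases w) (auto simp: closed_words_def)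
        have "\<gamma> s w \<le> h a v"
          using w \<gamma> unfolding av
          by (cases a) (auto simp: h_def yy_def ss_def closed_words_def)
        then have "real (len d (hd w)) * \<gamma> s w \<le> real (len d a) * h a v"
          unfolding av by (simp add: mult_left_mono)
        moreover have "duration d v = n - len d a" using w av by (auto simp: closed_words_def)
        ultimately show "\<exists>y\<in>SIGMA a:UNIV. {w. duration d w = n - len d a}.
          (case y of (a, w) \<Rightarrow> a # w) = w \<and>
          real (len d (hd w)) * \<gamma> s w \<le> (case y of (a, w) \<Rightarrow> real (len d a) * h a w)"
          using av by (intro bexI[of _ "(a, v)"]) auto
      qed
    qed
    also have "\<dots> = (\<Sum>a\<in>UNIV. real (len d a) * (\<Sum>w | duration d w = n - len d a. h a w))"
      using finite_duration[OF d_pos] by (subst sum.Sigma[symmetric]) (auto simp: UNIV_letter sum_distrib_left)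
    finally have "x ^ n * (\<Sum>w\<in>closed_words n d s. real (len d (hd w)) * \<gamma> s w)
        \<le> x ^ n * (\<Sum>a\<in>UNIV. real (len d a) * (\<Sum>w | duration d w = n - len d a. h a w))"
      using x_pos by (intro mult_left_mono) auto
    also have "\<dots> = (\<Sum>a\<in>UNIV. real (len d a) * x ^ len d a *
        (x ^ (n - len d a) * (\<Sum>w | duration d w = n - len d a. h a w)))"
    proof -
      have "x ^ n = x ^ len d a * x ^ (n - len d a)" for a
        using len(1)[of a] by (simp flip: power_add)
      then show ?thesis by (simp only: sum_distrib_left) (intro sum.cong refl, simp only: mult_ac)
    qed
    also have "\<dots> \<le> (\<Sum>a\<in>UNIV. real (len d a) * x ^ len d a * B)"
    proof (intro sum_mono mult_left_mono)
      fix a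
      show "x ^ (n - len d a) * (\<Sum>w | duration d w = n - len d a. h a w) \<le> B"
        unfolding h_def by (rule bound) (use len in \<open>auto simp: yy_def\<close>)
    qed (use x_pos in auto)
    \<comment> \<open>The size-biased total weight of the first letter, which is the mean letter
      duration.\<close>
    also have "\<dots> = (2 + (2 * real d - 1) * q) * B"
    proof -
      have "(\<Sum>a\<in>UNIV. F a) = F (Sg True) + F (Sg False) + F Jp" for F :: "letter \<Rightarrow> real"
        by (simp add: UNIV_letter)
      moreover have "x ^ len d (Sg b) = (1 - q) / 2" "x ^ len d Jp = q" for b
        by (simp_all add: x_sq q_def)
      ultimately show ?thesis by (simp only:) (simp add: algebra_simps)
    qed
    also have "\<dots> \<le> 4 * B" using q_mult_le B by (intro mult_right_mono) auto
    finally show ?thesis .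
  qed
  show ?thesis using main[of True] main[of False] by (simp add: UNIV_bool distrib_left)
qed

section \<open>Weighted sums over homomorphisms\<close>

lemma sum_card_Rng_le:
  assumes n: "even n" "n \<ge> 4 * d + 4"
  shows "x ^ n * (\<Sum>f\<in>torus_Hom n d. real (card (Rng n f))) \<le> 16000"
proof -
  define g where "g = (\<lambda>y s w. 2 * real_of_int (peak y s w) + 3)"
  have g: "g y s w \<ge> 0" for y s w using peak_nonneg[of y s w] by (simp add: g_def)
  have "(\<Sum>f\<in>torus_Hom n d. real (card (Rng n f)))
      \<le> (\<Sum>s\<in>UNIV. \<Sum>w\<in>closed_words n d s. real (len d (hd w)) * g 0 s w)"
  proof (rule sum_torus_Hom_le[OF d_pos n])
    fix f s w c assume w: "w \<in> closed_words n d s"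
      and f: "\<forall>i<n. f i = word_path d 0 s w ((i + c) mod n) - word_path d 0 s w c"
    have "int (card (Rng n f)) \<le> 2 * peak 0 s w + 3"
      by (rule card_Rng_le_peak[OF w d_pos _ f]) (use n in auto)
    then show "real (card (Rng n f)) \<le> g 0 s w" unfolding g_def by linarith
  qed (rule g)
  then have "x ^ n * (\<Sum>f\<in>torus_Hom n d. real (card (Rng n f)))
      \<le> x ^ n * (\<Sum>s\<in>UNIV. \<Sum>w\<in>closed_words n d s. real (len d (hd w)) * g 0 s w)"
    using x_pos by (intro mult_left_mono) auto
  also have "\<dots> \<le> 8 * 2000"
  proof (rule closed_words_weight_le[OF n(2) g])
    fix y :: int and s t assume y: "\<bar>y\<bar> \<le> 1"
    have "x ^ t * (\<Sum>w | duration d w = t. of_bool (y + disp s w = 0) * g y s w)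
        \<le> expect t (\<lambda>w. g y s w * of_bool (hits d t 0 s 0 y w))"
    proof (rule sum_duration_le_expect)
      fix w :: "letter list" and k assume k: "length w = t" "k \<le> t" "duration d (take k w) = t"
      show "of_bool (y + disp s (take k w) = 0) * g y s (take k w) \<le> g y s w * of_bool (hits d t 0 s 0 y w)"
      proof (cases "y + disp s (take k w) = 0")
        case True
        then have "hits d t 0 s 0 y w" using k by (auto simp: hits_def)
        then show ?thesis using True peak_take[of y s k w] by (simp add: g_def)
      qed (use g in simp)
    qed (use g in auto)
    also have "\<dots> \<le> 2000" unfolding g_def by (rule expect_peak_hits[OF y])
    finally show "x ^ t * (\<Sum>w | duration d w = t. of_bool (y + disp s w = 0) * g y s w) \<le> 2000" .
  next
    fix s b w
    show "g 0 s (Sg b # w) \<le> g 0 b w" using peak_nonneg[of 0 b w] by (simp add: g_def)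
    show "g 0 s (Jp # w) \<le> g (sg s) s w" using peak_nonneg[of "sg s" s w] by (simp add: g_def)
  qed simp
  finally show ?thesis by simp
qed

text \<open>A small range confines the displacement of every prefix, in particular of the one with
  \<open>3 * N\<close> letters. The factor 2 in \<open>B\<close> accounts for
  \<open>t \<ge> n / 2\<close>.\<close>

lemma sum_small_Rng_le:
  assumes n: "even n" "n \<ge> 4 * d + 4"
  shows "x ^ n * real (card {f \<in> torus_Hom n d. card (Rng n f) \<le> R})
    \<le> 16 * (802 + 800 * real R) / (1 + real n * q)"
proof -
  define g :: "int \<Rightarrow> bool \<Rightarrow> letter list \<Rightarrow> real" where
    "g = (\<lambda>y s w. of_bool (\<forall>u v. w = u @ v \<longrightarrow> \<bar>y + disp s u\<bar> \<le> int R))"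
  have g: "g y s w \<ge> 0" and g1: "g y s w \<le> 1" for y s w by (simp_all add: g_def)
  have fin: "finite (torus_Hom n d)" using n by (intro finite_torus_Hom) auto
  define B where "B = 2 * (802 + 800 * real R) / (1 + real n * q)"
  have "real (card {f \<in> torus_Hom n d. card (Rng n f) \<le> R})
      = (\<Sum>f\<in>torus_Hom n d. of_bool (card (Rng n f) \<le> R))"
    using fin by (simp add: Int_def)
  also have "\<dots> \<le> (\<Sum>s\<in>UNIV. \<Sum>w\<in>closed_words n d s. real (len d (hd w)) * g 0 s w)"
  proof (rule sum_torus_Hom_le[OF d_pos n])
    fix f s w c assume w: "w \<in> closed_words n d s"
      and f: "\<forall>i<n. f i = word_path d 0 s w ((i + c) mod n) - word_path d 0 s w c"
    have "\<bar>disp s u\<bar> + 1 \<le> int (card (Rng n f))" if "w = u @ v" for u v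
      by (rule abs_disp_less_card_Rng[OF w d_pos _ f that]) (use n in auto)
    then show "of_bool (card (Rng n f) \<le> R) \<le> g 0 s w"
      by (force simp: g_def)
  qed (rule g)
  finally have "x ^ n * real (card {f \<in> torus_Hom n d. card (Rng n f) \<le> R})
      \<le> x ^ n * (\<Sum>s\<in>UNIV. \<Sum>w\<in>closed_words n d s. real (len d (hd w)) * g 0 s w)"
    using x_pos by (intro mult_left_mono) auto
  also have "\<dots> \<le> 8 * B"
  proof (rule closed_words_weight_le[OF n(2) g])
    show "B \<ge> 0" using q_pos by (simp add: B_def)
  next
    fix y :: int and s t assume y: "\<bar>y\<bar> \<le> 1" and t: "n \<le> 2 * t"
    define N where "N = block t"
    have "x ^ t * (\<Sum>w | duration d w = t. of_bool (y + disp s w = 0) * g y s w)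
        \<le> expect t (\<lambda>w. of_bool (t < duration d (take (6 * N) w)) +
      of_bool (hits d t 0 s 0 y w \<and> duration d (take (6 * N) w) \<le> t \<and> \<bar>y + disp s (take (3 * N) w)\<bar> \<le> int R))"
    proof (rule sum_duration_le_expect)
      fix w :: "letter list" and k assume k: "length w = t" "k \<le> t" "duration d (take k w) = t"
      show "of_bool (y + disp s (take k w) = 0) * g y s (take k w)
        \<le> of_bool (t < duration d (take (6 * N) w)) +
      of_bool (hits d t 0 s 0 y w \<and> duration d (take (6 * N) w) \<le> t \<and> \<bar>y + disp s (take (3 * N) w)\<bar> \<le> int R)"
      proof (cases "y + disp s (take k w) = 0 \<and> g y s (take k w) \<noteq> 0 \<and> duration d (take (6 * N) w) \<le> t")
        case True
        then have h: "hits d t 0 s 0 y w" using k by (auto simp: hits_def)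
        \<comment> \<open>If fewer letters lasted \<open>t\<close>, the first \<open>6 * N\<close>
          letters would last longer than \<open>t\<close>.\<close>
        have "3 * N \<le> k"
        proof (rule ccontr)
          assume "\<not> 3 * N \<le> k"
          then have "k < 6 * N" by simp
          moreover have "6 * N \<le> length w" using block_le[of t] k by (simp add: N_def)
          ultimately show False using duration_take_strict[OF d_pos, of k "6 * N" w] k True by simp
        qed
        then have "take k w = take (3 * N) w @ take (k - 3 * N) (drop (3 * N) w)"
          by (metis le_add_diff_inverse take_add)
        then have "\<bar>y + disp s (take (3 * N) w)\<bar> \<le> int R"
          using True by (auto simp: g_def)
        then show ?thesis using True h by (simp add: g_def)
      qed (auto simp: g_def)
    qed (use g in auto)
    also have "\<dots> \<le> (802 + 800 * real R) / (1 + real t * q)"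
      unfolding N_def by (rule expect_small_hits)
    also have "\<dots> \<le> B"
    proof -
      have "real n \<le> 2 * real t" using t by linarith
      then have "real n * q \<le> (2 * real t) * q" using q_pos by (intro mult_right_mono) auto
      then have le: "1 + real n * q \<le> 2 * (1 + real t * q)" by simp
      have "1 + real n * q > 0" "1 + real t * q > 0" using q_pos by (auto intro!: add_pos_nonneg)
      then have "1 / (1 + real t * q) \<le> 2 / (1 + real n * q)" using le by (simp add: field_simps)
      then have "(802 + 800 * real R) * (1 / (1 + real t * q)) \<le> (802 + 800 * real R) * (2 / (1 + real n * q))"
        by (intro mult_left_mono) auto
      then show ?thesis by (simp add: B_def mult.commute)
    qed
    finally show "x ^ t * (\<Sum>w | duration d w = t. of_bool (y + disp s w = 0) * g y s w) \<le> B" .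
  next
    fix s b w
    show "g 0 s (Sg b # w) \<le> g 0 b w"
    proof (cases "g 0 s (Sg b # w) = 0")
      case False
      then have *: "\<bar>0 + disp s u\<bar> \<le> int R" if "Sg b # w = u @ v" for u v
        using that by (auto simp: g_def split: if_splits)
      have "\<bar>0 + disp b u\<bar> \<le> int R" if "w = u @ v" for u v
        using *[of "Sg b # u" v] that by simp
      then have "g 0 b w = 1" unfolding g_def by auto
      then show ?thesis using g1[of 0 s "Sg b # w"] by simp
    qed (use g in simp)
    show "g 0 s (Jp # w) \<le> g (sg s) s w"
    proof (cases "g 0 s (Jp # w) = 0")
      case False
      then have *: "\<bar>0 + disp s u\<bar> \<le> int R" if "Jp # w = u @ v" for u v
        using that by (auto simp: g_def split: if_splits)
      have "\<bar>sg s + disp s u\<bar> \<le> int R" if "w = u @ v" for u v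
        using *[of "Jp # u" v] that by simp
      then have "g (sg s) s w = 1" unfolding g_def by auto
      then show ?thesis using g1[of 0 s "Jp # w"] by simp
    qed (use g in simp)
  qed
  finally show ?thesis by (simp add: B_def)
qed

end

section \<open>The range of a random homomorphism\<close>

lemma letter_weights_exists:
  assumes "d > 0"
  shows "\<exists>x. letter_weights d x"
proof -
  have "\<exists>x\<ge>0. x \<le> 1 \<and> 2 * x ^ 2 + x ^ (2 * d + 1) = (1 :: real)"
    by (rule IVT') (auto intro!: continuous_intros)
  then obtain x :: real where x: "x \<ge> 0" "2 * x ^ 2 + x ^ (2 * d + 1) = 1" by blast
  then have "x > 0" by (cases "x = 0") auto
  then show ?thesis using x assms by (intro exI[of _ x]) (simp add: letter_weights_def)
qed

definition torus_scale :: "nat \<Rightarrow> nat \<Rightarrow> real" where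
  "torus_scale n d = sqrt (real n * 2 powr (- real d))"

lemma torus_scale_nonneg: "torus_scale n d \<ge> 0"
  by (simp add: torus_scale_def)

lemma torus_scale_sq: "torus_scale n d ^ 2 = real n / 2 ^ d"
  by (simp add: torus_scale_def powr_minus powr_realpow field_simps)

lemma (in letter_weights) sqrt_bounds:
  "sqrt (1 + real n * q) \<le> 1 + torus_scale n d" "torus_scale n d \<le> 3 * sqrt (1 + real n * q)"
proof -
  have "real n * q \<le> real n * ((3 / 4) / 2 ^ d)" by (intro mult_left_mono q_le) auto
  also have "\<dots> \<le> torus_scale n d ^ 2" unfolding torus_scale_sq by (simp add: field_simps)
  also have "\<dots> + 1 \<le> (1 + torus_scale n d) ^ 2"
    using torus_scale_nonneg[of n d] by (simp add: power2_eq_square algebra_simps)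
  finally have "1 + real n * q \<le> (1 + torus_scale n d) ^ 2" by simp
  then show "sqrt (1 + real n * q) \<le> 1 + torus_scale n d"
    using torus_scale_nonneg[of n d] by (intro real_le_lsqrt) auto
  have "real n * ((1 / 8) / 2 ^ d) \<le> real n * q" by (intro mult_left_mono q_ge) auto
  then have "torus_scale n d ^ 2 \<le> 8 * (real n * q)" unfolding torus_scale_sq by (simp add: field_simps)
  also have "\<dots> \<le> 9 * (1 + real n * q)" using q_pos by simp
  finally have "torus_scale n d \<le> sqrt (9 * (1 + real n * q))" by (rule real_le_rsqrt)
  also have "\<dots> = 3 * sqrt (1 + real n * q)"
  proof -
    have "sqrt (9 :: real) = 3" by (rule real_sqrt_unique) simp_all
    then show ?thesis by (simp only: real_sqrt_mult)
  qed
  finally show "torus_scale n d \<le> 3 * sqrt (1 + real n * q)" .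
qed

lemma prob_random_hom:
  assumes "even n" "n > 0"
  shows "measure_pmf.prob (random_hom n d) {f. P f}
    = real (card {f \<in> torus_Hom n d. P f}) / real (card (torus_Hom n d))"
  unfolding random_hom_def
  using torus_Hom_nonempty[OF assms] finite_torus_Hom[OF assms]
  by (simp add: measure_pmf_of_set Int_def conj_commute)

lemma expectation_random_hom:
  assumes "even n" "n > 0"
  shows "measure_pmf.expectation (random_hom n d) h
    = (\<Sum>f\<in>torus_Hom n d. h f) / real (card (torus_Hom n d))"
  unfolding random_hom_def
  using torus_Hom_nonempty[OF assms] finite_torus_Hom[OF assms]
  by (simp add: integral_pmf_of_set)

lemma card_torus_Hom_pos: "even n \<Longrightarrow> n > 0 \<Longrightarrow> card (torus_Hom n d) > 0"
  using torus_Hom_nonempty[of n d] finite_torus_Hom[of n d] by (simp add: card_gt_0_iff)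

text \<open>The constant is \<open>16000 * 896000\<close>, from \<open>sum_card_Rng_le\<close> and
  \<open>torus_Hom_weight_ge\<close>; the remaining factor \<open>b\<close> is the cost of
  conditioning.\<close>

lemma expectation_card_Rng_le:
  assumes n: "even n" "n > 0" and d: "d > 0"
  shows "measure_pmf.expectation (random_hom n d) (\<lambda>f. real (card (Rng n f)))
    \<le> 14336000000 * (torus_scale n d + 1)"
proof (cases "n < 4 * d + 4")
  case True
  have "(\<Sum>f\<in>torus_Hom n d. real (card (Rng n f))) \<le> (\<Sum>f\<in>torus_Hom n d. 3)"
  proof (rule sum_mono)
    fix f assume "f \<in> torus_Hom n d"
    moreover have "n \<ge> 2" using n by (auto elim!: evenE)
    ultimately show "real (card (Rng n f)) \<le> 3"
      using card_Rng_le_3[of f n d] n True by simp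
  qed
  then have "measure_pmf.expectation (random_hom n d) (\<lambda>f. real (card (Rng n f))) \<le> 3"
    using card_torus_Hom_pos[OF n, of d] by (simp add: expectation_random_hom[OF n] divide_le_eq)
  then show ?thesis using torus_scale_nonneg[of n d] by simp
next
  case False
  obtain x where "letter_weights d x" using letter_weights_exists[OF d] by blast
  then interpret letter_weights d x .
  define S where "S = (\<Sum>f\<in>torus_Hom n d. real (card (Rng n f)))"
  define H where "H = real (card (torus_Hom n d))"
  define b where "b = sqrt (1 + real n * q)"
  have b: "b \<ge> 1" using q_pos by (simp add: b_def)
  have H: "H > 0" using card_torus_Hom_pos[OF n] by (simp add: H_def)
  have xn: "x ^ n > 0" using x_pos by simp
  have "1 / (896000 * b) \<le> x ^ n * H"
    unfolding b_def H_def by (rule torus_Hom_weight_ge) (use n False d in auto)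
  then have "1 \<le> x ^ n * H * (896000 * b)" using b by (simp add: divide_le_eq)
  then have "16000 * 1 \<le> 16000 * (x ^ n * H * (896000 * b))" by (intro mult_left_mono) auto
  moreover have "x ^ n * S \<le> 16000"
    unfolding S_def by (rule sum_card_Rng_le) (use n False in auto)
  ultimately have "x ^ n * S \<le> 16000 * (x ^ n * H * (896000 * b))" by linarith
  also have "\<dots> = x ^ n * (14336000000 * b * H)" by simp
  finally have "x ^ n * S \<le> x ^ n * (14336000000 * b * H)" .
  then have "S \<le> 14336000000 * b * H" using xn by (simp only: mult_le_cancel_left_pos)
  then have "S / H \<le> 14336000000 * b" using H by (simp add: divide_le_eq)
  also have "\<dots> \<le> 14336000000 * (torus_scale n d + 1)"
    using sqrt_bounds(1)[of n] by (simp add: b_def)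
  finally show ?thesis by (simp add: expectation_random_hom[OF n] S_def H_def)
qed

text \<open>Here 48 is 16 from \<open>sum_small_Rng_le\<close> times 3 from
  \<open>sqrt_bounds\<close>; \<open>802 + 800 * R\<close> is absorbed into
  \<open>802 * (1 + R)\<close>.\<close>

definition small_const :: real where
  "small_const = 48 * 802 * 896000"

lemma prob_card_Rng_le:
  assumes n: "even n" "n \<ge> 4 * d + 4" and d: "d > 0"
  shows "torus_scale n d * measure_pmf.prob (random_hom n d) {f. card (Rng n f) \<le> R}
    \<le> small_const * (1 + real R)"
proof -
  obtain x where "letter_weights d x" using letter_weights_exists[OF d] by blast
  then interpret letter_weights d x .
  have n0: "n > 0" using n by simp
  define S where "S = real (card {f \<in> torus_Hom n d. card (Rng n f) \<le> R})"
  define H where "H = real (card (torus_Hom n d))"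
  define b where "b = sqrt (1 + real n * q)"
  have b: "b \<ge> 1" "b ^ 2 = 1 + real n * q" using q_pos by (simp_all add: b_def)
  have H: "H > 0" using card_torus_Hom_pos[OF n(1) n0] by (simp add: H_def)
  have xn: "x ^ n > 0" using x_pos by simp
  have "1 / (896000 * b) \<le> x ^ n * H"
    unfolding b_def H_def by (rule torus_Hom_weight_ge) (use n d in auto)
  then have h: "1 \<le> x ^ n * H * (896000 * b)" using b(1) by (simp add: divide_le_eq)
  have "x ^ n * S \<le> 16 * (802 + 800 * real R) / b ^ 2"
    unfolding S_def b(2) by (rule sum_small_Rng_le[OF n])
  then have "(x ^ n * S) * b ^ 2 \<le> 16 * (802 + 800 * real R)"
    using b(1) by (subst (asm) pos_le_divide_eq) auto
  also have "\<dots> \<le> 16 * 802 * (1 + real R) * 1" by simp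
  also have "\<dots> \<le> 16 * 802 * (1 + real R) * (x ^ n * H * (896000 * b))"
    using h by (intro mult_left_mono) auto
  finally have "(x ^ n * b) * (S * b) \<le> (x ^ n * b) * (16 * 802 * 896000 * (1 + real R) * H)"
    by (simp add: power2_eq_square mult_ac)
  then have "S * b \<le> 16 * 802 * 896000 * (1 + real R) * H"
    using xn b(1) by (subst (asm) mult_le_cancel_left_pos) auto
  then have "3 * b * (S / H) \<le> small_const * (1 + real R)"
    using H by (simp add: small_const_def field_simps)
  moreover have "torus_scale n d * (S / H) \<le> 3 * b * (S / H)"
    using sqrt_bounds(2)[of n] H by (intro mult_right_mono) (auto simp: b_def S_def)
  ultimately show ?thesis by (simp add: prob_random_hom[OF n(1) n0] S_def H_def)
qed

text \<open>Conversely, a scale of at least 3 guarantees \<open>n \<ge> 4 * d + 4\<close>, so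
  complete bipartite graphs are out of the way.\<close>

lemma torus_scale_small:
  assumes "n < 4 * d + 4" "even n" "d > 0"
  shows "torus_scale n d < 3"
proof -
  have "n \<le> 4 * d + 2" using assms by presburger
  moreover have "4 * k + 6 \<le> 6 * 2 ^ k" for k :: nat by (induction k) auto
  from this[of "d - 1"] have "4 * d + 2 \<le> 6 * 2 ^ (d - 1)" using assms(3) by simp
  moreover have "2 * 2 ^ (d - 1) = (2 :: nat) ^ d" using assms(3) by (cases d) auto
  ultimately have "n \<le> 3 * 2 ^ d" by linarith
  then have "real n \<le> real (3 * 2 ^ d)" by (simp only: of_nat_le_iff)
  then have "torus_scale n d ^ 2 \<le> 3" unfolding torus_scale_sq by (simp add: divide_le_eq)
  also have "\<dots> < 3 ^ 2" by simp
  finally show ?thesis by (rule power_less_imp_less_base) simp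
qed

lemma prob_card_Rng_less_3:
  assumes n: "even n" "n > 0"
  shows "measure_pmf.prob (random_hom n d) {f. card (Rng n f) < 3} \<le> 2 powr (1 - real n / 2)"
proof -
  have n2: "n \<ge> 2" using n by (auto elim!: evenE)
  have "real (card {f \<in> torus_Hom n d. card (Rng n f) < 3}) \<le> 2"
    using card_Rng_less_3[OF n2, of d] by simp
  moreover have "real (2 ^ (n div 2)) \<le> real (card (torus_Hom n d))"
    using card_torus_Hom_ge_power[OF n, of d] by (simp only: of_nat_le_iff)
  ultimately have "measure_pmf.prob (random_hom n d) {f. card (Rng n f) < 3} \<le> 2 / 2 ^ (n div 2)"
    unfolding prob_random_hom[OF n] by (intro frac_le) auto
  also have "\<dots> = 2 powr (1 - real n / 2)"
    using n by (auto elim!: evenE simp: powr_diff powr_realpow)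
  finally show ?thesis .
qed

lemma prob_small_range:
  assumes \<epsilon>: "\<epsilon> > 0"
  shows "\<exists>\<delta>>0. \<forall>n d. even n \<and> n > 0 \<and> d > 0 \<and> \<delta> * torus_scale n d \<ge> 1 \<longrightarrow>
    measure_pmf.prob (random_hom n d) {f. int (card (Rng n f)) < 3 + \<lfloor>\<delta> * torus_scale n d\<rfloor>} \<le> \<epsilon>"
\<comment> \<open>The first bound on \<open>\<delta>\<close> makes the scale at least 3 as soon as
  the product is at least 1; the second one absorbs
  \<open>1 + R \<le> 4 * (\<delta> * torus_scale n d)\<close>.\<close>
proof (intro exI[of _ "min (1 / 3) (\<epsilon> / (4 * small_const))"] conjI allI impI)
  have c: "small_const > 0" by (simp add: small_const_def)
  define \<delta> where "\<delta> = min (1 / 3) (\<epsilon> / (4 * small_const))"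
  have \<delta>: "\<delta> > 0" "\<delta> \<le> 1 / 3" "\<delta> \<le> \<epsilon> / (4 * small_const)" using c \<epsilon> by (auto simp: \<delta>_def)
  then show "min (1 / 3) (\<epsilon> / (4 * small_const)) > 0" by (simp add: \<delta>_def)
  fix n d assume "even n \<and> n > 0 \<and> d > 0 \<and> min (1 / 3) (\<epsilon> / (4 * small_const)) * torus_scale n d \<ge> 1"
  then have n: "even n" "n > 0" and d: "d > 0" and s: "\<delta> * torus_scale n d \<ge> 1"
    by (auto simp: \<delta>_def)
  have "\<delta> * torus_scale n d \<le> 1 / 3 * torus_scale n d"
    using \<delta> torus_scale_nonneg by (intro mult_right_mono) auto
  then have s3: "torus_scale n d \<ge> 3" using s by simp
  then have nd: "n \<ge> 4 * d + 4" using torus_scale_small[of n d] n d by fastforce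
  define R where "R = nat (2 + \<lfloor>\<delta> * torus_scale n d\<rfloor>)"
  have fl: "\<lfloor>\<delta> * torus_scale n d\<rfloor> \<ge> 1" using s by simp
  have R: "1 + real R \<le> 4 * (\<delta> * torus_scale n d)"
    using s fl by (simp add: R_def) linarith
  have "int R = 2 + \<lfloor>\<delta> * torus_scale n d\<rfloor>" using fl by (simp add: R_def)
  then have "{f. int (card (Rng n f)) < 3 + \<lfloor>\<delta> * torus_scale n d\<rfloor>} = {f. card (Rng n f) \<le> R}"
    by auto
  moreover have "torus_scale n d * measure_pmf.prob (random_hom n d) {f. card (Rng n f) \<le> R} \<le> torus_scale n d * \<epsilon>"
  proof -
    have "torus_scale n d * measure_pmf.prob (random_hom n d) {f. card (Rng n f) \<le> R}
        \<le> small_const * (1 + real R)"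
      by (rule prob_card_Rng_le[OF n(1) nd d])
    also have "\<dots> \<le> small_const * (4 * (\<delta> * torus_scale n d))"
      using R c by (intro mult_left_mono) auto
    also have "\<dots> = torus_scale n d * (\<delta> * (4 * small_const))" by simp
    also have "\<dots> \<le> torus_scale n d * \<epsilon>"
      using \<delta>(3) c torus_scale_nonneg by (intro mult_left_mono) (auto simp: pos_le_divide_eq)
    finally show ?thesis .
  qed
  ultimately show "measure_pmf.prob (random_hom n d) {f. int (card (Rng n f)) <
      3 + \<lfloor>min (1 / 3) (\<epsilon> / (4 * small_const)) * torus_scale n d\<rfloor>} \<le> \<epsilon>"
    using s3 by (simp add: \<delta>_def)
qed

text \<open>The range has at least 2 values always and at least \<open>m\<close> off the exceptional
  event.\<close>

lemma expectation_card_Rng_ge: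
  assumes n: "even n" "n > 0" and m: "m \<ge> 2"
  shows "measure_pmf.expectation (random_hom n d) (\<lambda>f. real (card (Rng n f)))
    \<ge> real m - (real m - 2) * measure_pmf.prob (random_hom n d) {f. card (Rng n f) < m}"
proof -
  let ?H = "torus_Hom n d"
  have fin: "finite ?H" by (rule finite_torus_Hom[OF n])
  have H: "real (card ?H) > 0" using card_torus_Hom_pos[OF n] by simp
  have "(\<Sum>f\<in>?H. real m - (real m - 2) * of_bool (card (Rng n f) < m)) \<le> (\<Sum>f\<in>?H. real (card (Rng n f)))"
  proof (rule sum_mono)
    fix f assume f: "f \<in> ?H"
    have "n \<ge> 2" using n by (auto elim!: evenE)
    then have "card (Rng n f) \<ge> 2" using card_Rng_ge_2[OF f] by simp
    then show "real m - (real m - 2) * of_bool (card (Rng n f) < m) \<le> real (card (Rng n f))"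
      by auto
  qed
  moreover have "(\<Sum>f\<in>?H. real m - (real m - 2) * of_bool (card (Rng n f) < m))
      = real (card ?H) * real m - (real m - 2) * real (card {f \<in> ?H. card (Rng n f) < m})"
    using fin by (simp add: sum_subtractf Int_def flip: sum_distrib_left)
  ultimately have "(real (card ?H) * real m - (real m - 2) * real (card {f \<in> ?H. card (Rng n f) < m})) / real (card ?H)
      \<le> (\<Sum>f\<in>?H. real (card (Rng n f))) / real (card ?H)"
    using H by (intro divide_right_mono) auto
  then show ?thesis
    unfolding prob_random_hom[OF n] expectation_random_hom[OF n]
    using H by (simp add: diff_divide_distrib)
qed

lemma expectation_lower:
  "\<exists>c>0. \<forall>n d. even n \<and> n > 0 \<and> d > 0 \<longrightarrow>
    3 + of_int \<lfloor>c * torus_scale n d\<rfloor> - 2 powr (1 - real n / 2)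
      \<le> measure_pmf.expectation (random_hom n d) (\<lambda>f. real (card (Rng n f)))"
proof -
  obtain \<delta> where \<delta>: "\<delta> > 0"
    "\<forall>n d. even n \<and> n > 0 \<and> d > 0 \<and> \<delta> * torus_scale n d \<ge> 1 \<longrightarrow>
      measure_pmf.prob (random_hom n d) {f. int (card (Rng n f)) < 3 + \<lfloor>\<delta> * torus_scale n d\<rfloor>} \<le> 1 / 2"
    using prob_small_range[of "1 / 2"] by auto
  show ?thesis
  \<comment> \<open>For \<open>s < 8\<close> the floor vanishes and the case \<open>m = 3\<close>
    gives exactly the error term; for \<open>s \<ge> 8\<close> the bound
    \<open>m / 2 + 1 \<ge> 2 + s / 2\<close> exceeds \<open>3 + s / 8\<close>.\<close>
  proof (intro exI[of _ "\<delta> / 8"] conjI allI impI)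
    fix n d :: nat assume "even n \<and> n > 0 \<and> d > 0"
    then have n: "even n" "n > 0" and d: "d > 0" by auto
    define s where "s = \<delta> * torus_scale n d"
    let ?E = "measure_pmf.expectation (random_hom n d) (\<lambda>f. real (card (Rng n f)))"
    have s0: "s \<ge> 0" using \<delta>(1) torus_scale_nonneg by (simp add: s_def)
    show "3 + of_int \<lfloor>\<delta> / 8 * torus_scale n d\<rfloor> - 2 powr (1 - real n / 2) \<le> ?E"
    proof (cases "s < 8")
      case True
      then have "\<lfloor>\<delta> / 8 * torus_scale n d\<rfloor> = 0" using s0 by (intro floor_unique) (auto simp: s_def)
      then show ?thesis
        using expectation_card_Rng_ge[OF n, of 3 d] prob_card_Rng_less_3[OF n, of d] by simp
    next
      case False
      define m where "m = nat (3 + \<lfloor>s\<rfloor>)"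
      have m: "m \<ge> 2" "real m = 3 + of_int \<lfloor>s\<rfloor>" using s0 by (auto simp: m_def nat_add_distrib)
      have "{f. card (Rng n f) < m} = {f. int (card (Rng n f)) < 3 + \<lfloor>\<delta> * torus_scale n d\<rfloor>}"
        using s0 by (auto simp: m_def s_def)
      then have P: "measure_pmf.prob (random_hom n d) {f. card (Rng n f) < m} \<le> 1 / 2"
        using \<delta>(2) n d False by (simp add: s_def)
      have "(real m - 2) * measure_pmf.prob (random_hom n d) {f. card (Rng n f) < m} \<le> (real m - 2) * (1 / 2)"
        using m by (intro mult_left_mono P) auto
      then have "?E \<ge> real m / 2 + 1"
        using expectation_card_Rng_ge[OF n m(1), of d] by simp
      moreover have "of_int \<lfloor>\<delta> / 8 * torus_scale n d\<rfloor> \<le> s / 8"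
        using of_int_floor_le[of "s / 8"] by (simp add: s_def)
      moreover have "real m \<ge> 2 + s" using m(2) by linarith
      moreover have "2 powr (1 - real n / 2) \<ge> 0" by simp
      ultimately show ?thesis using False by linarith
    qed
  qed (use \<delta> in auto)
qed

lemma prob_lower:
  assumes "\<epsilon> > 0"
  shows "\<exists>\<delta>>0. \<forall>n d. even n \<and> n > 0 \<and> d > 0 \<longrightarrow>
    measure_pmf.prob (random_hom n d) {f. int (card (Rng n f)) < 3 + \<lfloor>\<delta> * torus_scale n d\<rfloor>}
      \<le> \<epsilon> + 2 powr (1 - real n / 2)"
proof -
  obtain \<delta> where \<delta>: "\<delta> > 0"
    "\<forall>n d. even n \<and> n > 0 \<and> d > 0 \<and> \<delta> * torus_scale n d \<ge> 1 \<longrightarrow>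
      measure_pmf.prob (random_hom n d) {f. int (card (Rng n f)) < 3 + \<lfloor>\<delta> * torus_scale n d\<rfloor>} \<le> \<epsilon>"
    using prob_small_range[OF assms] by auto
  show ?thesis
  proof (intro exI[of _ \<delta>] conjI allI impI \<delta>(1))
    fix n d :: nat assume nd: "even n \<and> n > 0 \<and> d > 0"
    show "measure_pmf.prob (random_hom n d) {f. int (card (Rng n f)) < 3 + \<lfloor>\<delta> * torus_scale n d\<rfloor>}
      \<le> \<epsilon> + 2 powr (1 - real n / 2)"
    proof (cases "\<delta> * torus_scale n d \<ge> 1")
      case True
      then show ?thesis using \<delta>(2) nd by (intro add_increasing2) auto
    next
      case False
      then have "\<lfloor>\<delta> * torus_scale n d\<rfloor> = 0" using \<delta>(1) torus_scale_nonneg[of n d] by (intro floor_unique) auto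
      then have "{f. int (card (Rng n f)) < 3 + \<lfloor>\<delta> * torus_scale n d\<rfloor>} = {f. card (Rng n f) < 3}" by auto
      then show ?thesis using prob_card_Rng_less_3[of n d] nd assms by simp
    qed
  qed
qed

lemma eventually_even_at_top: "eventually P even_at_top \<longleftrightarrow> (\<exists>N. \<forall>n\<ge>N. even n \<longrightarrow> P n)"
  by (simp add: even_at_top_def eventually_inf_principal eventually_at_top_linorder)

lemma prob_range_tendsto_0:
  assumes d: "\<forall>n. even n \<and> n > 0 \<longrightarrow> d n > 0"
    and lim: "filterlim (\<lambda>n. real (d n) - log 2 (real n)) at_bot even_at_top"
  shows "((\<lambda>n. measure_pmf.prob (random_hom n (d n)) {f. card (Rng n f) \<le> r}) \<longlongrightarrow> 0) even_at_top"
proof (rule tendstoI)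
  fix \<epsilon> :: real assume \<epsilon>: "\<epsilon> > 0"
  obtain \<delta> where \<delta>: "\<delta> > 0" "\<forall>n d. even n \<and> n > 0 \<and> d > 0 \<longrightarrow>
    measure_pmf.prob (random_hom n d) {f. int (card (Rng n f)) < 3 + \<lfloor>\<delta> * torus_scale n d\<rfloor>}
      \<le> \<epsilon> / 2 + 2 powr (1 - real n / 2)"
    using prob_lower[of "\<epsilon> / 2"] \<epsilon> by auto
  \<comment> \<open>Chosen so that a scale of at least \<open>K\<close> makes
    \<open>\<delta>\<close> times the scale at least \<open>r\<close>. As the squared scale is
    \<open>n / 2 ^ d\<close>, this means \<open>d - log 2 n \<le> - 2 * log 2 K\<close>; the maximum
    with 1 keeps the logarithm meaningful.\<close>
  define K where "K = max 1 (real r / \<delta>)"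
  have "eventually (\<lambda>n. real (d n) - log 2 (real n) \<le> - 2 * log 2 K) even_at_top"
    using lim by (simp add: filterlim_at_bot)
  moreover have "eventually (\<lambda>n. n > 0) even_at_top"
    unfolding eventually_even_at_top by (intro exI[of _ 1]) auto
  moreover have "eventually (\<lambda>n. even n) even_at_top"
    unfolding eventually_even_at_top by auto
  moreover have "eventually (\<lambda>n. 2 powr (1 - real n / 2) < \<epsilon> / 2) even_at_top"
  proof -
    have "((\<lambda>n. 2 powr (1 - real n / 2)) \<longlongrightarrow> 0) at_top"
    proof -
      have "2 powr (1 - real n / 2) = 2 * (2 powr (- 1 / 2)) ^ n" for n
      proof -
        have "(2 powr (- 1 / 2)) ^ n = (2 powr (- 1 / 2)) powr real n"
          by (simp add: powr_realpow)
        also have "\<dots> = 2 powr (- (real n / 2))" by (simp add: powr_powr)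
        finally have "2 * (2 powr (- 1 / 2)) ^ n = 2 powr (1 + - (real n / 2))"
          by (simp only: powr_add) simp
        then show ?thesis by simp
      qed
      moreover have "2 powr (- 1 / 2) < (1 :: real)" by (simp add: powr_less_one)
      then have "(\<lambda>n. 2 * (2 powr (- 1 / 2)) ^ n) \<longlonglongrightarrow> (0 :: real)"
        by (intro tendsto_mult_right_zero LIMSEQ_realpow_zero) auto
      ultimately show ?thesis by simp
    qed
    then have "eventually (\<lambda>n. 2 powr (1 - real n / 2) < \<epsilon> / 2) at_top"
      by (rule order_tendstoD) (use \<epsilon> in simp)
    then show ?thesis unfolding even_at_top_def by (rule filter_leD[rotated]) simp
  qed
  ultimately show "eventually (\<lambda>n. dist (measure_pmf.prob (random_hom n (d n)) {f. card (Rng n f) \<le> r}) 0 < \<epsilon>)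
      even_at_top"
  proof eventually_elim
    case (elim n)
    have K: "K \<ge> 1" "real r \<le> \<delta> * K" using \<delta>(1) by (auto simp: K_def max_def field_simps)
    have "2 powr (2 * log 2 K) \<le> 2 powr (log 2 (real n) - real (d n))"
      using elim(1) by (intro powr_mono) auto
    moreover have "2 powr (2 * log 2 K) = K ^ 2"
    proof -
      have "2 powr (2 * log 2 K) = (2 powr log 2 K) powr 2" by (simp add: powr_powr mult.commute)
      then show ?thesis using K(1) by (simp add: powr_realpow[of K 2, simplified])
    qed
    moreover have "2 powr (log 2 (real n) - real (d n)) = real n * 2 powr (- real (d n))"
      using elim(2) by (simp add: powr_diff powr_minus field_simps)
    ultimately have "K \<le> torus_scale n (d n)" unfolding torus_scale_def by (intro real_le_rsqrt) simp
    then have "real r \<le> \<delta> * torus_scale n (d n)"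
      using K(2) \<delta>(1) mult_left_mono[of K "torus_scale n (d n)" \<delta>] by linarith
    then have "int r \<le> \<lfloor>\<delta> * torus_scale n (d n)\<rfloor>" by (simp add: le_floor_iff)
    then have "{f. card (Rng n f) \<le> r} \<subseteq> {f. int (card (Rng n f)) < 3 + \<lfloor>\<delta> * torus_scale n (d n)\<rfloor>}"
      by auto
    then have "measure_pmf.prob (random_hom n (d n)) {f. card (Rng n f) \<le> r}
        \<le> measure_pmf.prob (random_hom n (d n)) {f. int (card (Rng n f)) < 3 + \<lfloor>\<delta> * torus_scale n (d n)\<rfloor>}"
      by (intro measure_pmf.finite_measure_mono) auto
    also have "\<dots> \<le> \<epsilon> / 2 + 2 powr (1 - real n / 2)"
      using \<delta>(2) elim(2,3) d by simp
    also have "\<dots> < \<epsilon>" using elim(4) by simp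
    finally show ?case by simp
  qed
qed

theorem theorem2p8:
  "(\<exists>C c :: real. C > 0 \<and> c > 0 \<and>
      (\<forall>n d :: nat. even n \<and> n > 0 \<and> d > 0 \<longrightarrow>
        3 + of_int \<lfloor>c * sqrt (real n * 2 powr (- real d))\<rfloor> - 2 powr (1 - real n / 2)
          \<le> measure_pmf.expectation (random_hom n d) (\<lambda>f. real (card (Rng n f))) \<and>
        measure_pmf.expectation (random_hom n d) (\<lambda>f. real (card (Rng n f)))
          \<le> C * (sqrt (real n * 2 powr (- real d)) + 1))) \<and>
   (\<forall>\<epsilon> :: real. \<epsilon> > 0 \<longrightarrow> (\<exists>\<delta> :: real. \<delta> > 0 \<and>
      (\<forall>n d :: nat. even n \<and> n > 0 \<and> d > 0 \<longrightarrow>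
        measure_pmf.prob (random_hom n d)
          {f. int (card (Rng n f)) < 3 + \<lfloor>\<delta> * sqrt (real n * 2 powr (- real d))\<rfloor>}
          \<le> \<epsilon> + 2 powr (1 - real n / 2)))) \<and>
   (\<forall>d :: nat \<Rightarrow> nat. (\<forall>n. even n \<and> n > 0 \<longrightarrow> d n > 0) \<longrightarrow>
      filterlim (\<lambda>n. real (d n) - log 2 (real n)) at_bot even_at_top \<longrightarrow>
      (\<forall>r :: nat. r > 0 \<longrightarrow>
        ((\<lambda>n. measure_pmf.prob (random_hom n (d n)) {f. card (Rng n f) \<le> r}) \<longlongrightarrow> 0)
          even_at_top))"
proof (intro conjI)
  obtain c where "c > 0" "\<forall>n d. even n \<and> n > 0 \<and> d > 0 \<longrightarrow>
    3 + of_int \<lfloor>c * torus_scale n d\<rfloor> - 2 powr (1 - real n / 2)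
      \<le> measure_pmf.expectation (random_hom n d) (\<lambda>f. real (card (Rng n f)))"
    using expectation_lower by blast
  then show "\<exists>C c :: real. C > 0 \<and> c > 0 \<and>
      (\<forall>n d :: nat. even n \<and> n > 0 \<and> d > 0 \<longrightarrow>
        3 + of_int \<lfloor>c * sqrt (real n * 2 powr (- real d))\<rfloor> - 2 powr (1 - real n / 2)
          \<le> measure_pmf.expectation (random_hom n d) (\<lambda>f. real (card (Rng n f))) \<and>
        measure_pmf.expectation (random_hom n d) (\<lambda>f. real (card (Rng n f)))
          \<le> C * (sqrt (real n * 2 powr (- real d)) + 1))"
    unfolding torus_scale_def[symmetric] using expectation_card_Rng_le
    by (intro exI[of _ 14336000000] exI[of _ c]) auto
next
  show "\<forall>\<epsilon> :: real. \<epsilon> > 0 \<longrightarrow> (\<exists>\<delta> :: real. \<delta> > 0 \<and>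
      (\<forall>n d :: nat. even n \<and> n > 0 \<and> d > 0 \<longrightarrow>
        measure_pmf.prob (random_hom n d)
          {f. int (card (Rng n f)) < 3 + \<lfloor>\<delta> * sqrt (real n * 2 powr (- real d))\<rfloor>}
          \<le> \<epsilon> + 2 powr (1 - real n / 2)))"
    unfolding torus_scale_def[symmetric] using prob_lower by blast
next
  show "\<forall>d :: nat \<Rightarrow> nat. (\<forall>n. even n \<and> n > 0 \<longrightarrow> d n > 0) \<longrightarrow>
      filterlim (\<lambda>n. real (d n) - log 2 (real n)) at_bot even_at_top \<longrightarrow>
      (\<forall>r :: nat. r > 0 \<longrightarrow>
        ((\<lambda>n. measure_pmf.prob (random_hom n (d n)) {f. card (Rng n f) \<le> r}) \<longlongrightarrow> 0)
          even_at_top)"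
    using prob_range_tendsto_0 by blast
qed

end
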